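(* Let $\{\Sigma_a\}_{a\in(0,1/2)}$ be the family of embedded free boundary minimal annuli of revolution in the geodesic balls $B(R(a))\subset\mathbb{S}^3$ defined in the context, with radius map $R$ and parametric fields $\varphi_a$. Then: (i) the radius map $R$ is real-analytic on $(0,\tfrac12)$, satisfies $R>\tfrac\pi2$ there, and $$\lim_{a\to 0^+}R(a)=\lim_{a\to(1/2)^-}R(a)=\frac\pi2;$$ in particular $R$ is non-monotone, it attains an interior maximum, and it is not injective; (ii) for every $\rho\in\bigl(\tfrac\pi2,\max R\bigr)$ the geodesic ball $B(\rho)\subset\mathbb{S}^3$ contains at least two, and at most finitely many, mutually non-congruent embedded free boundary minimal annuli of the family (i.e. annuli $\Sigma_a$ with $R(a)=\rho$); (iii) at every critical point $a_*$ of $R$, and in particular at an interior maximum, the annulus $\Sigma_{a_*}$ is degenerate modulo the ambient isometries preserving the ball, with $\operatorname{nul}(\Sigma_{a_*})\ge 3$: the Jacobi--Robin kernel of $\Sigma_{a_*}$ contains the nonzero, rotationally invariant, reflection-even field $\varphi_{a_*}$, and $\varphi_{a_*}$ is not induced by any Killing field of $\mathbb{S}^3$ whose flow preserves $B(R(a_* ))$; (iv) the critical set $\{a\in(0,\tfrac12): R'(a)=0\}$ is discrete, and for every $a\in(0,\tfrac12)$ outside it $\dim\mathcal{K}_0^{\mathrm{ev}}(\Sigma_a)=0$.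
   Context: Ambient. $\mathbb{S}^3\subset\mathbb{R}^4$ is the round unit sphere, $p_0=(1,0,0,0)$, $\rho=\operatorname{dist}(p_0,\cdot)$, $B(r)$ is the closed geodesic ball of radius $r\in(0,\pi)$ centred at $p_0$, $S(r)=\partial B(r)$. A free boundary minimal surface in $B(r)$ is a compact two-sided minimal immersed surface in $B(r)$ with boundary on $S(r)$, meeting $S(r)$ orthogonally, i.e. its outward unit conormal $\eta$ equals $\partial_\rho$ along its boundary. For a unit normal $\nu$, $A(X,Y)=\langle\overline\nabla_X\nu,Y\rangle$, where $\overline\nabla$ is the Levi-Civita connection of $\mathbb{S}^3$. The family. For $a\in(0,\tfrac12)$ put $\lambda_a(s)=\tfrac12-a\cos 2s$, $z_a(s)=(\tfrac12+a\cos2s)^{1/2}$, $c(a)=(\tfrac14-a^2)^{1/2}$, $\omega(a,t)=\dfrac{c(a)}{z_a(t)\lambda_a(t)}$, $\beta(a,s)=\int_0^s\omega(a,t)\,dt$, $x_a=\lambda_a^{1/2}\cos\beta(a,\cdot)$, $y_a=\lambda_a^{1/2}\sin\beta(a,\cdot)$, and $$X_a(s,\theta)=\bigl(x_a(s),y_a(s),z_a(s)\cos\theta,z_a(s)\sin\theta\bigr),$$ a minimal immersion of $\mathbb{R}\times\mathbb{S}^1$ into $\mathbb{S}^3$ with induced metric $ds^2+z_a^2d\theta^2$. Let $G_a=y_a\dot z_a-z_a\dot y_a$ (dot $=d/ds$); $G_a$ has exactly one zero in $(0,\tfrac\pi2]$, denoted $s_1(a)$. $\Sigma_a$ is the restriction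 of $X_a$ to $[-s_1(a),s_1(a)]\times\mathbb{S}^1$; it is an embedded free boundary minimal annulus in $B(R(a))$, where $R(a)=\arccos x_a(s_1(a))\in(0,\pi)$. Parametric field. Let $\Psi_a(\tau,\theta)=X_a(s_1(a)\tau,\theta)$ on $[-1,1]\times\mathbb{S}^1$, let $\nu_a$ be a unit normal of $\Psi_a$ chosen smoothly in $a$, and $\varphi_a=\langle\partial_a\Psi_a,\nu_a\rangle$. Kernel. For a free boundary minimal surface $\Sigma\subset B(r)\subset\mathbb{S}^3$, the Jacobi--Robin kernel is $\mathcal{K}(\Sigma,r)=\{u\in C^\infty(\Sigma):\Delta u+(|A|^2+2)u=0,\ \partial_\eta u-\cot(r)u=0\text{ on }\partial\Sigma\}$ and $\operatorname{nul}(\Sigma)=\dim\mathcal{K}(\Sigma,r)$. A field $u\in \mathcal K(\Sigma,r)$ is induced by a Killing field $Z$ whose flow preserves $B(r)$ if $u=\langle Z,\nu\rangle$. $\Sigma$ is degenerate modulo the ambient isometries preserving the ball if $\mathcal{K}(\Sigma,r)$ contains an element not induced by any Killing field of $\mathbb{S}^3$ whose flow preserves $B(r)$. Rotationally invariant means independent of $\theta$; reflection-even means even in $s$ (equivalently in $\tau$). $\mathcal{K}_0^{\mathrm{ev}}(\Sigma_a)$ is the space of rotationally invariant, reflection-even elements of $\mathcal{K}(\Sigma_a,R(a))$. Congruent means related by an isometry of $\mathbb{S}^3$. *)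

theory Defs
  imports "HOL-Analysis.Analysis" "HOL-Library.Function_Algebras" "HOL-Library.Extended_Nat"
begin

primrec Ck :: "nat \<Rightarrow> 'a::real_normed_vector set \<Rightarrow> ('a \<Rightarrow> 'b::real_normed_vector) \<Rightarrow> bool" where
  "Ck 0 S f \<longleftrightarrow> continuous_on S f"
| "Ck (Suc k) S f \<longleftrightarrow>
     (\<exists>D. (\<forall>x\<in>S. (f has_derivative D x) (at x within S)) \<and> (\<forall>v. Ck k S (\<lambda>x. D x v)))"

text \<open>Used for open sets, for products of intervals and lines (one-sided derivatives at the
  boundary, so this is smoothness up to the boundary) and for the unit sphere. In the last case
  the derivative within the sphere is determined only on tangent vectors, and \<^term>\<open>D\<close>
  in \<^const>\<open>Ck\<close> is any choice of its extension to normal vectors.\<close>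

definition smooth :: "'a::real_normed_vector set \<Rightarrow> ('a \<Rightarrow> 'b::real_normed_vector) \<Rightarrow> bool" where
  "smooth S f \<longleftrightarrow> (\<forall>k. Ck k S f)"

definition real_analytic_on :: "real set \<Rightarrow> (real \<Rightarrow> real) \<Rightarrow> bool" where
  "real_analytic_on S f \<longleftrightarrow>
     (\<forall>x\<in>S. \<exists>c r. r > 0 \<and> (\<forall>h. \<bar>h\<bar> < r \<longrightarrow> (\<lambda>n. c n * h ^ n) sums f (x + h)))"

global_interpretation real_fun: vector_space "\<lambda>(c::real) (f::'a \<Rightarrow> real). (\<lambda>x. c * f x)"
  by unfold_locales (auto simp: fun_eq_iff algebra_simps)

text \<open>The dimension of a space of real functions, with value \<open>\<infinity>\<close> for
  infinite-dimensional spaces (where the library's \<open>dim\<close> would return 0).\<close>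

definition fun_dim :: "('a \<Rightarrow> real) set \<Rightarrow> enat" where
  "fun_dim V = (SUP B \<in> {B. finite B \<and> B \<subseteq> V \<and> real_fun.independent B}. enat (card B))"

abbreviation S3 :: "(real^4) set" where "S3 \<equiv> sphere 0 1"

definition p0 :: "real^4" where "p0 = vector [1, 0, 0, 0]"

definition sdist :: "real^4 \<Rightarrow> real^4 \<Rightarrow> real" where
  "sdist p q = arccos (p \<bullet> q)"

definition gball :: "real \<Rightarrow> (real^4) set" where
  "gball r = {p \<in> S3. sdist p0 p \<le> r}"

definition gsphere :: "real \<Rightarrow> (real^4) set" where
  "gsphere r = {p \<in> S3. sdist p0 p = r}"

text \<open>The gradient of \<open>sdist p0\<close>, i.e. the velocity at \<open>p\<close> of the unit speed
  geodesic \<open>cos t p0 + sin t e\<close> from \<open>p0\<close> to \<open>p\<close>.\<close>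

definition d_rho :: "real^4 \<Rightarrow> real^4" where
  "d_rho p = (cos (sdist p0 p) *\<^sub>R p - p0) /\<^sub>R sin (sdist p0 p)"

definition S3_isometry :: "(real^4 \<Rightarrow> real^4) \<Rightarrow> bool" where
  "S3_isometry f \<longleftrightarrow> f ` S3 = S3 \<and> (\<forall>p\<in>S3. \<forall>q\<in>S3. sdist (f p) (f q) = sdist p q)"

definition congruent_sets :: "(real^4) set \<Rightarrow> (real^4) set \<Rightarrow> bool" where
  "congruent_sets A B \<longleftrightarrow> (\<exists>f. S3_isometry f \<and> f ` A = B)"

text \<open>The Levi-Civita connection of the sphere is the tangential part of the flat derivative; the
  tangential projection disappears in inner products with tangent vectors.\<close>

definition killing_field :: "(real^4 \<Rightarrow> real^4) \<Rightarrow> bool" where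
  "killing_field Z \<longleftrightarrow> smooth S3 Z \<and> (\<forall>p\<in>S3. Z p \<bullet> p = 0) \<and>
     (\<forall>p\<in>S3. \<forall>X Y. X \<bullet> p = 0 \<longrightarrow> Y \<bullet> p = 0 \<longrightarrow>
        frechet_derivative Z (at p within S3) X \<bullet> Y
          + X \<bullet> frechet_derivative Z (at p within S3) Y = 0)"

definition integral_curve :: "(real^4 \<Rightarrow> real^4) \<Rightarrow> (real \<Rightarrow> real^4) \<Rightarrow> bool" where
  "integral_curve Z \<gamma> \<longleftrightarrow>
     (\<forall>t. \<gamma> t \<in> S3 \<and> (\<gamma> has_vector_derivative Z (\<gamma> t)) (at t))"

definition flow_preserves :: "(real^4 \<Rightarrow> real^4) \<Rightarrow> (real^4) set \<Rightarrow> bool" where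
  "flow_preserves Z B \<longleftrightarrow> (\<forall>\<gamma>. integral_curve Z \<gamma> \<and> \<gamma> 0 \<in> B \<longrightarrow> (\<forall>t. \<gamma> t \<in> B))"

text \<open>An annulus \<open>[-1,1] \<times> S\<^sup>1\<close> is represented by the strip \<open>strip\<close>, with maps
  that are \<open>2\<pi>\<close>-periodic in the second coordinate. Only values on \<open>strip\<close> matter, and all
  derivatives are taken within \<open>strip\<close>.\<close>

definition strip :: "(real^2) set" where
  "strip = {p. \<bar>p $ 1\<bar> \<le> 1}"

definition bdry :: "(real^2) set" where
  "bdry = {p. \<bar>p $ 1\<bar> = 1}"

definition periodic :: "(real^2 \<Rightarrow> 'b) \<Rightarrow> bool" where
  "periodic f \<longleftrightarrow> (\<forall>p\<in>strip. f (p + axis 2 (2 * pi)) = f p)"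

definition pushfwd :: "(real^2 \<Rightarrow> 'b::real_normed_vector) \<Rightarrow> real^2 \<Rightarrow> real^2 \<Rightarrow> 'b" where
  "pushfwd f p = frechet_derivative f (at p within strip)"

definition pd :: "2 \<Rightarrow> (real^2 \<Rightarrow> 'b::real_normed_vector) \<Rightarrow> real^2 \<Rightarrow> 'b" where
  "pd i f p = pushfwd f p (axis i 1)"

definition immersed_annulus :: "(real^2 \<Rightarrow> real^4) \<Rightarrow> bool" where
  "immersed_annulus F \<longleftrightarrow> smooth strip F \<and> periodic F \<and> F ` strip \<subseteq> S3 \<and>
     (\<forall>p\<in>strip. inj (pushfwd F p))"

definition embedded_annulus :: "(real^2 \<Rightarrow> real^4) \<Rightarrow> bool" where
  "embedded_annulus F \<longleftrightarrow> immersed_annulus F \<and>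
     (\<forall>p\<in>strip. \<forall>q\<in>strip. F p = F q \<longrightarrow>
        p $ 1 = q $ 1 \<and> (\<exists>k::int. p $ 2 - q $ 2 = 2 * pi * of_int k))"

definition metric :: "(real^2 \<Rightarrow> real^4) \<Rightarrow> real^2 \<Rightarrow> real^2^2" where
  "metric F p = (\<chi> i j. pd i F p \<bullet> pd j F p)"

definition metric_inv :: "(real^2 \<Rightarrow> real^4) \<Rightarrow> real^2 \<Rightarrow> real^2^2" where
  "metric_inv F p = matrix_inv (metric F p)"

definition unit_normal :: "(real^2 \<Rightarrow> real^4) \<Rightarrow> (real^2 \<Rightarrow> real^4) \<Rightarrow> bool" where
  "unit_normal F \<nu> \<longleftrightarrow> smooth strip \<nu> \<and> periodic \<nu> \<and>
     (\<forall>p\<in>strip. norm (\<nu> p) = 1 \<and> \<nu> p \<bullet> F p = 0 \<and> (\<forall>i. \<nu> p \<bullet> pd i F p = 0))"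

text \<open>The bilinear form \<open>A(X,Y) = \<langle>\<nabla>\<^sub>X \<nu>, Y\<rangle>\<close> in coordinates.\<close>

definition sff :: "(real^2 \<Rightarrow> real^4) \<Rightarrow> (real^2 \<Rightarrow> real^4) \<Rightarrow> real^2 \<Rightarrow> real^2^2" where
  "sff F \<nu> p = (\<chi> i j. pd i \<nu> p \<bullet> pd j F p)"

definition mean_curvature :: "(real^2 \<Rightarrow> real^4) \<Rightarrow> (real^2 \<Rightarrow> real^4) \<Rightarrow> real^2 \<Rightarrow> real" where
  "mean_curvature F \<nu> p = (\<Sum>i\<in>UNIV. \<Sum>j\<in>UNIV. metric_inv F p $ i $ j * sff F \<nu> p $ i $ j)"

definition sff_norm2 :: "(real^2 \<Rightarrow> real^4) \<Rightarrow> (real^2 \<Rightarrow> real^4) \<Rightarrow> real^2 \<Rightarrow> real" where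
  "sff_norm2 F \<nu> p = (\<Sum>i\<in>UNIV. \<Sum>j\<in>UNIV. \<Sum>k\<in>UNIV. \<Sum>l\<in>UNIV.
     metric_inv F p $ i $ k * metric_inv F p $ j $ l * sff F \<nu> p $ i $ j * sff F \<nu> p $ k $ l)"

definition laplacian :: "(real^2 \<Rightarrow> real^4) \<Rightarrow> (real^2 \<Rightarrow> real) \<Rightarrow> real^2 \<Rightarrow> real" where
  "laplacian F u p = (\<Sum>i\<in>UNIV.
      pd i (\<lambda>q. sqrt (det (metric F q)) * (\<Sum>j\<in>UNIV. metric_inv F q $ i $ j * pd j u q)) p)
    / sqrt (det (metric F p))"

text \<open>The outward unit conormal on \<open>bdry\<close>, as a vector in coordinates: the normalised
  gradient of the first coordinate, with the sign of that coordinate.\<close>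

definition conormal :: "(real^2 \<Rightarrow> real^4) \<Rightarrow> real^2 \<Rightarrow> real^2" where
  "conormal F p = (\<chi> i. sgn (p $ 1) * metric_inv F p $ 1 $ i / sqrt (metric_inv F p $ 1 $ 1))"

definition free_boundary_minimal_annulus :: "real \<Rightarrow> (real^2 \<Rightarrow> real^4) \<Rightarrow> bool" where
  "free_boundary_minimal_annulus r F \<longleftrightarrow> 0 < r \<and> r < pi \<and> immersed_annulus F \<and>
     F ` strip \<subseteq> gball r \<and> F ` bdry \<subseteq> gsphere r \<and>
     (\<exists>\<nu>. unit_normal F \<nu> \<and> (\<forall>p\<in>strip. mean_curvature F \<nu> p = 0)) \<and>
     (\<forall>p\<in>bdry. pushfwd F p (conormal F p) = d_rho (F p))"

text \<open>Functions on the annulus are normalised to vanish outside \<open>strip\<close>, so that distinct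
  functions on \<open>real^2\<close> stand for distinct functions on the annulus. On an annulus the unit
  normal is unique up to sign, on which neither \<open>|A|\<^sup>2\<close> nor the notion of being induced
  by a Killing field depends.\<close>

definition annulus_functions :: "(real^2 \<Rightarrow> real) set" where
  "annulus_functions = {u. smooth strip u \<and> periodic u \<and> (\<forall>p. p \<notin> strip \<longrightarrow> u p = 0)}"

definition jacobi_robin_kernel :: "(real^2 \<Rightarrow> real^4) \<Rightarrow> real \<Rightarrow> (real^2 \<Rightarrow> real) set" where
  "jacobi_robin_kernel F r = {u \<in> annulus_functions.
     (\<exists>\<nu>. unit_normal F \<nu> \<and>
        (\<forall>p\<in>strip. laplacian F u p + (sff_norm2 F \<nu> p + 2) * u p = 0)) \<and>
     (\<forall>p\<in>bdry. pushfwd u p (conormal F p) - cot r * u p = 0)}"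

definition nul :: "(real^2 \<Rightarrow> real^4) \<Rightarrow> real \<Rightarrow> enat" where
  "nul F r = fun_dim (jacobi_robin_kernel F r)"

definition killing_induced :: "(real^2 \<Rightarrow> real^4) \<Rightarrow> real \<Rightarrow> (real^2 \<Rightarrow> real) \<Rightarrow> bool" where
  "killing_induced F r u \<longleftrightarrow> (\<exists>Z \<nu>. killing_field Z \<and> flow_preserves Z (gball r) \<and>
     unit_normal F \<nu> \<and> (\<forall>p\<in>strip. u p = Z (F p) \<bullet> \<nu> p))"

definition degenerate :: "(real^2 \<Rightarrow> real^4) \<Rightarrow> real \<Rightarrow> bool" where
  "degenerate F r \<longleftrightarrow> (\<exists>u \<in> jacobi_robin_kernel F r. \<not> killing_induced F r u)"

definition rotation_invariant :: "(real^2 \<Rightarrow> real) \<Rightarrow> bool" where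
  "rotation_invariant u \<longleftrightarrow> (\<forall>p q. p $ 1 = q $ 1 \<longrightarrow> u p = u q)"

definition reflection_even :: "(real^2 \<Rightarrow> real) \<Rightarrow> bool" where
  "reflection_even u \<longleftrightarrow> (\<forall>s \<theta>. u (vector [- s, \<theta>]) = u (vector [s, \<theta>]))"

definition kernel_ev :: "(real^2 \<Rightarrow> real^4) \<Rightarrow> real \<Rightarrow> (real^2 \<Rightarrow> real) set" where
  "kernel_ev F r = {u \<in> jacobi_robin_kernel F r. rotation_invariant u \<and> reflection_even u}"

definition lam :: "real \<Rightarrow> real \<Rightarrow> real" where
  "lam a s = 1/2 - a * cos (2 * s)"

definition zz :: "real \<Rightarrow> real \<Rightarrow> real" where
  "zz a s = sqrt (1/2 + a * cos (2 * s))"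

definition cc :: "real \<Rightarrow> real" where
  "cc a = sqrt (1/4 - a\<^sup>2)"

definition omega :: "real \<Rightarrow> real \<Rightarrow> real" where
  "omega a t = cc a / (zz a t * lam a t)"

definition beta :: "real \<Rightarrow> real \<Rightarrow> real" where
  "beta a s = (LBINT t=ereal 0..ereal s. omega a t)"

definition xx :: "real \<Rightarrow> real \<Rightarrow> real" where
  "xx a s = sqrt (lam a s) * cos (beta a s)"

definition yy :: "real \<Rightarrow> real \<Rightarrow> real" where
  "yy a s = sqrt (lam a s) * sin (beta a s)"

definition X_imm :: "real \<Rightarrow> real^2 \<Rightarrow> real^4" where
  "X_imm a p = vector [xx a (p $ 1), yy a (p $ 1),
                       zz a (p $ 1) * cos (p $ 2), zz a (p $ 1) * sin (p $ 2)]"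

definition GG :: "real \<Rightarrow> real \<Rightarrow> real" where
  "GG a s = yy a s * deriv (zz a) s - zz a s * deriv (yy a) s"

definition s1 :: "real \<Rightarrow> real" where
  "s1 a = (THE s. 0 < s \<and> s \<le> pi / 2 \<and> GG a s = 0)"

definition Rad :: "real \<Rightarrow> real" where
  "Rad a = arccos (xx a (s1 a))"

definition Sigma_set :: "real \<Rightarrow> (real^4) set" where
  "Sigma_set a = X_imm a ` {p. \<bar>p $ 1\<bar> \<le> s1 a}"

text \<open>\<open>\<Psi>\<^sub>a\<close> is the surface \<open>\<Sigma>\<^sub>a\<close> parametrised over the fixed domain \<open>strip\<close>.\<close>

definition Psi :: "real \<Rightarrow> real^2 \<Rightarrow> real^4" where
  "Psi a p = X_imm a (vector [s1 a * p $ 1, p $ 2])"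

definition smooth_normal_family :: "(real \<Rightarrow> real^2 \<Rightarrow> real^4) \<Rightarrow> bool" where
  "smooth_normal_family \<nu> \<longleftrightarrow> (\<forall>a\<in>{0<..<1/2}. unit_normal (Psi a) (\<nu> a)) \<and>
     smooth ({0<..<1/2} \<times> strip) (\<lambda>(a, p). \<nu> a p)"

definition phi :: "(real \<Rightarrow> real^2 \<Rightarrow> real^4) \<Rightarrow> real \<Rightarrow> real^2 \<Rightarrow> real" where
  "phi \<nu> a p = (if p \<in> strip then vector_derivative (\<lambda>b. Psi b p) (at a) \<bullet> \<nu> a p else 0)"

end

theory Submission
  imports Defs "HOL-Complex_Analysis.Cauchy_Integral_Formula"
begin

text \<open>
  The profile curve \<open>\<gamma> = (x, y, z)\<close> of \<open>\<Sigma>\<^sub>a\<close> has unit speed on the unit sphere of three-space.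
  With \<open>S = a sin 2s\<close> and \<open>L = \<surd>\<lambda>\<close> everything about it follows from \<open>L\<^sup>2 + z\<^sup>2 = 1\<close> and
  \<open>S\<^sup>2 + c\<^sup>2 = L\<^sup>2 z\<^sup>2\<close>: with \<open>n = \<gamma> \<times> \<gamma>'\<close> one has \<open>n' = - (c / z\<^sup>2) \<gamma>'\<close>, so the surface is minimal with
  \<open>|A|\<^sup>2 = 2 c\<^sup>2 / z\<^sup>4\<close>, and the first component of \<open>n\<close> is the function \<open>G\<close> whose zero defines the boundary.

  \<^emph>\<open>The radius.\<close> Since \<open>(z G)' = y\<close> and \<open>0 < \<beta> < \<pi>\<close> on \<open>(0, \<pi>/2]\<close>, the zero \<open>s\<^sub>1\<close> is unique, and \<open>G = 0\<close> gives
  \<open>R = \<pi>/2 + arctan (S / z\<^sup>2)\<close> at \<open>s\<^sub>1\<close> (\<open>Rad_eq\<close>). Hence \<open>R > \<pi>/2\<close>, and \<open>R\<close> tends to \<open>\<pi>/2\<close> as \<open>a\<close> tends to 0.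
  As \<open>a\<close> tends to 1/2 one uses \<open>R \<le> \<beta>(\<pi>/2)\<close> and the bound \<open>\<beta>(\<pi>/2) \<le> \<pi>/2 + \<surd>c \<pi>/2\<close> (\<open>B_pi_half_le\<close>), which comes from
  integrating \<open>c / \<lambda>\<close> and \<open>c / z\<^sup>2\<close> explicitly. The integral \<open>\<beta>\<close> extends holomorphically to complex \<open>a\<close> and \<open>s\<close>, so
  \<open>s\<^sub>1\<close>, and with it \<open>R\<close>, is real-analytic by an implicit function theorem (\<open>holomorphic_implicit_function\<close>).
  The remaining claims on \<open>R\<close>, its level sets and its critical set hold for every analytic function on an interval
  that lies above its common limit at the two ends (locale \<open>analytic_hump\<close>).

  \<^emph>\<open>Non-congruence.\<close> The points of \<open>\<Sigma>\<^sub>a\<close> whose antipode also lies in \<open>\<Sigma>\<^sub>a\<close> form two parallel circles. An isometry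
  between two members of the family matches these circles, hence preserves the plane of rotation, hence the maximal
  distance \<open>\<surd>(1/2 + a)\<close> from its orthogonal complement (\<open>congruent_imp_le\<close>).

  \<^emph>\<open>Degeneracy.\<close> The normal part of the variation of the family is the even profile \<open>ww\<close>
  (\<open>variation_field\<close>). It solves the Jacobi equation, is positive at \<open>s = 0\<close>, and by \<open>Rad_deriv\<close> satisfies
  \<open>w' - cot(R) w = - (c / z\<^sup>2) R'\<close> at the boundary; so it lies in the kernel when \<open>R' = 0\<close>. Together with
  \<open>x' cos \<theta>\<close> and \<open>x' sin \<theta>\<close>, which come from rotations fixing the centre of the ball, it gives nullity at
  least three. It is not induced by a Killing field \<open>Z\<close>: the product of \<open>Z\<close> with the velocity of a great circle is
  constant, and the normal great circles at two opposite points of the central circle \<open>s = 0\<close> pass through \<open>p\<^sub>0\<close> in opposite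
  directions, so an induced rotationally invariant field vanishes on this circle. Finally, an even rotationally
  invariant element of the kernel is a solution of a second-order linear equation with vanishing derivative at
  \<open>s = 0\<close>, hence a multiple of \<open>ww\<close>, and the Robin condition excludes nonzero multiples when \<open>R' \<noteq> 0\<close>
  (\<open>even_solution_vanishes\<close>).
\<close>

section \<open>Real-analytic functions of one variable\<close>

lemma power_series_of_holomorphic:
  fixes f :: "real \<Rightarrow> real"
  assumes "F holomorphic_on ball (of_real x) r"
    and "\<And>h. \<bar>h\<bar> < r \<Longrightarrow> f (x + h) = Re (F (of_real (x + h)))"
  shows "\<exists>c. \<forall>h. \<bar>h\<bar> < r \<longrightarrow> (\<lambda>n. c n * h ^ n) sums f (x + h)"
proof (intro exI allI impI)
  fix h :: real assume h: "\<bar>h\<bar> < r"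
  let ?c = "\<lambda>n. (deriv ^^ n) F (of_real x) / fact n"
  have "of_real (x + h) \<in> ball (of_real x :: complex) r"
    using h by (simp add: dist_norm)
  from holomorphic_power_series[OF assms(1) this]
  have "(\<lambda>n. ?c n * of_real h ^ n) sums F (of_real (x + h))" by simp
  then have "(\<lambda>n. Re (?c n * of_real h ^ n)) sums Re (F (of_real (x + h)))"
    by (rule sums_Re)
  moreover have "Re (z * of_real h ^ n) = Re z * h ^ n" for n z
    by (simp flip: of_real_power)
  ultimately show "(\<lambda>n. Re (?c n) * h ^ n) sums f (x + h)"
    unfolding assms(2)[OF h] by (simp only:)
qed

lemma real_analytic_on_differentiable:
  assumes "real_analytic_on S f" "x \<in> S"
  shows "f field_differentiable (at x)"
proof -
  obtain c r where r: "r > 0" and s: "\<And>h. \<bar>h\<bar> < r \<Longrightarrow> (\<lambda>n. c n * h ^ n) sums f (x + h)"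
    using assms unfolding real_analytic_on_def by blast
  have "((\<lambda>h. f (x + h)) has_field_derivative (\<Sum>n. diffs c n * 0 ^ n)) (at 0)"
  proof -
    have "((\<lambda>h. \<Sum>n. c n * h ^ n) has_field_derivative (\<Sum>n. diffs c n * 0 ^ n)) (at 0)"
      by (rule termdiffs_strong'[where K = r]) (use r s in \<open>auto simp: sums_iff\<close>)
    then show ?thesis
    proof (rule has_field_derivative_transform_within_open[where S = "ball 0 r"])
      show "(\<Sum>n. c n * h ^ n) = f (x + h)" if "h \<in> ball 0 r" for h
        using s[of h] that by (simp add: sums_iff dist_norm)
    qed (use r in auto)
  qed
  then have "(f has_field_derivative (\<Sum>n. diffs c n * 0 ^ n)) (at x)"
    using DERIV_shift[of f _ 0 x] by (simp add: add.commute)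
  then show ?thesis by (auto simp: field_differentiable_def)
qed

text \<open>Termwise differentiation of the local power series.\<close>

lemma real_analytic_on_deriv:
  assumes "real_analytic_on S f" "open S"
  shows "real_analytic_on S (deriv f)"
  unfolding real_analytic_on_def
proof
  fix x assume x: "x \<in> S"
  obtain c r where r: "r > 0" and s: "\<And>h. \<bar>h\<bar> < r \<Longrightarrow> (\<lambda>n. c n * h ^ n) sums f (x + h)"
    using assms x unfolding real_analytic_on_def by blast
  obtain e where e: "e > 0" "ball x e \<subseteq> S"
    using assms(2) x openE by blast
  have "(\<lambda>n. diffs c n * h ^ n) sums deriv f (x + h)" if h: "\<bar>h\<bar> < min r e" for h
  proof (rule termdiffs_sums_strong[where K = r and f = "\<lambda>h. f (x + h)"])
    have "x + h \<in> S" using e h by (auto simp: dist_norm subset_iff)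
    then have "(f has_field_derivative deriv f (x + h)) (at (x + h))"
      using real_analytic_on_differentiable[OF assms(1)] field_differentiable_derivI by blast
    then show "((\<lambda>h. f (x + h)) has_field_derivative deriv f (x + h)) (at h)"
      by (simp add: DERIV_shift add.commute)
  qed (use s h in auto)
  then show "\<exists>c r. r > 0 \<and> (\<forall>h. \<bar>h\<bar> < r \<longrightarrow> (\<lambda>n. c n * h ^ n) sums deriv f (x + h))"
    using r e by (intro exI[of _ "diffs c"] exI[of _ "min r e"]) auto
qed

lemma real_analytic_on_add_const:
  assumes "real_analytic_on S f"
  shows "real_analytic_on S (\<lambda>x. f x + k)"
  unfolding real_analytic_on_def
proof
  fix x assume "x \<in> S"
  then obtain c r where r: "r > 0" and s: "\<And>h. \<bar>h\<bar> < r \<Longrightarrow> (\<lambda>n. c n * h ^ n) sums f (x + h)"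
    using assms unfolding real_analytic_on_def by blast
  have "(\<lambda>n. (c n + (if n = 0 then k else 0)) * h ^ n) sums (f (x + h) + k)" if "\<bar>h\<bar> < r" for h
  proof -
    have "(\<lambda>n. if n = 0 then k else 0) sums k" by (rule sums_single[where i = 0, simplified])
    from sums_add[OF s[OF that] this]
    show ?thesis by (rule back_subst[where P = "\<lambda>g. g sums _"]) (auto simp: fun_eq_iff algebra_simps)
  qed
  then show "\<exists>c r. r > 0 \<and> (\<forall>h. \<bar>h\<bar> < r \<longrightarrow> (\<lambda>n. c n * h ^ n) sums (f (x + h) + k))"
    using r by (intro exI[of _ "\<lambda>n. c n + (if n = 0 then k else 0)"] exI[of _ r]) auto
qed

text \<open>Either all coefficients of the local power series vanish, or the first nonzero one dominates near
  the centre.\<close>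

lemma real_analytic_zero_dichotomy:
  assumes "real_analytic_on S f" "x \<in> S"
  shows "(\<forall>\<^sub>F y in nhds x. f y = 0) \<or> (\<forall>\<^sub>F y in at x. f y \<noteq> 0)"
proof -
  obtain c r where r: "r > 0" and s: "\<And>h. \<bar>h\<bar> < r \<Longrightarrow> (\<lambda>n. c n * h ^ n) sums f (x + h)"
    using assms unfolding real_analytic_on_def by blast
  have s': "(\<lambda>n. c n * (y - x) ^ n) sums f y" if "norm (y - x) < r" for y
    using s[of "y - x"] that by simp
  show ?thesis
  proof (cases "f x = 0")
    case False
    have "isCont f x"
      using real_analytic_on_differentiable[OF assms] field_differentiable_imp_continuous_at by blast
    then have "\<forall>\<^sub>F y in at x. f y \<noteq> 0"
      using False by (simp add: isCont_def tendsto_imp_eventually_ne)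
    then show ?thesis ..
  next
    case True
    have c0: "c 0 = 0" using s'[of x] r True by (simp add: sums_iff)
    show ?thesis
    proof (cases "\<forall>m. c m = 0")
      case True
      have "f y = 0" if "dist y x < r" for y
        using s'[of y] that True by (simp add: sums_iff dist_norm)
      then show ?thesis using r by (auto simp: eventually_nhds_metric)
    next
      case False
      then obtain m where m: "c m \<noteq> 0" by blast
      then have "m > 0" using c0 by (cases m) auto
      obtain d where d: "0 < d" "\<And>z. z \<in> cball x d - {x} \<Longrightarrow> f z \<noteq> 0"
        using powser_0_nonzero[OF r s' \<open>f x = 0\<close> m \<open>m > 0\<close>] by blast
      then have "\<forall>\<^sub>F y in at x. f y \<noteq> 0"
        unfolding eventually_at by (intro exI[of _ d]) (auto simp: dist_commute)
      then show ?thesis ..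
    qed
  qed
qed

text \<open>The points near which \<open>f\<close> vanishes identically and the points near which it has
  no other zero form a partition of \<open>S\<close> into two open sets.\<close>

lemma real_analytic_isolated_zeros:
  assumes an: "real_analytic_on S f" and S: "open S" "connected S"
    and nz: "\<exists>x\<in>S. f x \<noteq> 0" and x: "x \<in> S"
  shows "\<forall>\<^sub>F y in at x. f y \<noteq> 0"
proof (rule ccontr)
  assume neg: "\<not> ?thesis"
  define Z where "Z = {x \<in> S. \<forall>\<^sub>F y in nhds x. f y = 0}"
  define N where "N = {x \<in> S. \<forall>\<^sub>F y in at x. f y \<noteq> 0}"
  have "open Z"
  proof (subst open_subopen, intro ballI)
    fix z assume "z \<in> Z"
    then have "\<forall>\<^sub>F y in nhds z. y \<in> S \<and> (\<forall>\<^sub>F y in nhds y. f y = 0)"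
      unfolding Z_def using S(1) eventually_nhds_in_open[of S z]
      by (auto simp: eventually_eventually intro!: eventually_conj)
    then show "\<exists>T. open T \<and> z \<in> T \<and> T \<subseteq> Z"
      unfolding Z_def eventually_nhds by auto
  qed
  moreover have "open N"
  proof (subst open_subopen, intro ballI)
    fix z assume z: "z \<in> N"
    then have "\<forall>\<^sub>F y in nhds z. y \<noteq> z \<longrightarrow> f y \<noteq> 0"
      by (simp add: N_def eventually_at_filter)
    then obtain T where T: "open T" "z \<in> T" "\<And>y. y \<in> T \<Longrightarrow> y \<noteq> z \<Longrightarrow> f y \<noteq> 0"
      unfolding eventually_nhds by blast
    have "T \<inter> S \<subseteq> N"
    proof
      fix y assume y: "y \<in> T \<inter> S"
      show "y \<in> N"
      proof (cases "y = z")
        case False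
        have "\<forall>\<^sub>F w in nhds y. w \<in> T - {z}"
          by (rule eventually_nhds_in_open) (use T y False in auto)
        then have "\<forall>\<^sub>F w in at y. f w \<noteq> 0"
          unfolding eventually_at_filter by (rule eventually_mono) (use T in auto)
        then show ?thesis using y by (simp add: N_def)
      qed (use z in simp)
    qed
    then show "\<exists>T. open T \<and> z \<in> T \<and> T \<subseteq> N"
      using T S(1) z by (intro exI[of _ "T \<inter> S"]) (auto simp: N_def)
  qed
  moreover have "S \<subseteq> Z \<union> N"
    using real_analytic_zero_dichotomy[OF an] by (auto simp: Z_def N_def)
  moreover have "Z \<inter> N \<inter> S = {}"
  proof -
    have False if "y \<in> Z" "y \<in> N" for y
    proof -
      have "\<forall>\<^sub>F w in at y. f w = 0 \<and> f w \<noteq> 0"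
        using that by (auto simp: Z_def N_def eventually_at_filter elim: eventually_elim2)
      then show False by simp
    qed
    then show ?thesis by blast
  qed
  moreover have "x \<in> Z" using neg x real_analytic_zero_dichotomy[OF an x] by (auto simp: Z_def)
  ultimately have "N \<inter> S = {}"
    using S(2) x unfolding connected_def by blast
  then have "S \<subseteq> Z" using \<open>S \<subseteq> Z \<union> N\<close> by blast
  then show False using nz by (auto simp: Z_def dest: eventually_nhds_x_imp_x)
qed

section \<open>A holomorphic implicit function theorem\<close>

lemma has_derivative_of_partials:
  fixes H :: "'a::real_normed_field \<Rightarrow> 'a \<Rightarrow> 'a"
  assumes "open A" "open W" "x \<in> A" "y \<in> W"
    and x: "\<And>x y. x \<in> A \<Longrightarrow> y \<in> W \<Longrightarrow> ((\<lambda>x. H x y) has_field_derivative Hx x y) (at x)"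
    and y: "\<And>x y. x \<in> A \<Longrightarrow> y \<in> W \<Longrightarrow> ((\<lambda>y. H x y) has_field_derivative Hy x y) (at y)"
    and cont: "continuous_on (A \<times> W) (\<lambda>(x, y). Hy x y)"
  shows "((\<lambda>(x, y). H x y) has_derivative (\<lambda>(dx, dy). Hx x y * dx + Hy x y * dy)) (at (x, y))"
proof -
  obtain e where e: "e > 0" "ball y e \<subseteq> W" using assms openE by blast
  have "((\<lambda>(x, y). H x y) has_derivative (\<lambda>(dx, dy). Hx x y * dx + blinfun_mult_right (Hy x y) dy))
      (at (x, y) within A \<times> ball y e)"
  proof (rule has_derivative_partialsI)
    show "((\<lambda>x. H x y) has_derivative (*) (Hx x y)) (at x within A)"
      using x[OF assms(3,4)] by (auto simp: has_field_derivative_def intro: has_derivative_at_withinI)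
    show "((\<lambda>y. H x' y) has_derivative blinfun_apply (blinfun_mult_right (Hy x' y'))) (at y' within ball y e)"
      if "x' \<in> A" "y' \<in> ball y e" for x' y'
    proof -
      have "y' \<in> W" using that e by blast
      from y[OF that(1) this] show ?thesis
        unfolding has_field_derivative_def blinfun_mult_right.rep_eq by (rule has_derivative_at_withinI)
    qed
    have "continuous (at (x, y) within A \<times> W) (\<lambda>(x, y). Hy x y)"
      using cont assms(3,4) by (auto simp: continuous_on_eq_continuous_within)
    then have "((\<lambda>(x, y). Hy x y) \<longlongrightarrow> Hy x y) (at (x, y) within A \<times> ball y e)"
      unfolding continuous_within using e by (auto intro: tendsto_within_subset)
    then have "((\<lambda>p. blinfun_mult_right (case p of (x, y) \<Rightarrow> Hy x y)) \<longlongrightarrow> blinfun_mult_right (Hy x y))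
        (at (x, y) within A \<times> ball y e)"
      by (rule bounded_linear.tendsto[OF bounded_linear_blinfun_mult_right])
    then show "continuous (at (x, y) within A \<times> ball y e) (\<lambda>(x, y). blinfun_mult_right (Hy x y))"
      unfolding continuous_within by (simp add: case_prod_unfold)
  qed (use e in auto)
  moreover have "at (x, y) within A \<times> ball y e = at (x, y)"
    by (rule at_within_open) (use assms e in \<open>auto intro: open_Times\<close>)
  ultimately show ?thesis by simp
qed

text \<open>The inverse function theorem for \<open>(x, y) \<mapsto> (x, H x y)\<close> gives a real differentiable
  solution; differentiating \<open>H x (g x) = 0\<close> shows that its derivative is complex linear.\<close>

lemma holomorphic_implicit_function:
  fixes H :: "complex \<Rightarrow> complex \<Rightarrow> complex"
  assumes A: "open A" and W: "open W" and x0: "x0 \<in> A" and y0: "y0 \<in> W"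
    and Hx: "\<And>x y. x \<in> A \<Longrightarrow> y \<in> W \<Longrightarrow> ((\<lambda>x. H x y) has_field_derivative Hx x y) (at x)"
    and Hy: "\<And>x y. x \<in> A \<Longrightarrow> y \<in> W \<Longrightarrow> ((\<lambda>y. H x y) has_field_derivative Hy x y) (at y)"
    and contx: "continuous_on (A \<times> W) (\<lambda>(x, y). Hx x y)"
    and conty: "continuous_on (A \<times> W) (\<lambda>(x, y). Hy x y)"
    and zero: "H x0 y0 = 0" and nz: "Hy x0 y0 \<noteq> 0"
  obtains r e g where "r > 0" "e > 0" "ball x0 r \<subseteq> A" "ball y0 e \<subseteq> W"
    "\<And>x. x \<in> ball x0 r \<Longrightarrow> g x \<in> W"
    "\<And>x. x \<in> ball x0 r \<Longrightarrow> (g has_field_derivative - Hx x (g x) / Hy x (g x)) (at x)"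
    "\<And>x y. x \<in> ball x0 r \<Longrightarrow> y \<in> ball y0 e \<Longrightarrow> H x y = 0 \<Longrightarrow> y = g x"
proof -
  define P where "P = (\<lambda>(x, y). (x, H x y))"
  define P' where "P' = (\<lambda>p. Blinfun (\<lambda>(dx, dy). (dx, Hx (fst p) (snd p) * dx + Hy (fst p) (snd p) * dy)))"
  define U where "U = {p \<in> A \<times> W. Hy (fst p) (snd p) \<noteq> 0}"
  have bl: "bounded_linear (\<lambda>(dx, dy). (dx, a * dx + b * dy))" for a b :: complex
    unfolding case_prod_unfold by (intro bounded_linear_intros)
  have P': "blinfun_apply (P' p) = (\<lambda>(dx, dy). (dx, Hx (fst p) (snd p) * dx + Hy (fst p) (snd p) * dy))" for p
    unfolding P'_def by (rule bounded_linear_Blinfun_apply[OF bl])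
  have openU: "open U"
  proof -
    have "open ((A \<times> W) \<inter> (\<lambda>(x, y). Hy x y) -` (- {0}))"
      by (rule continuous_open_preimage[OF conty open_Times[OF A W]]) auto
    also have "(A \<times> W) \<inter> (\<lambda>(x, y). Hy x y) -` (- {0}) = U"
      by (auto simp: U_def)
    finally show ?thesis .
  qed
  have der: "(P has_derivative blinfun_apply (P' p)) (at p)" if "p \<in> U" for p
  proof -
    obtain x y where p: "p = (x, y)" by (cases p)
    have "x \<in> A" "y \<in> W" using that by (auto simp: U_def p)
    then have "((\<lambda>(x, y). H x y) has_derivative (\<lambda>(dx, dy). Hx x y * dx + Hy x y * dy)) (at (x, y))"
      by (rule has_derivative_of_partials[OF A W _ _ Hx Hy conty])
    then show ?thesis unfolding P_def P' p
      by (auto simp: case_prod_unfold intro!: derivative_eq_intros)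
  qed
  have cont: "continuous_on U P'"
  proof (rule continuous_on_blinfun_componentwise)
    fix i :: "complex \<times> complex"
    have "U \<subseteq> A \<times> W" by (auto simp: U_def)
    then have "continuous_on U (\<lambda>p. Hx (fst p) (snd p))" "continuous_on U (\<lambda>p. Hy (fst p) (snd p))"
      using contx conty by (auto simp: case_prod_unfold intro: continuous_on_subset)
    then show "continuous_on U (\<lambda>p. P' p i)"
      unfolding P' case_prod_unfold by (intro continuous_intros)
  qed
  define a b where "a = Hx x0 y0" and "b = Hy x0 y0"
  define Q where "Q = Blinfun (\<lambda>(dx, dy). (dx, (- a / b) * dx + (1 / b) * dy))"
  have Q: "blinfun_apply Q = (\<lambda>(dx, dy). (dx, (- a / b) * dx + (1 / b) * dy))"
    unfolding Q_def by (rule bounded_linear_Blinfun_apply[OF bl])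
  have invQ: "Q o\<^sub>L P' (x0, y0) = id_blinfun"
    by (rule blinfun_eqI) (use nz in \<open>auto simp: Q P' a_def b_def field_simps\<close>)
  have "(x0, y0) \<in> U" using x0 y0 nz by (simp add: U_def)
  obtain U' V G and G' :: "complex \<times> complex \<Rightarrow> complex \<times> complex \<Rightarrow> complex \<times> complex" where inv:
      "open U'" "U' \<subseteq> U" "(x0, y0) \<in> U'" "open V" "P (x0, y0) \<in> V"
      "homeomorphism U' V P G" "\<And>v. v \<in> V \<Longrightarrow> (G has_derivative G' v) (at v)"
    by (rule inverse_function_theorem[OF openU der cont \<open>(x0, y0) \<in> U\<close> invQ], assumption, rule that) assumption+
  define g where "g = (\<lambda>x. snd (G (x, 0)))"
  have P0: "P (x0, y0) = (x0, 0)" by (simp add: P_def zero)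
  obtain r1 where r1: "r1 > 0" "\<And>x. x \<in> ball x0 r1 \<Longrightarrow> (x, 0) \<in> V"
  proof -
    have "open ((\<lambda>x. (x, 0)) -` V)"
      by (intro open_vimage continuous_intros) fact
    moreover have "x0 \<in> (\<lambda>x. (x, 0)) -` V" using inv(5) P0 by simp
    ultimately show ?thesis using that by (meson openE subsetD vimageD)
  qed
  obtain r2 e where r2: "r2 > 0" "e > 0" "ball x0 r2 \<times> ball y0 e \<subseteq> U'"
  proof -
    obtain S T where ST: "open S" "open T" "x0 \<in> S" "y0 \<in> T" "S \<times> T \<subseteq> U'"
      by (rule open_prod_elim[OF inv(1,3)]) auto
    obtain r2 e where "r2 > 0" "ball x0 r2 \<subseteq> S" "e > 0" "ball y0 e \<subseteq> T"
      using openE[OF ST(1,3)] openE[OF ST(2,4)] by metis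
    then show ?thesis using that[of r2 e] ST(5) Sigma_mono[of "ball x0 r2" S] by blast
  qed
  define r where "r = min r1 r2"
  have sol: "g x \<in> W" "H x (g x) = 0" "x \<in> A" "Hy x (g x) \<noteq> 0" if "x \<in> ball x0 r" for x
  proof -
    have V: "(x, 0) \<in> V" using that r1 by (simp add: r_def)
    then have "G (x, 0) \<in> U'" "P (G (x, 0)) = (x, 0)"
      using inv(6) by (auto simp: homeomorphism_def)
    then show "g x \<in> W" "H x (g x) = 0" "x \<in> A" "Hy x (g x) \<noteq> 0"
      using inv(2) by (cases "G (x, 0)"; auto simp: P_def U_def g_def)+
  qed
  have "(g has_field_derivative - Hx x (g x) / Hy x (g x)) (at x)" if x: "x \<in> ball x0 r" for x
  proof -
    have "(G has_derivative G' (x, 0)) (at (x, 0))" using inv(7) r1 x by (simp add: r_def)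
    then have "((\<lambda>x. G (x, 0)) has_derivative (\<lambda>d. G' (x, 0) (d, 0))) (at x)"
      by (rule has_derivative_compose[rotated]) (auto intro!: derivative_eq_intros)
    then have g: "(g has_derivative (\<lambda>d. snd (G' (x, 0) (d, 0)))) (at x)"
      unfolding g_def by (rule has_derivative_snd)
    let ?T = "\<lambda>d. snd (G' (x, 0) (d, 0))"
    have H': "((\<lambda>(x, y). H x y) has_derivative (\<lambda>(dx, dy). Hx x (g x) * dx + Hy x (g x) * dy)) (at (x, g x))"
      using sol[OF x] by (intro has_derivative_of_partials[OF A W _ _ Hx Hy conty])
    have xg: "((\<lambda>x. (x, g x)) has_derivative (\<lambda>d. (d, ?T d))) (at x)"
      by (intro has_derivative_Pair has_derivative_ident g)
    have "((\<lambda>x. H x (g x)) has_derivative (\<lambda>d. Hx x (g x) * d + Hy x (g x) * ?T d)) (at x)"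
      using has_derivative_compose[OF xg H'] by simp
    moreover have "((\<lambda>x. H x (g x)) has_derivative (\<lambda>_. 0)) (at x)"
      by (rule has_derivative_transform_within_open[where s = "ball x0 r" and f = "\<lambda>_. 0"])
         (use x sol in auto)
    ultimately have "(\<lambda>d. Hx x (g x) * d + Hy x (g x) * ?T d) = (\<lambda>_. 0)"
      by (rule has_derivative_unique)
    then have "Hx x (g x) * d + Hy x (g x) * ?T d = 0" for d
      by (simp add: fun_eq_iff)
    then have "?T d = (- Hx x (g x) / Hy x (g x)) * d" for d
      using sol(4)[OF x] by (simp add: field_simps eq_neg_iff_add_eq_0)
    then have "?T = (*) (- Hx x (g x) / Hy x (g x))" by (rule ext)
    with g show ?thesis unfolding has_field_derivative_def by (simp only:)
  qed
  moreover have "y = g x" if "x \<in> ball x0 r" "y \<in> ball y0 e" "H x y = 0" for x y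
  proof -
    have "(x, y) \<in> U'" using that r2 by (auto simp: r_def)
    then have "G (P (x, y)) = (x, y)" using inv(6) by (auto simp: homeomorphism_def)
    then show ?thesis using that by (simp add: P_def g_def)
  qed
  moreover have "ball y0 e \<subseteq> W"
  proof
    fix y assume "y \<in> ball y0 e"
    then have "(x0, y) \<in> ball x0 r2 \<times> ball y0 e" using r2(1) by simp
    then have "(x0, y) \<in> U" using r2(3) inv(2) by blast
    then show "y \<in> W" by (simp add: U_def)
  qed
  moreover have "ball x0 r \<subseteq> A" using sol by auto
  ultimately show thesis using that[of r e g] sol r1 r2 by (auto simp: r_def)
qed

section \<open>The angle function and its complex extension\<close>

locale annulus_parameter =
  fixes a :: real
  assumes a_pos: "0 < a" and a_less: "a < 1/2"
begin

abbreviation z where "z \<equiv> zz a"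
abbreviation c where "c \<equiv> cc a"

lemma abs_a_cos_less: "\<bar>a * cos (2 * s)\<bar> < 1/2"
proof -
  have "\<bar>a * cos (2 * s)\<bar> \<le> a"
    using a_pos by (simp add: abs_mult mult_left_le)
  then show ?thesis using a_less by linarith
qed

lemma lam_pos: "0 < lam a s" and zz_arg_pos: "0 < 1/2 + a * cos (2 * s)"
  using abs_a_cos_less[of s] by (auto simp: lam_def)

lemma cc_arg_pos: "0 < 1/4 - a\<^sup>2"
proof -
  have "a * a < (1/2) * (1/2)" using a_pos a_less by (intro mult_strict_mono) auto
  then show ?thesis by (simp add: power2_eq_square)
qed

lemma zz_pos: "0 < z s" and zz_sq: "(z s)\<^sup>2 = 1/2 + a * cos (2 * s)"
  and cc_pos: "0 < c" and cc_sq: "c\<^sup>2 = 1/4 - a\<^sup>2"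
  using zz_arg_pos[of s] cc_arg_pos by (auto simp: zz_def cc_def)

lemma lam_eq: "lam a s = 1 - (z s)\<^sup>2"
  by (simp add: lam_def zz_sq)

lemma nonzero [simp]: "z s \<noteq> 0" "c \<noteq> 0" "lam a s \<noteq> 0"
  using zz_pos[of s] cc_pos lam_pos[of s] by auto

lemma continuous_omega: "continuous_on S (omega a)"
proof -
  have "z s * lam a s \<noteq> 0" for s by simp
  then show ?thesis
    unfolding omega_def[abs_def] zz_def[abs_def] lam_def[abs_def] by (intro continuous_intros) blast
qed

end

lemma interval_integral_has_derivative:
  fixes f :: "real \<Rightarrow> real"
  assumes "continuous_on UNIV f"
  shows "((\<lambda>s. LBINT t=ereal 0..ereal s. f t) has_real_derivative f s) (at s)"
proof -
  have "\<And>x. isCont f x" using assms by (simp add: continuous_on_eq_continuous_at)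
  then obtain F where F: "\<And>x. (F has_vector_derivative f x) (at x)"
    using einterval_antiderivative[of "-\<infinity>" "\<infinity>" f] by auto
  have "(LBINT t=ereal 0..ereal s. f t) = F s - F 0" for s
    by (rule interval_integral_FTC_finite)
       (use assms F in \<open>auto intro: continuous_on_subset has_vector_derivative_at_within\<close>)
  then show ?thesis
    using F[of s] by (auto simp: has_real_derivative_iff_has_vector_derivative intro!: derivative_eq_intros)
qed

text \<open>\<open>omega_a\<close> is \<open>\<partial>\<omega>/\<partial>a\<close>, written as \<open>\<omega>\<close> times the logarithmic derivative of
  \<open>c / (z \<lambda>)\<close>; accordingly \<open>beta_a\<close> is \<open>\<partial>\<beta>/\<partial>a\<close>.\<close>

definition omega_a :: "real \<Rightarrow> real \<Rightarrow> real" where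
  "omega_a a t = omega a t * (- a / (1/4 - a\<^sup>2) - cos (2 * t) / (2 * (1/2 + a * cos (2 * t)))
     + cos (2 * t) / (1/2 - a * cos (2 * t)))"

definition beta_a :: "real \<Rightarrow> real \<Rightarrow> real" where
  "beta_a a s = (LBINT t=ereal 0..ereal s. omega_a a t)"

lemma beta_0 [simp]: "beta a 0 = 0" and beta_a_0 [simp]: "beta_a a 0 = 0"
  by (simp_all add: beta_def beta_a_def)

context annulus_parameter
begin

lemma beta_deriv: "(beta a has_real_derivative omega a s) (at s)"
  unfolding beta_def[abs_def] by (rule interval_integral_has_derivative[OF continuous_omega])

lemma continuous_omega_a: "continuous_on S (omega_a a)"
proof -
  have "1/4 - a\<^sup>2 \<noteq> 0" "2 * (1/2 + a * cos (2 * s)) \<noteq> 0" "1/2 - a * cos (2 * s) \<noteq> 0" for s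
    using zz_arg_pos[of s] cc_arg_pos nonzero(3)[of s] unfolding lam_def by auto
  then show ?thesis
    unfolding omega_a_def[abs_def] by (intro continuous_intros continuous_omega) blast+
qed

lemma beta_a_deriv: "(beta_a a has_real_derivative omega_a a s) (at s)"
  unfolding beta_a_def[abs_def] by (rule interval_integral_has_derivative[OF continuous_omega_a])

end

definition omegaC :: "complex \<Rightarrow> complex \<Rightarrow> complex" where
  "omegaC a t = csqrt (1/4 - a\<^sup>2) / (csqrt (1/2 + a * cos (2 * t)) * (1/2 - a * cos (2 * t)))"

definition omegaC_a :: "complex \<Rightarrow> complex \<Rightarrow> complex" where
  "omegaC_a a t = omegaC a t * (- a / (1/4 - a\<^sup>2) - cos (2 * t) / (2 * (1/2 + a * cos (2 * t)))
     + cos (2 * t) / (1/2 - a * cos (2 * t)))"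

definition omegaC_s :: "complex \<Rightarrow> complex \<Rightarrow> complex" where
  "omegaC_s a t = omegaC a t * (a * sin (2 * t) / (1/2 + a * cos (2 * t))
     - 2 * a * sin (2 * t) / (1/2 - a * cos (2 * t)))"

text \<open>The substitution \<open>t \<mapsto> s t\<close> moves the endpoint of the integral into the integrand, so that one
  integral over a fixed interval can be differentiated in \<open>a\<close> and in \<open>s\<close>.\<close>

definition betaC :: "complex \<Rightarrow> complex \<Rightarrow> complex" where
  "betaC a s = integral (cbox 0 1) (\<lambda>t. s * omegaC a (s * of_real t))"

definition betaC_a :: "complex \<Rightarrow> complex \<Rightarrow> complex" where
  "betaC_a a s = integral (cbox 0 1) (\<lambda>t. s * omegaC_a a (s * of_real t))"

lemma logarithmic_derivative_quotient:
  fixes q p m :: "'a::real_normed_field \<Rightarrow> 'a"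
  assumes "(q has_field_derivative q') (at x)" "(p has_field_derivative p') (at x)"
    "(m has_field_derivative m') (at x)" "q x \<noteq> 0" "p x \<noteq> 0" "m x \<noteq> 0"
  shows "((\<lambda>x. q x / (p x * m x)) has_field_derivative
    q x / (p x * m x) * (q' / q x - p' / p x - m' / m x)) (at x)"
  by (rule derivative_eq_intros assms refl)+ (use assms(4-6) in \<open>simp_all add: field_simps\<close>)

text \<open>On \<open>|a| < \<rho>\<close>, \<open>|Im s| < \<delta>\<close> the number \<open>a cos 2s\<close> has modulus at most \<open>\<rho> e\<^bsup>2\<delta>\<^esup> < 1/2\<close>, so that
  \<open>1/2 \<plusminus> a cos 2s\<close> and \<open>1/4 - a\<^sup>2\<close> have positive real part and the principal square roots are holomorphic.
  Both factors of the domain are convex, as differentiation under the integral sign requires, and the second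
  one contains with \<open>s\<close> the segment from 0 to \<open>s\<close>, along which one integrates.\<close>

locale complex_domain =
  fixes \<rho> \<delta> :: real
  assumes \<rho>: "0 < \<rho>" and \<delta>: "0 < \<delta>" and small: "\<rho> * exp (2 * \<delta>) < 1/2"
begin

definition A :: "complex set" where "A = ball 0 \<rho>"
definition W :: "complex set" where "W = {s. \<bar>Im s\<bar> < \<delta>}"

lemma open_A: "open A" and convex_A: "convex A" and open_W: "open W" and convex_W: "convex W"
proof -
  have W: "W = {s. Im s < \<delta>} \<inter> {s. Im s > - \<delta>}" by (auto simp: W_def)
  show "open W" "convex W" unfolding W
    by (auto intro!: open_Int convex_Int open_halfspace_Im_lt open_halfspace_Im_gt
        convex_halfspace_Im_lt convex_halfspace_Im_gt)
qed (auto simp: A_def)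

lemma mult_mem_W: "s \<in> W \<Longrightarrow> 0 \<le> t \<Longrightarrow> t \<le> 1 \<Longrightarrow> s * of_real t \<in> W"
proof -
  assume *: "s \<in> W" "0 \<le> t" "t \<le> 1"
  then have "t * \<bar>Im s\<bar> \<le> 1 * \<bar>Im s\<bar>" by (intro mult_right_mono) auto
  then show ?thesis using * by (simp add: W_def abs_mult mult.commute)
qed

lemma of_real_mem_W [simp]: "of_real s \<in> W"
  using \<delta> by (simp add: W_def)

lemma bounds:
  assumes "a \<in> A" "s \<in> W"
  shows "0 < Re (1/2 + a * cos (2 * s))" "0 < Re (1/2 - a * cos (2 * s))" "0 < Re (1/4 - a\<^sup>2)"
proof -
  have "exp \<bar>Im (2 * s)\<bar> < exp (2 * \<delta>)" using assms by (simp add: W_def)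
  then have "cmod (cos (2 * s)) < exp (2 * \<delta>)"
    using cmod_cos_le_exp[of 1 "2 * s"] by (auto intro: le_less_trans)
  moreover have a: "cmod a < \<rho>" using assms by (simp add: A_def)
  ultimately have "cmod a * cmod (cos (2 * s)) \<le> \<rho> * exp (2 * \<delta>)"
    using \<rho> by (intro mult_mono) auto
  then have *: "cmod (a * cos (2 * s)) < 1/2" using small by (simp add: norm_mult)
  then show "0 < Re (1/2 + a * cos (2 * s))" "0 < Re (1/2 - a * cos (2 * s))"
    using abs_Re_le_cmod[of "a * cos (2 * s)"] by (auto simp: Re_divide_numeral abs_less_iff)
  have "\<rho> * 1 \<le> \<rho> * exp (2 * \<delta>)" using \<rho> \<delta> by (intro mult_left_mono) auto
  then have "cmod a < 1/2" using a small by simp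
  then have "cmod a * cmod a < (1/2) * (1/2)" by (intro mult_strict_mono) auto
  then have "cmod (a\<^sup>2) < 1/4" by (simp add: norm_mult power2_eq_square)
  then show "0 < Re (1/4 - a\<^sup>2)"
    using complex_Re_le_cmod[of "a\<^sup>2"] by (simp add: Re_divide_numeral)
qed

lemma nonpos_iff: "0 < Re w \<Longrightarrow> w \<notin> \<real>\<^sub>\<le>\<^sub>0" "0 < Re w \<Longrightarrow> w \<noteq> 0"
  by (auto simp: complex_nonpos_Reals_iff)

lemmas slit = bounds[THEN nonpos_iff(1)]
lemmas nonzero = bounds[THEN nonpos_iff(2)]

lemma omegaC_has_derivative_a:
  assumes "a \<in> A" "s \<in> W"
  shows "((\<lambda>a. omegaC a s) has_field_derivative omegaC_a a s) (at a)"
proof -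
  note nz = nonzero[OF assms] and sl = slit[OF assms]
  have q: "((\<lambda>a. csqrt (1/4 - a\<^sup>2)) has_field_derivative - a / csqrt (1/4 - a\<^sup>2)) (at a)"
    by (rule derivative_eq_intros refl sl(3))+ (simp add: divide_simps)
  have p: "((\<lambda>a. csqrt (1/2 + a * cos (2 * s))) has_field_derivative
      cos (2 * s) / (2 * csqrt (1/2 + a * cos (2 * s)))) (at a)"
    by (rule derivative_eq_intros refl sl(1))+ (simp add: divide_simps)
  have m: "((\<lambda>a. 1/2 - a * cos (2 * s)) has_field_derivative - cos (2 * s)) (at a)"
    by (auto intro!: derivative_eq_intros)
  have sq: "csqrt w * csqrt w = w" for w by (simp flip: power2_eq_square)
  show ?thesis unfolding omegaC_def
    by (rule DERIV_cong[OF logarithmic_derivative_quotient[OF q p m]])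
       (use nz in \<open>simp_all add: omegaC_a_def omegaC_def sq mult.assoc\<close>)
qed

lemma omegaC_has_derivative_s:
  assumes "a \<in> A" "s \<in> W"
  shows "((\<lambda>s. omegaC a s) has_field_derivative omegaC_s a s) (at s)"
proof -
  note nz = nonzero[OF assms] and sl = slit[OF assms]
  have q: "((\<lambda>s. csqrt (1/4 - a\<^sup>2)) has_field_derivative 0) (at s)"
    by simp
  have p: "((\<lambda>s. csqrt (1/2 + a * cos (2 * s))) has_field_derivative
      - a * sin (2 * s) / csqrt (1/2 + a * cos (2 * s))) (at s)"
    by (rule derivative_eq_intros refl sl(1))+ (simp add: divide_simps)
  have m: "((\<lambda>s. 1/2 - a * cos (2 * s)) has_field_derivative 2 * a * sin (2 * s)) (at s)"
    by (auto intro!: derivative_eq_intros)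
  have sq: "csqrt w * csqrt w = w" for w by (simp flip: power2_eq_square)
  show ?thesis unfolding omegaC_def
    by (rule DERIV_cong[OF logarithmic_derivative_quotient[OF q p m]])
       (use nz in \<open>simp_all add: omegaC_s_def omegaC_def sq mult.assoc\<close>)
qed

lemma continuous_omegaC: "continuous_on (A \<times> W) (\<lambda>p. omegaC (fst p) (snd p))"
  and continuous_omegaC_a: "continuous_on (A \<times> W) (\<lambda>p. omegaC_a (fst p) (snd p))"
  and continuous_omegaC_s: "continuous_on (A \<times> W) (\<lambda>p. omegaC_s (fst p) (snd p))"
proof -
  have sqrt: "continuous_on (A \<times> W) (\<lambda>p. csqrt (f p))"
    if "continuous_on (A \<times> W) f" "\<And>p. p \<in> A \<times> W \<Longrightarrow> f p \<notin> \<real>\<^sub>\<le>\<^sub>0" for f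
    by (rule continuous_on_compose2[OF continuous_on_csqrt that(1)]) (use that in auto)
  show *: "continuous_on (A \<times> W) (\<lambda>p. omegaC (fst p) (snd p))"
    unfolding omegaC_def by (intro continuous_intros sqrt) (use slit nonzero in auto)
  have "1/4 - (fst p)\<^sup>2 \<noteq> 0" "1/2 + fst p * cos (2 * snd p) \<noteq> 0" "1/2 - fst p * cos (2 * snd p) \<noteq> 0"
    "2 * (1/2 + fst p * cos (2 * snd p)) \<noteq> 0" if "p \<in> A \<times> W" for p
    using nonzero[of "fst p" "snd p"] that by (simp_all only: mem_Times_iff mult_eq_0_iff) auto
  note nz = this[THEN ballI]
  show "continuous_on (A \<times> W) (\<lambda>p. omegaC_a (fst p) (snd p))"
    unfolding omegaC_a_def by (intro continuous_intros * nz)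
  show "continuous_on (A \<times> W) (\<lambda>p. omegaC_s (fst p) (snd p))"
    unfolding omegaC_s_def by (intro continuous_intros * nz)
qed

lemma betaC_has_derivative_a:
  assumes "a \<in> A" "s \<in> W"
  shows "((\<lambda>a. betaC a s) has_field_derivative betaC_a a s) (at a)"
proof -
  have "((\<lambda>a. integral (cbox 0 1) (\<lambda>t. s * omegaC a (s * of_real t))) has_field_derivative
      integral (cbox 0 1) (\<lambda>t. s * omegaC_a a (s * of_real t))) (at a within A)"
  proof (rule leibniz_rule_field_derivative)
    fix a t assume at: "a \<in> A" "t \<in> cbox 0 (1::real)"
    then have "s * of_real t \<in> W" using mult_mem_W[OF assms(2)] by auto
    then show "((\<lambda>a. s * omegaC a (s * of_real t)) has_field_derivative s * omegaC_a a (s * of_real t)) (at a within A)"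
      by (rule has_field_derivative_at_within[OF DERIV_cmult[OF omegaC_has_derivative_a[OF at(1)]]])
  next
    fix a assume a: "a \<in> A"
    have "continuous_on (cbox 0 1) (\<lambda>t. s * omegaC a (s * of_real t))"
      by (rule continuous_on_mult_left, rule continuous_on_compose2[OF continuous_omegaC, where f = "\<lambda>t. (a, s * of_real t)", simplified])
         (use a mult_mem_W[OF assms(2)] in \<open>auto intro!: continuous_intros\<close>)
    then show "(\<lambda>t. s * omegaC a (s * of_real t)) integrable_on cbox 0 1" by (rule integrable_continuous)
  next
    have "continuous_on (A \<times> cbox 0 1) (\<lambda>p. s * omegaC_a (fst p) (s * of_real (snd p)))"
      by (rule continuous_on_mult_left, rule continuous_on_compose2[OF continuous_omegaC_a, where f = "\<lambda>p. (fst p, s * of_real (snd p))", simplified])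
         (use mult_mem_W[OF assms(2)] in \<open>auto intro!: continuous_intros\<close>)
    then show "continuous_on (A \<times> cbox 0 1) (\<lambda>(a, t). s * omegaC_a a (s * of_real t))"
      by (simp add: case_prod_unfold)
  qed (use assms convex_A in auto)
  then show ?thesis
    unfolding at_within_open[OF assms(1) open_A] betaC_def betaC_a_def .
qed

text \<open>The derivative of the integrand in \<open>s\<close> is the derivative in \<open>t\<close> of \<open>t \<omega>(a, s t)\<close>, so its
  integral over \<open>[0, 1]\<close> is \<open>\<omega>(a, s)\<close>.\<close>

lemma betaC_has_derivative_s:
  assumes "a \<in> A" "s \<in> W"
  shows "((\<lambda>s. betaC a s) has_field_derivative omegaC a s) (at s)"
proof -
  define f where "f = (\<lambda>s t. omegaC a (s * of_real t) + s * (of_real t * omegaC_s a (s * of_real t)))"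
  have "((\<lambda>s. integral (cbox 0 1) (\<lambda>t. s * omegaC a (s * of_real t))) has_field_derivative
      integral (cbox 0 1) (f s)) (at s within W)"
  proof (rule leibniz_rule_field_derivative)
    fix s t assume st: "s \<in> W" "t \<in> cbox 0 (1::real)"
    then have "s * of_real t \<in> W" using mult_mem_W by auto
    from omegaC_has_derivative_s[OF assms(1) this]
    have "((\<lambda>s. omegaC a (s * of_real t)) has_field_derivative omegaC_s a (s * of_real t) * of_real t) (at s)"
      by (rule DERIV_chain2) (auto intro!: derivative_eq_intros)
    then show "((\<lambda>s. s * omegaC a (s * of_real t)) has_field_derivative f s t) (at s within W)"
      unfolding f_def
      by (rule has_field_derivative_at_within[OF DERIV_cong[OF DERIV_mult[OF DERIV_ident]]])
         (simp add: algebra_simps)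
  next
    fix s assume s: "s \<in> W"
    have "continuous_on (cbox 0 1) (\<lambda>t. s * omegaC a (s * of_real t))"
      by (rule continuous_on_mult_left, rule continuous_on_compose2[OF continuous_omegaC, where f = "\<lambda>t. (a, s * of_real t)", simplified])
         (use s mult_mem_W assms in \<open>auto intro!: continuous_intros\<close>)
    then show "(\<lambda>t. s * omegaC a (s * of_real t)) integrable_on cbox 0 1" by (rule integrable_continuous)
  next
    have 1: "continuous_on (W \<times> cbox 0 1) (\<lambda>p. omegaC a (fst p * of_real (snd p)))"
      by (rule continuous_on_compose2[OF continuous_omegaC, where f = "\<lambda>p. (a, fst p * of_real (snd p))", simplified])
         (use mult_mem_W assms in \<open>auto intro!: continuous_intros\<close>)
    have 2: "continuous_on (W \<times> cbox 0 1) (\<lambda>p. omegaC_s a (fst p * of_real (snd p)))"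
      by (rule continuous_on_compose2[OF continuous_omegaC_s, where f = "\<lambda>p. (a, fst p * of_real (snd p))", simplified])
         (use mult_mem_W assms in \<open>auto intro!: continuous_intros\<close>)
    show "continuous_on (W \<times> cbox 0 1) (\<lambda>(s, t). f s t)"
      unfolding case_prod_unfold f_def by (intro continuous_intros 1 2)
  qed (use assms convex_W in auto)
  moreover have "integral (cbox 0 1) (f s) = omegaC a s"
  proof -
    have "(f s has_integral (of_real 1 * omegaC a (s * of_real 1) - of_real 0 * omegaC a (s * of_real 0))) {0..1}"
    proof (rule fundamental_theorem_of_calculus)
      fix t :: real assume t: "t \<in> {0..1}"
      then have "s * of_real t \<in> W" using mult_mem_W assms by auto
      from omegaC_has_derivative_s[OF assms(1) this]
      have "((\<lambda>w. omegaC a (s * w)) has_field_derivative omegaC_s a (s * of_real t) * s) (at (of_real t))"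
        by (rule DERIV_chain2) (auto intro!: derivative_eq_intros)
      then have "((\<lambda>w. w * omegaC a (s * w)) has_field_derivative f s t) (at (of_real t))"
        unfolding f_def
        by (rule DERIV_cong[OF DERIV_mult[OF DERIV_ident]]) (simp add: algebra_simps)
      then show "((\<lambda>t. of_real t * omegaC a (s * of_real t)) has_vector_derivative f s t) (at t within {0..1})"
        by (rule has_vector_derivative_real_field)
    qed simp
    then show ?thesis by (simp add: integral_unique)
  qed
  ultimately show ?thesis
    unfolding at_within_open[OF assms(2) open_W] betaC_def by (simp only:)
qed

lemma continuous_betaC_a: "continuous_on (A \<times> W) (\<lambda>p. betaC_a (fst p) (snd p))"
  and continuous_betaC: "continuous_on (A \<times> W) (\<lambda>p. betaC (fst p) (snd p))"
  unfolding betaC_a_def betaC_def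
proof -
  have g: "continuous_on ((A \<times> W) \<times> cbox 0 (1::real)) (\<lambda>q. (fst (fst q), snd (fst q) * of_real (snd q)))"
    by (intro continuous_intros)
  have im: "(\<lambda>q. (fst (fst q), snd (fst q) * of_real (snd q))) ` ((A \<times> W) \<times> cbox 0 (1::real)) \<subseteq> A \<times> W"
    using mult_mem_W by auto
  have "continuous_on ((A \<times> W) \<times> cbox 0 (1::real)) (\<lambda>q. snd (fst q) * omegaC_a (fst (fst q)) (snd (fst q) * of_real (snd q)))"
    using continuous_on_compose2[OF continuous_omegaC_a g im] by (auto intro!: continuous_intros)
  then show "continuous_on (A \<times> W) (\<lambda>p. integral (cbox 0 1) (\<lambda>t. snd p * omegaC_a (fst p) (snd p * of_real t)))"
    by (intro integral_continuous_on_param) (simp add: case_prod_unfold)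
  have "continuous_on ((A \<times> W) \<times> cbox 0 (1::real)) (\<lambda>q. snd (fst q) * omegaC (fst (fst q)) (snd (fst q) * of_real (snd q)))"
    using continuous_on_compose2[OF continuous_omegaC g im] by (auto intro!: continuous_intros)
  then show "continuous_on (A \<times> W) (\<lambda>p. integral (cbox 0 1) (\<lambda>t. snd p * omegaC (fst p) (snd p * of_real t)))"
    by (intro integral_continuous_on_param) (simp add: case_prod_unfold)
qed

end

lemma (in annulus_parameter) of_real_omegaC: "omegaC (of_real a) (of_real s) = of_real (omega a s)"
proof -
  have "csqrt (of_real (1/4 - a\<^sup>2)) = of_real c" "csqrt (of_real (1/2 + a * cos (2 * s))) = of_real (z s)"
    using cc_arg_pos zz_arg_pos[of s] by (simp_all only: cc_def zz_def of_real_sqrt less_imp_le)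
  moreover have "cos (2 * complex_of_real s) = of_real (cos (2 * s))"
    by (metis cos_of_real of_real_mult of_real_numeral)
  ultimately show ?thesis by (simp add: omegaC_def omega_def lam_def)
qed

lemma (in annulus_parameter) of_real_omegaC_a: "omegaC_a (of_real a) (of_real s) = of_real (omega_a a s)"
proof -
  have "cos (2 * complex_of_real s) = of_real (cos (2 * s))"
    by (metis cos_of_real of_real_mult of_real_numeral)
  then show ?thesis unfolding omegaC_a_def omega_a_def of_real_omegaC by simp
qed

lemma integral_rescaled:
  assumes "\<And>s. (F has_real_derivative f s) (at s)" "F 0 = 0" "\<And>s. g (of_real s) = complex_of_real (f s)"
  shows "integral (cbox 0 1) (\<lambda>t. of_real s * g (of_real s * of_real t)) = of_real (F s)"
proof -
  have "((\<lambda>t. of_real s * g (of_real s * of_real t)) has_integral (of_real (F (s * 1)) - of_real (F (s * 0)))) {0..1}"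
  proof (rule fundamental_theorem_of_calculus)
    fix t :: real
    have "((\<lambda>t. F (s * t)) has_real_derivative s * f (s * t)) (at t within {0..1})"
      by (rule has_field_derivative_at_within, rule DERIV_cong, rule DERIV_chain2[OF assms(1)])
         (auto intro!: derivative_eq_intros)
    then have "((\<lambda>t. complex_of_real (F (s * t))) has_vector_derivative of_real (s * f (s * t))) (at t within {0..1})"
      by (rule has_vector_derivative_of_real)
    then show "((\<lambda>t. complex_of_real (F (s * t))) has_vector_derivative of_real s * g (of_real s * of_real t)) (at t within {0..1})"
      using assms(3)[of "s * t"] by simp
  qed simp
  then have "((\<lambda>t. of_real s * g (of_real s * of_real t)) has_integral of_real (F s)) (cbox 0 1)"
    using assms(2) by simp
  then show ?thesis by (rule integral_unique)
qed

lemma (in annulus_parameter) of_real_betaC: "betaC (of_real a) (of_real s) = of_real (beta a s)"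
  unfolding betaC_def by (rule integral_rescaled[OF beta_deriv]) (simp_all add: of_real_omegaC)

lemma (in annulus_parameter) of_real_betaC_a: "betaC_a (of_real a) (of_real s) = of_real (beta_a a s)"
  unfolding betaC_a_def by (rule integral_rescaled[OF beta_a_deriv]) (simp_all add: of_real_omegaC_a)

text \<open>Any \<open>\<rho>\<close> strictly between \<open>a\<close> and 1/2 leaves room for a strip of positive width.\<close>

lemma (in annulus_parameter) complex_domain_exists:
  obtains \<rho> \<delta> where "complex_domain \<rho> \<delta>" "of_real a \<in> complex_domain.A \<rho>"
proof -
  define \<rho> where "\<rho> = (a + 1/2) / 2"
  define \<delta> where "\<delta> = ln (1 / (2 * \<rho>)) / 4"
  have r: "a < \<rho>" "0 < \<rho>" "\<rho> < 1/2" using a_pos a_less by (auto simp: \<rho>_def field_simps)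
  have d: "0 < \<delta>" using r by (simp add: \<delta>_def)
  have "2 * \<delta> < ln (1 / (2 * \<rho>))" using d r by (simp add: \<delta>_def)
  then have "exp (2 * \<delta>) < exp (ln (1 / (2 * \<rho>)))" by (subst exp_less_cancel_iff)
  then have "\<rho> * exp (2 * \<delta>) < \<rho> * (1 / (2 * \<rho>))"
    using r by (intro mult_strict_left_mono) auto
  then have cd: "complex_domain \<rho> \<delta>" using r d by unfold_locales auto
  show thesis
    by (rule that[OF cd]) (use r a_pos in \<open>simp add: complex_domain.A_def[OF cd]\<close>)
qed

text \<open>Restricting the complex derivative to real arguments avoids a second differentiation under
  the integral sign.\<close>

lemma (in annulus_parameter) beta_has_derivative_a: "((\<lambda>a. beta a s) has_real_derivative beta_a a s) (at a)"
proof -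
  obtain \<rho> \<delta> where cd: "complex_domain \<rho> \<delta>" and mem: "of_real a \<in> complex_domain.A \<rho>"
    by (rule complex_domain_exists)
  interpret complex_domain \<rho> \<delta> by fact
  have "((\<lambda>a. betaC (of_real a) (of_real s)) has_vector_derivative betaC_a (of_real a) (of_real s)) (at a)"
    by (rule has_vector_derivative_real_field, rule betaC_has_derivative_a[OF mem of_real_mem_W])
  then have "((\<lambda>a. Re (betaC (of_real a) (of_real s))) has_vector_derivative Re (betaC_a (of_real a) (of_real s))) (at a)"
    by (rule bounded_linear.has_vector_derivative[OF bounded_linear_Re])
  then have "((\<lambda>a. Re (betaC (of_real a) (of_real s))) has_real_derivative beta_a a s) (at a)"
    by (simp add: has_real_derivative_iff_has_vector_derivative of_real_betaC_a)
  then show ?thesis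
    by (rule has_field_derivative_transform_within_open[where S = "{0<..<1/2}"])
       (use a_pos a_less in \<open>auto simp: annulus_parameter.of_real_betaC annulus_parameter_def\<close>)
qed

lemma (in annulus_parameter) beta_has_derivative:
  "((\<lambda>(a, s). beta a s) has_derivative (\<lambda>(da, ds). beta_a a s * da + omega a s * ds)) (at (a, s))"
proof (rule has_derivative_of_partials[where A = "{0<..<1/2}" and W = UNIV])
  have "continuous_on ({0<..<1/2} \<times> UNIV) (\<lambda>p. omega (fst p) (snd p))"
    unfolding omega_def zz_def lam_def cc_def
  proof (intro continuous_intros)
    show "\<forall>p\<in>{0<..<1/2} \<times> UNIV. sqrt (1/2 + fst p * cos (2 * snd p)) * (1/2 - fst p * cos (2 * snd p)) \<noteq> 0"
    proof
      fix p :: "real \<times> real" assume "p \<in> {0<..<1/2} \<times> UNIV"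
      then interpret p: annulus_parameter "fst p" by (auto simp: annulus_parameter_def)
      show "sqrt (1/2 + fst p * cos (2 * snd p)) * (1/2 - fst p * cos (2 * snd p)) \<noteq> 0"
        using p.nonzero(1,3)[of "snd p"] unfolding zz_def lam_def by simp
    qed
  qed
  then show "continuous_on ({0<..<1/2} \<times> UNIV) (\<lambda>(a, s). omega a s)" by (simp add: case_prod_unfold)
qed (use a_pos a_less annulus_parameter.beta_has_derivative_a annulus_parameter.beta_deriv
      in \<open>auto simp: annulus_parameter_def\<close>)

section \<open>Explicit integrals bounding the angle\<close>

text \<open>Away from odd multiples of \<open>\<pi>/2\<close> this is, up to a locally constant multiple of \<open>\<pi>\<close>, the angle
  \<open>arctan (k tan s)\<close>; taking the difference to \<open>s\<close> inside the arctangent makes the formula smooth in \<open>s\<close> everywhere for \<open>k > 0\<close>.\<close>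

definition profile_angle_comparison :: "real \<Rightarrow> real \<Rightarrow> real" where
  "profile_angle_comparison k s =
     s + arctan ((k - 1) * (sin s * cos s) / ((cos s)\<^sup>2 + k * (sin s)\<^sup>2))"

lemma comparison_deriv:
  assumes "k > 0"
  shows "(profile_angle_comparison k has_real_derivative k / ((cos s)\<^sup>2 + k\<^sup>2 * (sin s)\<^sup>2)) (at s)"
proof -
  define u v where "u = sin s" and "v = cos s"
  have uv: "v\<^sup>2 = 1 - u\<^sup>2" by (simp add: u_def v_def cos_squared_eq)
  have sq: "u\<^sup>2 \<le> 1" using sin_squared_eq[of s] by (simp add: u_def)
  have pos: "0 < v\<^sup>2 + m * u\<^sup>2" if "m > 0" for m
  proof (cases "u = 0")
    case False
    then have "0 < m * u\<^sup>2" using that by simp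
    then show ?thesis using uv sq by linarith
  qed (use uv in simp)
  define d where "d = v\<^sup>2 + k * u\<^sup>2"
  have d: "d > 0" unfolding d_def by (rule pos[OF assms])
  have e: "v\<^sup>2 + k\<^sup>2 * u\<^sup>2 > 0" using pos[of "k\<^sup>2"] assms by simp
  have "((\<lambda>s. (k - 1) * (sin s * cos s) / ((cos s)\<^sup>2 + k * (sin s)\<^sup>2)) has_real_derivative
      ((k - 1) * (v * v - u * u) * d - (k - 1) * (u * v) * (2 * v * (- u) + k * (2 * u * v))) / (d * d)) (at s)"
    using d by (auto intro!: derivative_eq_intros simp: d_def u_def v_def algebra_simps)
  also have "((k - 1) * (v * v - u * u) * d - (k - 1) * (u * v) * (2 * v * (- u) + k * (2 * u * v))) =
      (k - 1) * (v\<^sup>2 - k * u\<^sup>2)"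
    unfolding d_def using uv by algebra
  finally have q: "((\<lambda>s. (k - 1) * (sin s * cos s) / ((cos s)\<^sup>2 + k * (sin s)\<^sup>2)) has_real_derivative
      (k - 1) * (v\<^sup>2 - k * u\<^sup>2) / (d * d)) (at s)" .
  have one: "1 + ((k - 1) * (u * v) / d)\<^sup>2 = (v\<^sup>2 + k\<^sup>2 * u\<^sup>2) / (d * d)"
  proof -
    have "d * d + ((k - 1) * (u * v))\<^sup>2 = v\<^sup>2 + k\<^sup>2 * u\<^sup>2"
      unfolding d_def using uv by algebra
    moreover have "1 + (y / d)\<^sup>2 = (d * d + y\<^sup>2) / (d * d)" for y
      using d by (simp add: power_divide power2_eq_square add_divide_distrib)
    ultimately show ?thesis by simp
  qed
  have "(profile_angle_comparison k has_real_derivative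
      1 + inverse (1 + ((k - 1) * (u * v) / d)\<^sup>2) * ((k - 1) * (v\<^sup>2 - k * u\<^sup>2) / (d * d))) (at s)"
    unfolding profile_angle_comparison_def[abs_def]
    by (rule derivative_eq_intros q refl)+ (simp add: u_def v_def d_def)
  also have "1 + inverse (1 + ((k - 1) * (u * v) / d)\<^sup>2) * ((k - 1) * (v\<^sup>2 - k * u\<^sup>2) / (d * d)) =
      k / (v\<^sup>2 + k\<^sup>2 * u\<^sup>2)"
  proof -
    have "1 + inverse (1 + ((k - 1) * (u * v) / d)\<^sup>2) * ((k - 1) * (v\<^sup>2 - k * u\<^sup>2) / (d * d)) =
        ((v\<^sup>2 + k\<^sup>2 * u\<^sup>2) + (k - 1) * (v\<^sup>2 - k * u\<^sup>2)) / (v\<^sup>2 + k\<^sup>2 * u\<^sup>2)"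
    proof -
      have "1 + inverse (w / (d * d)) * (x / (d * d)) = (w + x) / w" if "w > 0" for w x
        using d that by (simp add: field_simps)
      then show ?thesis unfolding one using e by blast
    qed
    also have "(v\<^sup>2 + k\<^sup>2 * u\<^sup>2) + (k - 1) * (v\<^sup>2 - k * u\<^sup>2) = k"
      using uv by algebra
    finally show ?thesis .
  qed
  finally show ?thesis by (simp add: u_def v_def)
qed

lemma comparison_0 [simp]: "profile_angle_comparison k 0 = 0"
  and comparison_pi_half [simp]: "profile_angle_comparison k (pi / 2) = pi / 2"
  by (simp_all add: profile_angle_comparison_def)

section \<open>The profile curve and its moving frame\<close>

text \<open>\<open>(t1, t2, t3)\<close> is \<open>\<gamma>'\<close> and \<open>(n1, n2, n3)\<close> is \<open>\<gamma> \<times> \<gamma>'\<close> for the profile curve \<open>\<gamma> = (x, y, z)\<close>.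
  The function \<open>HH\<close> is \<open>- z \<surd>\<lambda> G\<close>; unlike \<open>G\<close> it contains no derivative and extends to complex arguments.\<close>

definition SS :: "real \<Rightarrow> real \<Rightarrow> real" where "SS a s = a * sin (2 * s)"
definition CC :: "real \<Rightarrow> real \<Rightarrow> real" where "CC a s = a * cos (2 * s)"
definition LL :: "real \<Rightarrow> real \<Rightarrow> real" where "LL a s = sqrt (lam a s)"
definition HH :: "real \<Rightarrow> real \<Rightarrow> real" where
  "HH a s = SS a s * sin (beta a s) + cc a * zz a s * cos (beta a s)"

definition t1 where "t1 a s = SS a s * cos (beta a s) / LL a s - cc a * sin (beta a s) / (zz a s * LL a s)"
definition t2 where "t2 a s = SS a s * sin (beta a s) / LL a s + cc a * cos (beta a s) / (zz a s * LL a s)"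
definition t3 where "t3 a s = - SS a s / zz a s"
definition n1 where "n1 a s = - SS a s * sin (beta a s) / (zz a s * LL a s) - cc a * cos (beta a s) / LL a s"
definition n2 where "n2 a s = SS a s * cos (beta a s) / (zz a s * LL a s) - cc a * sin (beta a s) / LL a s"
definition n3 where "n3 a s = cc a / zz a s"

lemma xx_eq: "xx a s = LL a s * cos (beta a s)" and yy_eq: "yy a s = LL a s * sin (beta a s)"
  by (simp_all add: xx_def yy_def LL_def)

context annulus_parameter
begin

abbreviation S where "S \<equiv> SS a"
abbreviation C where "C \<equiv> CC a"
abbreviation L where "L \<equiv> LL a"
abbreviation B where "B \<equiv> beta a"

lemma L_pos: "0 < L s" and L_nz [simp]: "L s \<noteq> 0" and lam_L: "lam a s = (L s)\<^sup>2"
  using lam_pos[of s] by (auto simp: LL_def)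

lemma z2: "(z s)\<^sup>2 = 1/2 + C s" by (simp add: zz_sq CC_def)
lemma L2: "(L s)\<^sup>2 = 1/2 - C s" by (simp add: lam_L[symmetric] lam_def CC_def)
lemma CS: "(S s)\<^sup>2 = a\<^sup>2 - (C s)\<^sup>2"
  by (simp add: SS_def CC_def power_mult_distrib sin_squared_eq algebra_simps)
lemma SLz: "(S s)\<^sup>2 + c\<^sup>2 = (L s)\<^sup>2 * (z s)\<^sup>2"
  unfolding z2 L2 CS cc_sq by (simp add: algebra_simps power2_eq_square)
lemma Lz: "(L s)\<^sup>2 + (z s)\<^sup>2 = 1" by (simp add: z2 L2)

lemma S_deriv: "(S has_real_derivative 2 * C s) (at s)"
  and C_deriv: "(C has_real_derivative - 2 * S s) (at s)"
  unfolding SS_def[abs_def] CC_def[abs_def] by (auto intro!: derivative_eq_intros)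

lemma z_deriv: "(z has_real_derivative - S s / z s) (at s)"
proof -
  have "((\<lambda>s. sqrt (1/2 + a * cos (2 * s))) has_real_derivative - (a * sin (2 * s)) / sqrt (1/2 + a * cos (2 * s))) (at s)"
    using zz_arg_pos[of s] by (auto intro!: derivative_eq_intros simp: divide_simps)
  then show ?thesis by (simp add: zz_def[abs_def] SS_def)
qed

lemma L_deriv: "(L has_real_derivative S s / L s) (at s)"
proof -
  have "((\<lambda>s. sqrt (1/2 - a * cos (2 * s))) has_real_derivative (a * sin (2 * s)) / sqrt (1/2 - a * cos (2 * s))) (at s)"
    using lam_pos[of s] by (auto intro!: derivative_eq_intros simp: divide_simps lam_def)
  then show ?thesis by (simp add: LL_def[abs_def] lam_def SS_def)
qed

lemma B_deriv: "(B has_real_derivative c / (z s * (L s)\<^sup>2)) (at s)"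
  using beta_deriv[of s] by (simp add: omega_def lam_L)

lemmas profile_derivs = S_deriv[THEN DERIV_chain2] C_deriv[THEN DERIV_chain2] z_deriv[THEN DERIV_chain2]
  L_deriv[THEN DERIV_chain2] B_deriv[THEN DERIV_chain2]
declare profile_derivs [derivative_intros]

lemma x_deriv: "(xx a has_real_derivative t1 a s) (at s)"
  unfolding xx_eq[abs_def] t1_def
  by (rule derivative_eq_intros refl)+ (simp add: field_simps power2_eq_square)

lemma y_deriv: "(yy a has_real_derivative t2 a s) (at s)"
  unfolding yy_eq[abs_def] t2_def
  by (rule derivative_eq_intros refl)+ (simp add: field_simps power2_eq_square)

lemma z_deriv': "(z has_real_derivative t3 a s) (at s)"
  unfolding t3_def by (rule z_deriv)

text \<open>Rewriting quotients as products with inverses and adding the equations \<open>u u\<^bsup>-1\<^esup> = 1\<close> turns identities between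
  the rational expressions of this theory into ideal membership problems for polynomials.\<close>

lemmas rational = divide_inverse inverse_mult_distrib power_inverse[symmetric]

lemma inverses: "z s * inverse (z s) = 1" "L s * inverse (L s) = 1"
  by simp_all

lemmas relations = z2 L2 SLz inverses

lemma t3_deriv: "(t3 a has_real_derivative - z s + c / (z s)\<^sup>2 * n3 a s) (at s)"
  unfolding t3_def[abs_def] n3_def
  by (rule derivative_eq_intros refl | simp; fail)+
     (simp only: rational, use relations[of s] in algebra)

lemma n1_deriv: "(n1 a has_real_derivative - (c / (z s)\<^sup>2) * t1 a s) (at s)"
  unfolding n1_def[abs_def] t1_def
  by (rule derivative_eq_intros refl | simp; fail)+
     (simp only: rational, use relations[of s] in algebra)

lemma n2_deriv: "(n2 a has_real_derivative - (c / (z s)\<^sup>2) * t2 a s) (at s)"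
  unfolding n2_def[abs_def] t2_def
  by (rule derivative_eq_intros refl | simp; fail)+
     (simp only: rational, use relations[of s] in algebra)

lemma n3_deriv: "(n3 a has_real_derivative - (c / (z s)\<^sup>2) * t3 a s) (at s)"
  unfolding n3_def[abs_def] t3_def
  by (rule derivative_eq_intros refl | simp; fail)+
     (simp add: field_simps power2_eq_square)

lemma orthonormal:
  "(xx a s)\<^sup>2 + (yy a s)\<^sup>2 + (z s)\<^sup>2 = 1"
  "xx a s * t1 a s + yy a s * t2 a s + z s * t3 a s = 0"
  "(t1 a s)\<^sup>2 + (t2 a s)\<^sup>2 + (t3 a s)\<^sup>2 = 1"
  "n1 a s * xx a s + n2 a s * yy a s + n3 a s * z s = 0"
  "n1 a s * t1 a s + n2 a s * t2 a s + n3 a s * t3 a s = 0"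
  "(n1 a s)\<^sup>2 + (n2 a s)\<^sup>2 + (n3 a s)\<^sup>2 = 1"
proof -
  define u v where "u = sin (B s)" and "v = cos (B s)"
  have uv: "u\<^sup>2 + v\<^sup>2 = 1" by (simp add: u_def v_def)
  note d = xx_eq yy_eq t1_def t2_def t3_def n1_def n2_def n3_def u_def[symmetric] v_def[symmetric]
  note eqs = uv Lz[of s] SLz[of s] inverses[of s]
  show "(xx a s)\<^sup>2 + (yy a s)\<^sup>2 + (z s)\<^sup>2 = 1" unfolding d using eqs by algebra
  show "xx a s * t1 a s + yy a s * t2 a s + z s * t3 a s = 0"
    unfolding d by (simp only: rational, use eqs in algebra)
  show "(t1 a s)\<^sup>2 + (t2 a s)\<^sup>2 + (t3 a s)\<^sup>2 = 1"
    unfolding d by (simp only: rational, use eqs in algebra)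
  show "n1 a s * xx a s + n2 a s * yy a s + n3 a s * z s = 0"
    unfolding d by (simp only: rational, use eqs in algebra)
  show "n1 a s * t1 a s + n2 a s * t2 a s + n3 a s * t3 a s = 0"
    unfolding d by (simp only: rational, use eqs in algebra)
  show "(n1 a s)\<^sup>2 + (n2 a s)\<^sup>2 + (n3 a s)\<^sup>2 = 1"
    unfolding d by (simp only: rational, use eqs in algebra)
qed

lemma GG_eq: "GG a s = n1 a s"
proof -
  have "deriv z s = t3 a s" "deriv (yy a) s = t2 a s"
    by (rule DERIV_imp_deriv, rule z_deriv' y_deriv)+
  then have "GG a s = yy a s * t3 a s - z s * t2 a s" by (simp add: GG_def)
  also have "\<dots> = n1 a s"
    unfolding yy_eq t3_def t2_def n1_def by (simp only: rational, use Lz[of s] inverses[of s] in algebra)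
  finally show ?thesis .
qed

lemma n1_HH: "n1 a s = - HH a s / (z s * L s)"
  by (simp add: n1_def HH_def divide_simps algebra_simps)

section \<open>Existence and uniqueness of the boundary parameter\<close>

lemma beta_minus: "B (- s) = - B s"
proof -
  have "((\<lambda>s. B (- s) + B s) has_real_derivative 0) (at s)" for s
    by (rule derivative_eq_intros refl | simp; fail)+ (simp add: zz_def LL_def lam_def)
  then have "B (- s) + B s = B (- 0) + B 0"
    by (rule DERIV_isconst_all[rule_format])
  then show ?thesis by simp
qed

lemma beta_a_minus: "beta_a a (- s) = - beta_a a s"
proof -
  have "((\<lambda>s. beta_a a (- s) + beta_a a s) has_real_derivative 0) (at s)" for s
    by (rule derivative_eq_intros refl beta_a_deriv[THEN DERIV_chain2] | simp; fail)+
       (simp add: omega_a_def omega_def zz_def lam_def)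
  then have "beta_a a (- s) + beta_a a s = beta_a a (- 0) + beta_a a 0"
    by (rule DERIV_isconst_all[rule_format])
  then show ?thesis by simp
qed

lemma parity:
  "S (- s) = - S s" "C (- s) = C s" "z (- s) = z s" "L (- s) = L s" "lam a (- s) = lam a s"
  "xx a (- s) = xx a s" "yy a (- s) = - yy a s"
  "t1 a (- s) = - t1 a s" "t2 a (- s) = t2 a s" "t3 a (- s) = - t3 a s"
  by (simp_all add: SS_def CC_def zz_def LL_def lam_def)
     (simp_all add: xx_eq yy_eq t1_def t2_def t3_def beta_minus LL_def lam_def SS_def zz_def)

lemma B_strict_mono: "s < t \<Longrightarrow> B s < B t"
  by (rule DERIV_pos_imp_increasing) (use B_deriv zz_pos L_pos cc_pos in \<open>auto intro!: exI divide_pos_pos\<close>)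

lemma cc_less: "c < 1/2"
proof -
  have "c\<^sup>2 < (1/2)\<^sup>2" using a_pos unfolding cc_sq by (simp add: power2_eq_square)
  then show ?thesis by (rule power2_less_imp_less) simp
qed

lemma zz_less_1: "z s < 1"
proof -
  have "(z s)\<^sup>2 < 1\<^sup>2" using lam_pos[of s] by (simp add: lam_eq)
  then show ?thesis by (rule power2_less_imp_less) simp
qed

text \<open>Here \<open>\<lambda> = (1/2 - a) (cos\<^sup>2 s + k\<^sup>2 sin\<^sup>2 s)\<close> with \<open>k = c / (1/2 - a)\<close>, and \<open>z\<^sup>2\<close> is the same expression with \<open>- a\<close>
  in place of \<open>a\<close>. So \<open>c / \<lambda>\<close> and \<open>c / z\<^sup>2\<close> both have integral \<open>\<pi>/2\<close> over \<open>[0, \<pi>/2]\<close>.\<close>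

lemma comparison_lam:
  "(profile_angle_comparison (c / (1/2 - a)) has_real_derivative c / (L s)\<^sup>2) (at s)"
  and comparison_zz:
  "(profile_angle_comparison (c / (1/2 + a)) has_real_derivative c / (z s)\<^sup>2) (at s)"
proof -
  have c2: "c\<^sup>2 = (1/2 - a) * (1/2 + a)" unfolding cc_sq by (simp add: algebra_simps power2_eq_square)
  have quot: "k * (x + k * m / k\<^sup>2 * y) = k * x + m * y" "m * (x + k * m / m\<^sup>2 * y) = m * x + k * y"
    if "k \<noteq> 0" "m \<noteq> 0" for k m x y :: real
    using that by (simp_all add: field_simps power2_eq_square)
  have k: "0 < c / (1/2 - a)" "0 < c / (1/2 + a)" using cc_pos a_pos a_less by auto
  have cos2: "cos (2 * s) = (cos s)\<^sup>2 - (sin s)\<^sup>2" "(cos s)\<^sup>2 + (sin s)\<^sup>2 = 1"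
    by (simp_all add: cos_double)
  have "(1/2 - a) * ((cos s)\<^sup>2 + (c / (1/2 - a))\<^sup>2 * (sin s)\<^sup>2) = (1/2 - a) * (cos s)\<^sup>2 + (1/2 + a) * (sin s)\<^sup>2"
    unfolding power_divide c2 by (rule quot) (use a_pos a_less in auto)
  also have "\<dots> = (L s)\<^sup>2" unfolding L2 CC_def using cos2 by algebra
  finally have "c / (1/2 - a) / ((cos s)\<^sup>2 + (c / (1/2 - a))\<^sup>2 * (sin s)\<^sup>2) = c / (L s)\<^sup>2" by (metis divide_divide_eq_left)
  then show "(profile_angle_comparison (c / (1/2 - a)) has_real_derivative c / (L s)\<^sup>2) (at s)"
    using comparison_deriv[OF k(1), of s] by simp
  have "(1/2 + a) * ((cos s)\<^sup>2 + (c / (1/2 + a))\<^sup>2 * (sin s)\<^sup>2) = (1/2 + a) * (cos s)\<^sup>2 + (1/2 - a) * (sin s)\<^sup>2"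
    unfolding power_divide c2 by (rule quot) (use a_pos a_less in auto)
  also have "\<dots> = (z s)\<^sup>2" unfolding z2 CC_def using cos2 by algebra
  finally have "c / (1/2 + a) / ((cos s)\<^sup>2 + (c / (1/2 + a))\<^sup>2 * (sin s)\<^sup>2) = c / (z s)\<^sup>2" by (metis divide_divide_eq_left)
  then show "(profile_angle_comparison (c / (1/2 + a)) has_real_derivative c / (z s)\<^sup>2) (at s)"
    using comparison_deriv[OF k(2), of s] by simp
qed

text \<open>Because \<open>z < 1\<close>, the integrand \<open>c / (z \<lambda>)\<close> exceeds \<open>c / \<lambda>\<close>.\<close>

lemma B_pi_half_gt: "pi / 2 < B (pi / 2)"
proof -
  let ?P = "profile_angle_comparison (c / (1/2 - a))"
  have "B 0 - ?P 0 < B (pi / 2) - ?P (pi / 2)"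
  proof (rule DERIV_pos_imp_increasing[where f = "\<lambda>s. B s - ?P s"])
    fix s :: real
    have "c / (L s)\<^sup>2 * 1 < c / (L s)\<^sup>2 * (1 / z s)"
      using cc_pos L_pos[of s] zz_pos[of s] zz_less_1[of s] by (intro mult_strict_left_mono) auto
    then have "0 < c / (z s * (L s)\<^sup>2) - c / (L s)\<^sup>2" by (simp add: mult.commute)
    then show "\<exists>y. ((\<lambda>s. B s - ?P s) has_real_derivative y) (at s) \<and> 0 < y"
      using DERIV_diff[OF B_deriv comparison_lam] by blast
  qed simp
  then show ?thesis by simp
qed

text \<open>The excess \<open>c (1 - z) / (z \<lambda>)\<close> of \<open>\<omega>\<close> over \<open>c / \<lambda>\<close> is at most \<open>c / z\<close>, since \<open>1 - z \<le> 1 - z\<^sup>2 = \<lambda>\<close>, and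
  \<open>c / z \<le> \<surd>c (1 + c / z\<^sup>2) / 2\<close> by the inequality between the arithmetic and the geometric mean.\<close>

lemma B_pi_half_le: "B (pi / 2) \<le> pi / 2 + sqrt c * (pi / 2)"
proof -
  let ?P = "profile_angle_comparison (c / (1/2 - a))" and ?Q = "profile_angle_comparison (c / (1/2 + a))"
  let ?f = "\<lambda>s. ?P s + sqrt c / 2 * (s + ?Q s) - B s"
  have "?f 0 \<le> ?f (pi / 2)"
  proof (rule DERIV_nonneg_imp_nondecreasing[where f = ?f])
    fix s :: real
    have d: "(?f has_real_derivative (c / (L s)\<^sup>2 + sqrt c / 2 * (1 + c / (z s)\<^sup>2) - c / (z s * (L s)\<^sup>2))) (at s)"
      by (rule derivative_eq_intros comparison_lam comparison_zz B_deriv refl)+ simp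
    have "c / (z s * (L s)\<^sup>2) - c / (L s)\<^sup>2 = c * (1 - z s) / (z s * (L s)\<^sup>2)"
      by (simp add: field_simps)
    also have "\<dots> \<le> c * (L s)\<^sup>2 / (z s * (L s)\<^sup>2)"
    proof -
      have "z s * z s \<le> 1 * z s" using zz_less_1[of s] zz_pos[of s] by (intro mult_right_mono) auto
      then have "1 - z s \<le> (L s)\<^sup>2" using Lz[of s] by (simp add: power2_eq_square)
      then show ?thesis using cc_pos zz_pos[of s] L_pos[of s]
        by (intro divide_right_mono mult_left_mono) auto
    qed
    also have "\<dots> = c / z s" by simp
    also have "\<dots> \<le> sqrt c / 2 * (1 + c / (z s)\<^sup>2)"
    proof -
      define q where "q = sqrt c"
      have q: "c = q\<^sup>2" "q > 0" using cc_pos by (simp_all add: q_def)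
      have "0 \<le> (1 - q / z s)\<^sup>2" by simp
      then have "2 * (q / z s) \<le> 1 + q\<^sup>2 / (z s)\<^sup>2" by (simp add: power2_diff power_divide)
      then have "q / 2 * (2 * (q / z s)) \<le> q / 2 * (1 + q\<^sup>2 / (z s)\<^sup>2)"
        using q by (intro mult_left_mono) auto
      then show ?thesis unfolding q_def[symmetric] q(1) using q(2) by (simp add: power2_eq_square)
    qed
    finally have "0 \<le> c / (L s)\<^sup>2 + sqrt c / 2 * (1 + c / (z s)\<^sup>2) - c / (z s * (L s)\<^sup>2)" by linarith
    with d show "\<exists>y. (?f has_real_derivative y) (at s) \<and> 0 \<le> y" by blast
  qed simp
  then show ?thesis by (simp add: algebra_simps)
qed

lemma B_pi_half_less: "B (pi / 2) < pi"
proof -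
  have "sqrt c < sqrt 1" using cc_less by (subst real_sqrt_less_iff) auto
  then have "sqrt c * (pi / 2) < 1 * (pi / 2)" by (intro mult_strict_right_mono) auto
  then show ?thesis using B_pi_half_le by linarith
qed

lemma B_bounds:
  assumes "0 < s" "s \<le> pi / 2"
  shows "0 < B s" "B s < pi" "0 < sin (B s)"
proof -
  show 1: "0 < B s" using B_strict_mono[OF assms(1)] by simp
  have "B s \<le> B (pi / 2)" using strict_mono_less_eq[of B s "pi / 2"] B_strict_mono assms(2) by (simp add: strict_mono_def)
  then show 2: "B s < pi" using B_pi_half_less by linarith
  show "0 < sin (B s)" by (rule sin_gt_zero[OF 1 2])
qed

text \<open>This is the equation \<open>(z G)' = y\<close>. It reflects that \<open>y\<close> and \<open>z cos \<theta>\<close> are eigenfunctions of the Laplacian of the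
  surface for the same eigenvalue.\<close>

lemma HH_over_L_deriv: "((\<lambda>s. HH a s / L s) has_real_derivative - L s * sin (B s)) (at s)"
  unfolding HH_def
  by (rule derivative_eq_intros refl | simp; fail)+
     (simp only: rational, use relations[of s] in algebra)

lemma HH_0: "0 < HH a 0" and HH_pi_half: "HH a (pi / 2) < 0"
proof -
  show "0 < HH a 0" using cc_pos zz_pos by (simp add: HH_def)
  have "cos (B (pi / 2)) < 0"
    using B_pi_half_gt B_pi_half_less by (intro cos_lt_zero_pi) auto
  then show "HH a (pi / 2) < 0"
    using cc_pos zz_pos by (simp add: HH_def SS_def mult_less_0_iff)
qed

lemma HH_over_L_decreasing:
  assumes "0 \<le> s" "s < t" "t \<le> pi / 2"
  shows "HH a t / L t < HH a s / L s"
proof (rule DERIV_neg_imp_decreasing_open[OF assms(2)])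
  show "\<exists>y. ((\<lambda>s. HH a s / L s) has_real_derivative y) (at x) \<and> y < 0" if "s < x" "x < t" for x
  proof (intro exI conjI)
    show "- L x * sin (B x) < 0"
      using B_bounds(3)[of x] L_pos[of x] assms that by simp
  qed (rule HH_over_L_deriv)
  show "continuous_on {s..t} (\<lambda>s. HH a s / L s)"
    by (rule DERIV_continuous_on, rule has_field_derivative_at_within, rule HH_over_L_deriv)
qed

lemma GG_zero_iff: "GG a s = 0 \<longleftrightarrow> HH a s = 0"
  by (simp add: GG_eq n1_HH)

text \<open>The function is positive at 0, negative at \<open>\<pi>/2\<close> because \<open>\<pi>/2 < \<beta>(\<pi>/2) < \<pi>\<close>, and strictly decreasing
  between because \<open>y > 0\<close>.\<close>

lemma HH_unique_zero: "\<exists>!s. 0 < s \<and> s \<le> pi / 2 \<and> GG a s = 0"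
proof -
  have "\<exists>s. 0 \<le> s \<and> s \<le> pi / 2 \<and> HH a s / L s = 0"
  proof (rule IVT2')
    show "continuous_on {0..pi / 2} (\<lambda>s. HH a s / L s)"
      by (rule DERIV_continuous_on, rule has_field_derivative_at_within, rule HH_over_L_deriv)
  qed (use HH_0 HH_pi_half L_pos in \<open>auto simp: divide_simps less_imp_le\<close>)
  then obtain s where s: "0 \<le> s" "s \<le> pi / 2" "HH a s = 0" by auto
  then have "s \<noteq> 0" using HH_0 by auto
  show ?thesis
  proof (rule ex1I[of _ s])
    fix t assume t: "0 < t \<and> t \<le> pi / 2 \<and> GG a t = 0"
    then show "t = s"
      using HH_over_L_decreasing[of s t] HH_over_L_decreasing[of t s] s
      by (cases t s rule: linorder_cases) (auto simp: GG_zero_iff)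
  qed (use s \<open>s \<noteq> 0\<close> in \<open>auto simp: GG_zero_iff\<close>)
qed

abbreviation \<sigma> where "\<sigma> \<equiv> s1 a"

lemma s1_pos: "0 < \<sigma>" and s1_less: "\<sigma> < pi / 2" and HH_s1: "HH a \<sigma> = 0"
proof -
  have *: "0 < \<sigma> \<and> \<sigma> \<le> pi / 2 \<and> GG a \<sigma> = 0"
    unfolding s1_def by (rule theI'[OF HH_unique_zero])
  then show "0 < \<sigma>" "HH a \<sigma> = 0" by (auto simp: GG_zero_iff)
  have "\<sigma> \<noteq> pi / 2" using HH_pi_half \<open>HH a \<sigma> = 0\<close> by (metis less_irrefl)
  then show "\<sigma> < pi / 2" using * by linarith
qed

lemma HH_pos_iff:
  assumes "0 \<le> s" "s \<le> pi / 2"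
  shows "0 < HH a s \<longleftrightarrow> s < \<sigma>" and "HH a s < 0 \<longleftrightarrow> \<sigma> < s"
  using HH_over_L_decreasing[of s \<sigma>] HH_over_L_decreasing[of \<sigma> s] HH_s1 s1_pos s1_less assms L_pos[of s]
  by (cases s \<sigma> rule: linorder_cases; auto simp: divide_less_0_iff zero_less_divide_iff)+

end

section \<open>Boundary values and the radius\<close>

context annulus_parameter
begin

text \<open>At the boundary parameter \<open>G = 0\<close> determines the point of the profile curve and its tangent as rational
  functions of \<open>S\<close>, \<open>z\<close>, \<open>c\<close> and this square root, which also equals \<open>\<surd>(z\<^sup>4 + S\<^sup>2)\<close>.\<close>

definition D where "D = sqrt ((z \<sigma>)\<^sup>2 - c\<^sup>2)"

lemma S_s1_pos: "0 < S \<sigma>"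
  using a_pos s1_pos s1_less by (auto simp: SS_def intro!: mult_pos_pos sin_gt_zero)

lemma D_sq: "D\<^sup>2 = (z \<sigma>)\<^sup>2 - c\<^sup>2" and D_sq': "D\<^sup>2 = (z \<sigma>) ^ 4 + (S \<sigma>)\<^sup>2" and D_pos: "0 < D"
proof -
  have *: "(z \<sigma>)\<^sup>2 - c\<^sup>2 = (z \<sigma>) ^ 4 + (S \<sigma>)\<^sup>2"
    using SLz[of \<sigma>] Lz[of \<sigma>] by algebra
  have "0 < (z \<sigma>)\<^sup>2 - c\<^sup>2"
    unfolding * using zz_pos[of \<sigma>] by (intro add_pos_nonneg) auto
  then show "D\<^sup>2 = (z \<sigma>)\<^sup>2 - c\<^sup>2" "D\<^sup>2 = (z \<sigma>) ^ 4 + (S \<sigma>)\<^sup>2" "0 < D"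
    using * by (auto simp: D_def)
qed

lemma D_nz [simp]: "D \<noteq> 0" using D_pos by simp

text \<open>The equation \<open>S sin \<beta> + c z cos \<beta> = 0\<close> fixes the direction of \<open>(sin \<beta>, cos \<beta>)\<close> up to sign, and \<open>sin \<beta> > 0\<close>
  fixes the sign.\<close>

lemma sin_B_s1: "sin (B \<sigma>) = c * z \<sigma> / (L \<sigma> * D)"
  and cos_B_s1: "cos (B \<sigma>) = - S \<sigma> / (L \<sigma> * D)"
proof -
  define u v where "u = sin (B \<sigma>)" and "v = cos (B \<sigma>)"
  have uv: "u\<^sup>2 + v\<^sup>2 = 1" by (simp add: u_def v_def)
  have h: "S \<sigma> * u + c * z \<sigma> * v = 0" using HH_s1 by (simp add: HH_def u_def v_def)
  have "(u * (L \<sigma> * D))\<^sup>2 = (c * z \<sigma>)\<^sup>2"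
    using uv h D_sq SLz[of \<sigma>] Lz[of \<sigma>] by algebra
  moreover have "0 \<le> u" using B_bounds(3)[of \<sigma>] s1_pos s1_less by (simp add: u_def)
  ultimately have *: "u * (L \<sigma> * D) = c * z \<sigma>"
    using L_pos D_pos cc_pos zz_pos by (subst (asm) power2_eq_iff_nonneg) (auto simp: less_imp_le)
  then show "sin (B \<sigma>) = c * z \<sigma> / (L \<sigma> * D)" by (simp add: u_def field_simps)
  have "(c * z \<sigma>) * (v * (L \<sigma> * D) + S \<sigma>) = 0" using h * by algebra
  then have "v * (L \<sigma> * D) + S \<sigma> = 0" by simp
  then show "cos (B \<sigma>) = - S \<sigma> / (L \<sigma> * D)" by (simp add: v_def field_simps eq_neg_iff_add_eq_0)
qed

lemma cos_B_s1_neg: "cos (B \<sigma>) < 0"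
  unfolding cos_B_s1 using S_s1_pos L_pos[of \<sigma>] D_pos by (simp add: divide_neg_pos)

lemma boundary_values:
  "xx a \<sigma> = - S \<sigma> / D" "yy a \<sigma> = c * z \<sigma> / D"
  "t1 a \<sigma> = - (z \<sigma>)\<^sup>2 / D" "t2 a \<sigma> = - c * S \<sigma> / (z \<sigma> * D)"
proof -
  note d = xx_eq yy_eq t1_def t2_def sin_B_s1 cos_B_s1
  have D: "D * inverse D = 1" by simp
  note r = SLz[of \<sigma>] Lz[of \<sigma>] inverses[of \<sigma>] D
  show "xx a \<sigma> = - S \<sigma> / D" "yy a \<sigma> = c * z \<sigma> / D" unfolding d by simp_all
  show "t1 a \<sigma> = - (z \<sigma>)\<^sup>2 / D" unfolding d by (simp only: rational, use r in algebra)
  show "t2 a \<sigma> = - c * S \<sigma> / (z \<sigma> * D)" unfolding d by (simp only: rational, use r in algebra)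
qed

lemma Rad_eq: "Rad a = pi / 2 + arctan (S \<sigma> / (z \<sigma>)\<^sup>2)"
proof -
  define q where "q = S \<sigma> / (z \<sigma>)\<^sup>2"
  have "1 + q\<^sup>2 = (D / (z \<sigma>)\<^sup>2)\<^sup>2"
    unfolding q_def power_divide D_sq' by (simp add: field_simps)
  then have "sqrt (1 + q\<^sup>2) = D / (z \<sigma>)\<^sup>2"
    using D_pos by (simp add: less_imp_le)
  then have "cos (pi / 2 + arctan q) = xx a \<sigma>"
    unfolding cos_add sin_arctan by (simp add: q_def boundary_values)
  moreover have "arccos (cos (pi / 2 + arctan q)) = pi / 2 + arctan q"
    using arctan_lbound[of q] arctan_ubound[of q] by (intro arccos_cos) linarith+
  ultimately show ?thesis by (simp add: Rad_def q_def)
qed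

lemma Rad_gt: "pi / 2 < Rad a" and Rad_less: "Rad a < pi"
  unfolding Rad_eq using S_s1_pos zz_pos[of \<sigma>] arctan_ubound[of "S \<sigma> / (z \<sigma>)\<^sup>2"] pi_gt_zero by simp_all

lemma cos_Rad: "cos (Rad a) = - S \<sigma> / D" and sin_Rad: "sin (Rad a) = (z \<sigma>)\<^sup>2 / D"
  and cot_Rad: "cot (Rad a) = - S \<sigma> / (z \<sigma>)\<^sup>2"
proof -
  have sq: "(S \<sigma> / D)\<^sup>2 + ((z \<sigma>)\<^sup>2 / D)\<^sup>2 = 1"
  proof -
    have "(S \<sigma>)\<^sup>2 + ((z \<sigma>)\<^sup>2)\<^sup>2 = D\<^sup>2" unfolding D_sq' by simp
    then show ?thesis by (simp add: power_divide add_divide_distrib[symmetric])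
  qed
  have "(S \<sigma> / D)\<^sup>2 \<le> 1" using sq zero_le_power2[of "(z \<sigma>)\<^sup>2 / D"] by linarith
  then have "(S \<sigma> / D)\<^sup>2 \<le> 1\<^sup>2" by simp
  then have "\<bar>S \<sigma> / D\<bar> \<le> 1" by (simp only: abs_le_square_iff[symmetric] abs_one)
  then have r: "- 1 \<le> - S \<sigma> / D" "- S \<sigma> / D \<le> 1"
    unfolding abs_le_iff minus_divide_left by linarith+
  show c: "cos (Rad a) = - S \<sigma> / D" unfolding Rad_def boundary_values using r by (rule cos_arccos)
  have "sin (Rad a) = sqrt (1 - (- S \<sigma> / D)\<^sup>2)"
    unfolding Rad_def boundary_values using r by (rule sin_arccos)
  also have "1 - (- S \<sigma> / D)\<^sup>2 = ((z \<sigma>)\<^sup>2 / D)\<^sup>2" using sq by simp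
  finally show s: "sin (Rad a) = (z \<sigma>)\<^sup>2 / D" using D_pos by simp
  show "cot (Rad a) = - S \<sigma> / (z \<sigma>)\<^sup>2" unfolding cot_def c s by simp
qed

text \<open>While \<open>cos \<beta>\<close> is positive the inequality is trivial, because \<open>x\<close> is negative at the
  boundary; afterwards \<open>x\<close> decreases.\<close>

lemma xx_ge_boundary:
  assumes "\<bar>s\<bar> \<le> \<sigma>"
  shows "xx a \<sigma> \<le> xx a s"
proof -
  have *: "xx a \<sigma> \<le> xx a s" if "0 \<le> s" "s \<le> \<sigma>" for s
  proof (cases "cos (B s) \<ge> 0")
    case True
    have "xx a \<sigma> < 0" using cos_B_s1_neg L_pos by (simp add: xx_eq mult_less_0_iff)
    also have "0 \<le> xx a s" using True L_pos[of s] by (simp add: xx_eq)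
    finally show ?thesis by simp
  next
    case False
    show ?thesis
    proof (rule DERIV_nonpos_imp_nonincreasing[OF that(2)])
      fix t assume t: "s \<le> t" "t \<le> \<sigma>"
      have "s \<noteq> 0" using False by auto
      then have t': "0 < t" "t \<le> pi / 2" using t that s1_less by auto
      have "B s \<le> B t" using B_strict_mono[of s t] t by (cases "s = t") auto
      moreover have "pi / 2 < B s"
        using False cos_ge_zero[of "B s"] B_bounds(1)[of s] that \<open>s \<noteq> 0\<close> s1_less
        by (smt (verit) pi_gt_zero)
      ultimately have "cos (B t) < 0" using B_bounds[OF t'] by (intro cos_lt_zero_pi) auto
      moreover have "0 \<le> S t" using a_pos t' by (auto simp: SS_def intro!: mult_nonneg_nonneg sin_ge_zero)
      ultimately have "t1 a t \<le> 0"
        using B_bounds(3)[OF t'] L_pos[of t] zz_pos[of t] cc_pos unfolding t1_def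
        by (smt (verit) divide_nonneg_pos divide_nonpos_pos mult_nonneg_nonpos mult_pos_pos divide_pos_pos)
      then show "\<exists>y. (xx a has_real_derivative y) (at t) \<and> y \<le> 0"
        using x_deriv by blast
    qed
  qed
  show ?thesis
    using *[of "\<bar>s\<bar>"] assms parity(6)[of s] by (cases "s \<ge> 0") auto
qed

end

section \<open>Analytic dependence on the parameter\<close>

definition HC :: "complex \<Rightarrow> complex \<Rightarrow> complex" where
  "HC a s = a * sin (2 * s) * sin (betaC a s)
     + csqrt (1/4 - a\<^sup>2) * csqrt (1/2 + a * cos (2 * s)) * cos (betaC a s)"

definition HC_a :: "complex \<Rightarrow> complex \<Rightarrow> complex" where
  "HC_a a s = sin (2 * s) * sin (betaC a s) + a * sin (2 * s) * (cos (betaC a s) * betaC_a a s)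
     - a / csqrt (1/4 - a\<^sup>2) * csqrt (1/2 + a * cos (2 * s)) * cos (betaC a s)
     + csqrt (1/4 - a\<^sup>2) * (cos (2 * s) / (2 * csqrt (1/2 + a * cos (2 * s)))) * cos (betaC a s)
     - csqrt (1/4 - a\<^sup>2) * csqrt (1/2 + a * cos (2 * s)) * (sin (betaC a s) * betaC_a a s)"

definition HC_s :: "complex \<Rightarrow> complex \<Rightarrow> complex" where
  "HC_s a s = 2 * a * cos (2 * s) * sin (betaC a s) + a * sin (2 * s) * (cos (betaC a s) * omegaC a s)
     - csqrt (1/4 - a\<^sup>2) * (a * sin (2 * s) / csqrt (1/2 + a * cos (2 * s))) * cos (betaC a s)
     - csqrt (1/4 - a\<^sup>2) * csqrt (1/2 + a * cos (2 * s)) * (sin (betaC a s) * omegaC a s)"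

context complex_domain
begin

lemma HC_has_derivative_a:
  assumes "a \<in> A" "s \<in> W"
  shows "((\<lambda>a. HC a s) has_field_derivative HC_a a s) (at a)"
proof -
  note sl = slit[OF assms]
  have q: "((\<lambda>a. csqrt (1/4 - a\<^sup>2)) has_field_derivative - a / csqrt (1/4 - a\<^sup>2)) (at a)"
    by (rule derivative_eq_intros refl sl(3))+ (simp add: divide_simps)
  have p: "((\<lambda>a. csqrt (1/2 + a * cos (2 * s))) has_field_derivative
      cos (2 * s) / (2 * csqrt (1/2 + a * cos (2 * s)))) (at a)"
    by (rule derivative_eq_intros refl sl(1))+ (simp add: divide_simps)
  note b = betaC_has_derivative_a[OF assms]
  have "((\<lambda>a. a * sin (2 * s) * sin (betaC a s)) has_field_derivative
      sin (2 * s) * sin (betaC a s) + a * sin (2 * s) * (cos (betaC a s) * betaC_a a s)) (at a)"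
    by (rule derivative_eq_intros b refl)+ (simp add: algebra_simps)
  moreover have "((\<lambda>a. cos (betaC a s)) has_field_derivative - sin (betaC a s) * betaC_a a s) (at a)"
    by (rule DERIV_chain2[OF DERIV_cos b])
  ultimately show ?thesis unfolding HC_def HC_a_def
    by (rule DERIV_cong[OF DERIV_add[OF _ DERIV_mult[OF DERIV_mult[OF q p]]]]) (simp add: algebra_simps)
qed

lemma HC_has_derivative_s:
  assumes "a \<in> A" "s \<in> W"
  shows "((\<lambda>s. HC a s) has_field_derivative HC_s a s) (at s)"
proof -
  note sl = slit[OF assms]
  have p: "((\<lambda>s. csqrt (1/2 + a * cos (2 * s))) has_field_derivative
      - (a * sin (2 * s)) / csqrt (1/2 + a * cos (2 * s))) (at s)"
    by (rule derivative_eq_intros refl sl(1))+ (simp add: divide_simps)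
  note b = betaC_has_derivative_s[OF assms]
  have "((\<lambda>s. a * sin (2 * s) * sin (betaC a s)) has_field_derivative
      2 * a * cos (2 * s) * sin (betaC a s) + a * sin (2 * s) * (cos (betaC a s) * omegaC a s)) (at s)"
    by (rule derivative_eq_intros b refl)+ (simp add: algebra_simps)
  moreover have "((\<lambda>s. cos (betaC a s)) has_field_derivative - sin (betaC a s) * omegaC a s) (at s)"
    by (rule DERIV_chain2[OF DERIV_cos b])
  ultimately show ?thesis unfolding HC_def HC_s_def
    by (rule DERIV_cong[OF DERIV_add[OF _ DERIV_mult[OF DERIV_cmult[OF p]]]]) (simp add: algebra_simps)
qed

lemma continuous_HC_a: "continuous_on (A \<times> W) (\<lambda>(a, s). HC_a a s)"
  and continuous_HC_s: "continuous_on (A \<times> W) (\<lambda>(a, s). HC_s a s)"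
proof -
  have sqrt: "continuous_on (A \<times> W) (\<lambda>p. csqrt (f p))"
    if "continuous_on (A \<times> W) f" "\<And>p. p \<in> A \<times> W \<Longrightarrow> f p \<notin> \<real>\<^sub>\<le>\<^sub>0" for f
    by (rule continuous_on_compose2[OF continuous_on_csqrt that(1)]) (use that in auto)
  have q: "continuous_on (A \<times> W) (\<lambda>p. csqrt (1/4 - (fst p)\<^sup>2))"
    and p: "continuous_on (A \<times> W) (\<lambda>p. csqrt (1/2 + fst p * cos (2 * snd p)))"
    by (intro sqrt continuous_intros, use slit in auto)+
  have nz: "\<forall>p\<in>A \<times> W. csqrt (1/4 - (fst p)\<^sup>2) \<noteq> 0"
    "\<forall>p\<in>A \<times> W. csqrt (1/2 + fst p * cos (2 * snd p)) \<noteq> 0"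
    "\<forall>p\<in>A \<times> W. 2 * csqrt (1/2 + fst p * cos (2 * snd p)) \<noteq> 0"
    using nonzero by auto
  show "continuous_on (A \<times> W) (\<lambda>(a, s). HC_a a s)" "continuous_on (A \<times> W) (\<lambda>(a, s). HC_s a s)"
    unfolding case_prod_unfold HC_a_def HC_s_def
    by (intro continuous_intros continuous_betaC continuous_betaC_a continuous_omegaC p q nz)+
qed

end

definition HH_a :: "real \<Rightarrow> real \<Rightarrow> real" where
  "HH_a a s = sin (2 * s) * sin (beta a s) + SS a s * (cos (beta a s) * beta_a a s)
     - a / cc a * zz a s * cos (beta a s) + cc a * (cos (2 * s) / (2 * zz a s)) * cos (beta a s)
     - cc a * zz a s * (sin (beta a s) * beta_a a s)"

definition HH_s :: "real \<Rightarrow> real \<Rightarrow> real" where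
  "HH_s a s = 2 * CC a s * sin (beta a s) + SS a s * (cos (beta a s) * omega a s)
     - cc a * (SS a s / zz a s) * cos (beta a s) - cc a * zz a s * (sin (beta a s) * omega a s)"

context annulus_parameter
begin

lemma of_real_HC: "HC (of_real a) (of_real s) = of_real (HH a s)"
  and of_real_HC_a: "HC_a (of_real a) (of_real s) = of_real (HH_a a s)"
  and of_real_HC_s: "HC_s (of_real a) (of_real s) = of_real (HH_s a s)"
proof -
  have sq: "csqrt (of_real (1/4 - a\<^sup>2)) = of_real c" "csqrt (of_real (1/2 + a * cos (2 * s))) = of_real (z s)"
    using cc_arg_pos zz_arg_pos[of s] by (simp_all only: cc_def zz_def of_real_sqrt less_imp_le)
  have trig: "cos (2 * complex_of_real s) = of_real (cos (2 * s))" "sin (2 * complex_of_real s) = of_real (sin (2 * s))"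
    by (metis cos_of_real sin_of_real of_real_mult of_real_numeral)+
  have sq': "csqrt (1/4 - (complex_of_real a)\<^sup>2) = of_real c"
    "csqrt (1/2 + of_real a * of_real (cos (2 * s))) = of_real (z s)"
    using sq by simp_all
  note e = trig sq' of_real_betaC of_real_betaC_a of_real_omegaC cos_of_real sin_of_real
  show "HC (of_real a) (of_real s) = of_real (HH a s)" unfolding HC_def e HH_def SS_def by simp
  show "HC_a (of_real a) (of_real s) = of_real (HH_a a s)" unfolding HC_a_def e HH_a_def SS_def by simp
  show "HC_s (of_real a) (of_real s) = of_real (HH_s a s)" unfolding HC_s_def e HH_s_def SS_def CC_def by simp
qed

lemma HH_s_s1: "HH_s a \<sigma> = - (L \<sigma>)\<^sup>2 * sin (B \<sigma>)"
proof -
  have "S \<sigma> * sin (B \<sigma>) + c * z \<sigma> * cos (B \<sigma>) = 0" using HH_s1 by (simp add: HH_def)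
  then show ?thesis unfolding HH_s_def omega_def lam_L
    by (simp only: rational, use relations[of \<sigma>] in algebra)
qed

lemma HH_continuous_parameter: "((\<lambda>b. HH b s) \<longlongrightarrow> HH a s) (nhds a)"
proof -
  have "isCont (\<lambda>b. HH b s) a"
    unfolding HH_def SS_def cc_def zz_def
    by (intro continuous_intros DERIV_isCont[OF beta_has_derivative_a])
  then show ?thesis unfolding isCont_def by (rule tendsto_at_iff_tendsto_nhds[THEN iffD1])
qed

lemma parameter_nearby: "\<forall>\<^sub>F b in nhds a. annulus_parameter b"
  using eventually_nhds_in_open[of "{0<..<1/2}" a] a_pos a_less
  by (auto simp: annulus_parameter_def elim: eventually_mono)

text \<open>The sign of \<open>HH\<close> at a fixed \<open>s\<close> decides on which side of the boundary parameter \<open>s\<close> lies, and this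
  sign persists under small changes of the parameter.\<close>

lemma s1_continuous: "(s1 \<longlongrightarrow> \<sigma>) (nhds a)"
proof (rule order_tendstoI)
  fix y assume "y < \<sigma>"
  define s where "s = max 0 y"
  have s: "0 \<le> s" "s < \<sigma>" "s < pi / 2" "y \<le> s" using \<open>y < \<sigma>\<close> s1_pos s1_less by (auto simp: s_def)
  then have "0 < HH a s" by (simp add: HH_pos_iff)
  then have "\<forall>\<^sub>F b in nhds a. 0 < HH b s"
    by (rule order_tendstoD[OF HH_continuous_parameter])
  with parameter_nearby show "\<forall>\<^sub>F b in nhds a. y < s1 b"
  proof eventually_elim
    case (elim b)
    then interpret b: annulus_parameter b by simp
    show ?case using elim s b.HH_pos_iff(1)[of s] by auto
  qed
next
  fix y assume "\<sigma> < y"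
  define s where "s = min (pi / 2) y"
  have s: "0 \<le> s" "\<sigma> < s" "s \<le> pi / 2" "s \<le> y" using \<open>\<sigma> < y\<close> s1_pos s1_less by (auto simp: s_def)
  then have "HH a s < 0" by (simp add: HH_pos_iff)
  then have "\<forall>\<^sub>F b in nhds a. HH b s < 0"
    by (rule order_tendstoD[OF HH_continuous_parameter])
  with parameter_nearby show "\<forall>\<^sub>F b in nhds a. s1 b < y"
  proof eventually_elim
    case (elim b)
    then interpret b: annulus_parameter b by simp
    show ?case using elim s b.HH_pos_iff(2)[of s] by auto
  qed
qed

text \<open>The implicit function theorem gives a holomorphic zero \<open>g\<close> of \<open>HC\<close>; by its local uniqueness and the
  continuity of the real zero, \<open>g\<close> extends \<open>s1\<close>.\<close>

lemma s1_holomorphic_extension: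
  obtains \<rho> \<delta> r g where "complex_domain \<rho> \<delta>" "r > 0" "ball (of_real a) r \<subseteq> complex_domain.A \<rho>"
    "g holomorphic_on ball (of_real a) r"
    "\<And>w. w \<in> ball (of_real a) r \<Longrightarrow> g w \<in> complex_domain.W \<delta>"
    "\<And>b. \<bar>b - a\<bar> < r \<Longrightarrow> annulus_parameter b \<and> g (of_real b) = of_real (s1 b)"
    "(g has_field_derivative of_real (- HH_a a \<sigma> / HH_s a \<sigma>)) (at (of_real a))"
proof -
  obtain \<rho> \<delta> where cd: "complex_domain \<rho> \<delta>" and mem: "of_real a \<in> complex_domain.A \<rho>"
    by (rule complex_domain_exists)
  interpret complex_domain \<rho> \<delta> by fact
  have "sin (B \<sigma>) \<noteq> 0" using B_bounds(3)[of \<sigma>] s1_pos s1_less by simp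
  then have nz: "HC_s (of_real a) (of_real \<sigma>) \<noteq> 0"
    by (simp add: of_real_HC_s HH_s_s1)
  have zero: "HC (of_real a) (of_real \<sigma>) = 0" by (simp add: of_real_HC HH_s1)
  obtain r e g where g: "r > 0" "e > 0" "ball (of_real a) r \<subseteq> A" "ball (of_real \<sigma>) e \<subseteq> W"
    "\<And>x. x \<in> ball (of_real a) r \<Longrightarrow> g x \<in> W"
    "\<And>x. x \<in> ball (of_real a) r \<Longrightarrow> (g has_field_derivative - HC_a x (g x) / HC_s x (g x)) (at x)"
    "\<And>x y. x \<in> ball (of_real a) r \<Longrightarrow> y \<in> ball (of_real \<sigma>) e \<Longrightarrow> HC x y = 0 \<Longrightarrow> y = g x"
    by (rule holomorphic_implicit_function[OF open_A open_W mem of_real_mem_W[of \<sigma>]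
        HC_has_derivative_a HC_has_derivative_s continuous_HC_a continuous_HC_s zero nz], assumption+, rule that)
      assumption+
  have "\<forall>\<^sub>F b in nhds a. dist (s1 b) \<sigma> < e"
    using s1_continuous g(2) by (rule tendstoD)
  with parameter_nearby have "\<forall>\<^sub>F b in nhds a. annulus_parameter b \<and> dist (s1 b) \<sigma> < e"
    by (rule eventually_conj)
  then obtain r' where r': "r' > 0" "\<And>b. dist b a < r' \<Longrightarrow> annulus_parameter b \<and> dist (s1 b) \<sigma> < e"
    unfolding eventually_nhds_metric by blast
  have ext: "annulus_parameter b \<and> g (of_real b) = of_real (s1 b)" if "\<bar>b - a\<bar> < min r r'" for b
  proof -
    have b: "annulus_parameter b" "dist (s1 b) \<sigma> < e" using r'(2)[of b] that by (auto simp: dist_real_def)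
    interpret b: annulus_parameter b by fact
    have "of_real (s1 b) = g (of_real b)"
    proof (rule g(7))
      show "complex_of_real b \<in> ball (of_real a) r" using that by (simp add: dist_real_def abs_minus_commute)
      show "complex_of_real (s1 b) \<in> ball (of_real \<sigma>) e" using b(2) by (simp add: dist_commute)
      show "HC (of_real b) (of_real (s1 b)) = 0" by (simp add: b.of_real_HC b.HH_s1)
    qed
    then show ?thesis using b(1) by simp
  qed
  have "g (of_real a) = of_real \<sigma>" using ext[of a] g(1) r'(1) by simp
  then have "(g has_field_derivative of_real (- HH_a a \<sigma> / HH_s a \<sigma>)) (at (of_real a))"
    using g(6)[of "of_real a"] g(1) by (simp add: of_real_HC_a of_real_HC_s)
  moreover have "g holomorphic_on ball (of_real a) (min r r')"
    unfolding holomorphic_on_def field_differentiable_def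
  proof
    fix x :: complex assume "x \<in> ball (of_real a) (min r r')"
    then have "x \<in> ball (of_real a) r" by simp
    from has_field_derivative_at_within[OF g(6)[OF this]]
    show "\<exists>f'. (g has_field_derivative f') (at x within ball (of_real a) (min r r'))" by blast
  qed
  moreover have "ball (of_real a) (min r r') \<subseteq> A" using g(3) by auto
  ultimately show thesis
    by (intro that[OF cd, of "min r r'" g] ext g(5)) (use g(1) r'(1) in auto)
qed

lemma s1_deriv: "(s1 has_real_derivative - HH_a a \<sigma> / HH_s a \<sigma>) (at a)"
proof -
  obtain \<rho> \<delta> r and g :: "complex \<Rightarrow> complex" where g: "complex_domain \<rho> \<delta>" "r > 0"
    "\<And>b. \<bar>b - a\<bar> < r \<Longrightarrow> annulus_parameter b \<and> g (of_real b) = of_real (s1 b)"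
    "(g has_field_derivative of_real (- HH_a a \<sigma> / HH_s a \<sigma>)) (at (of_real a))"
    by (rule s1_holomorphic_extension, rule that) assumption+
  have "((\<lambda>b. g (of_real b)) has_vector_derivative of_real (- HH_a a \<sigma> / HH_s a \<sigma>)) (at a)"
    by (rule has_vector_derivative_real_field[OF g(4)])
  then have "((\<lambda>b. Re (g (of_real b))) has_vector_derivative Re (of_real (- HH_a a \<sigma> / HH_s a \<sigma>))) (at a)"
    by (rule bounded_linear.has_vector_derivative[OF bounded_linear_Re])
  then have "((\<lambda>b. Re (g (of_real b))) has_real_derivative - HH_a a \<sigma> / HH_s a \<sigma>) (at a)"
    by (simp add: has_real_derivative_iff_has_vector_derivative)
  then show ?thesis
    by (rule has_field_derivative_transform_within_open[where S = "ball a r"])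
       (use g(2,3) in \<open>auto simp: dist_real_def abs_minus_commute\<close>)
qed

end

lemma Rad_real_analytic: "real_analytic_on {0<..<1/2} Rad"
  unfolding real_analytic_on_def
proof
  fix a :: real assume "a \<in> {0<..<1/2}"
  then interpret annulus_parameter a by (simp add: annulus_parameter_def)
  obtain \<rho> \<delta> r g where g: "complex_domain \<rho> \<delta>" "r > 0" "ball (of_real a) r \<subseteq> complex_domain.A \<rho>"
    "g holomorphic_on ball (of_real a) r"
    "\<And>w. w \<in> ball (of_real a) r \<Longrightarrow> g w \<in> complex_domain.W \<delta>"
    "\<And>b. \<bar>b - a\<bar> < r \<Longrightarrow> annulus_parameter b \<and> g (of_real b) = of_real (s1 b)"
    by (rule s1_holomorphic_extension, rule that) assumption+
  interpret complex_domain \<rho> \<delta> by fact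
  define q where "q = (\<lambda>w. w * sin (2 * g w) / (1/2 + w * cos (2 * g w)))"
  have nz: "1/2 + w * cos (2 * g w) \<noteq> 0" if "w \<in> ball (of_real a) r" for w
    using nonzero(1) g(3,5) that by blast
  have holq: "q holomorphic_on ball (of_real a) r"
    unfolding q_def by (intro holomorphic_intros g(4)) (rule nz)
  have q_real: "q (of_real b) = of_real (SS b (s1 b) / (zz b (s1 b))\<^sup>2)" if "\<bar>b - a\<bar> < r" for b
  proof -
    have b: "annulus_parameter b" "g (of_real b) = of_real (s1 b)" using g(6)[OF that] by auto
    interpret b: annulus_parameter b by fact
    have trig: "cos (2 * complex_of_real x) = of_real (cos (2 * x))" "sin (2 * complex_of_real x) = of_real (sin (2 * x))" for x
      by (metis cos_of_real sin_of_real of_real_mult of_real_numeral)+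
    show ?thesis unfolding q_def b(2) b.z2 SS_def CC_def trig by simp
  qed
  have "continuous_on (ball (of_real a) r) (\<lambda>w. Re (q w))"
    by (intro continuous_intros holomorphic_on_imp_continuous_on holq)
  then have "open ((\<lambda>w. Re (q w)) -` {0<..} \<inter> ball (of_real a) r)"
    by (simp add: continuous_on_open_vimage)
  moreover have "of_real a \<in> (\<lambda>w. Re (q w)) -` {0<..} \<inter> ball (of_real a) r"
    using q_real[of a] g(2) S_s1_pos zz_pos[of \<sigma>] by simp
  ultimately obtain r' where r': "r' > 0" "ball (of_real a) r' \<subseteq> (\<lambda>w. Re (q w)) -` {0<..} \<inter> ball (of_real a) r"
    by (meson openE)
  have "(\<lambda>w. of_real (pi / 2) + Arctan (q w)) holomorphic_on ball (of_real a) (min r r')"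
  proof (intro holomorphic_intros)
    show "(\<lambda>w. Arctan (q w)) holomorphic_on ball (of_real a) (min r r')"
      by (rule holomorphic_on_compose_gen[unfolded o_def, OF _ holomorphic_on_Arctan[of "{w. 0 < Re w}"]])
         (use r' in \<open>auto intro: holomorphic_on_subset[OF holq]\<close>)
  qed
  moreover have "Rad (a + h) = Re (of_real (pi / 2) + Arctan (q (of_real (a + h))))" if "\<bar>h\<bar> < min r r'" for h
  proof -
    interpret b: annulus_parameter "a + h" using g(6)[of "a + h"] that by auto
    have "\<bar>a + h - a\<bar> < r" using that by simp
    note q = q_real[OF this]
    show ?thesis unfolding b.Rad_eq q Arctan_of_real by simp
  qed
  ultimately have "\<exists>c. \<forall>h. \<bar>h\<bar> < min r r' \<longrightarrow> (\<lambda>n. c n * h ^ n) sums Rad (a + h)"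
    by (rule power_series_of_holomorphic)
  then show "\<exists>c r. r > 0 \<and> (\<forall>h. \<bar>h\<bar> < r \<longrightarrow> (\<lambda>n. c n * h ^ n) sums Rad (a + h))"
    using g(2) r'(1) by (metis min_less_iff_conj)
qed

section \<open>The variation profile\<close>

text \<open>\<open>ww\<close> is \<open>\<langle>\<partial>\<gamma>/\<partial>a, n\<rangle>\<close> along the profile curve and \<open>ww1\<close> its derivative. Its second summand is \<open>- \<partial>\<beta>/\<partial>a\<close> times
  \<open>z'\<close>, where \<open>z'\<close> is the odd solution of the Jacobi equation coming from rotation of the first two coordinates.\<close>

definition ww :: "real \<Rightarrow> real \<Rightarrow> real" where
  "ww a s = cc a * cos (2 * s) / (2 * (LL a s)\<^sup>2 * (zz a s)\<^sup>2) + beta_a a s * SS a s / zz a s"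

definition ww1 :: "real \<Rightarrow> real \<Rightarrow> real" where
  "ww1 a s = - cc a * sin (2 * s) / ((LL a s)\<^sup>2 * (zz a s)\<^sup>2) * (1 / (4 * (cc a)\<^sup>2) - 1/2 + 1 / (4 * (zz a s)\<^sup>2))
     + beta_a a s * (zz a s - (cc a)\<^sup>2 / (zz a s) ^ 3)"

context annulus_parameter
begin

lemma omega_a_eq: "omega_a a s = c / (z s * (L s)\<^sup>2) * (- a / c\<^sup>2 - cos (2 * s) / (2 * (z s)\<^sup>2) + cos (2 * s) / (L s)\<^sup>2)"
  unfolding omega_a_def omega_def cc_sq zz_sq lam_L[symmetric] by (simp add: lam_def)

declare beta_a_deriv[unfolded omega_a_eq, THEN DERIV_chain2, derivative_intros]

lemma trig_relations:
  "C s = a * cos (2 * s)" "S s = a * sin (2 * s)" "(cos (2 * s))\<^sup>2 + (sin (2 * s))\<^sup>2 = 1"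
  "(L s)\<^sup>2 = 1/2 - C s" "(z s)\<^sup>2 = 1/2 + C s"
  "z s * inverse (z s) = 1" "L s * inverse (L s) = 1"
  by (simp_all add: CC_def SS_def L2 z2)

lemma c_relations: "c\<^sup>2 = 1/4 - a\<^sup>2" "c * inverse c = 1"
  by (simp_all add: cc_sq)

text \<open>Numerals left behind by the rules for derivatives of powers.\<close>

lemma numeral_exponents: "2 - Suc 0 = 1" "3 - Suc 0 = 2" "real 2 = 2" "real 3 = 3" "w ^ 1 = (w :: real)"
  by simp_all

lemma ww_deriv: "(ww a has_real_derivative ww1 a s) (at s)"
proof -
  define e where "e = (\<lambda>s. c * cos (2 * s) / ((L s)\<^sup>2 * (z s)\<^sup>2))"
  define v where "v = (\<lambda>s. S s / z s)"
  define b' where "b' = c / (z s * (L s)\<^sup>2) * (- a / c\<^sup>2 - cos (2 * s) / (2 * (z s)\<^sup>2) + cos (2 * s) / (L s)\<^sup>2)"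
  define e' where "e' = - 2 * c * sin (2 * s) / ((L s)\<^sup>2 * (z s)\<^sup>2) - 4 * c * cos (2 * s) * C s * S s / ((L s) ^ 4 * (z s) ^ 4)"
  define v' where "v' = z s - c\<^sup>2 / (z s) ^ 3"
  define y p k where "y = inverse (z s)" and "p = inverse (L s)" and "k = inverse c"
  have inv: "z s * y = 1" "L s * p = 1" "c * k = 1" by (simp_all add: y_def p_def k_def)
  note rat = numeral_exponents rational y_def[symmetric] p_def[symmetric] k_def[symmetric]
  have de: "(e has_real_derivative e') (at s)"
    unfolding e_def e'_def
    by (rule derivative_eq_intros refl | simp; fail)+
       (simp only: rat, use inv trig_relations(1,2,4,5)[of s] in algebra)
  have dv: "(v has_real_derivative v') (at s)"
    unfolding v_def v'_def
    by (rule derivative_eq_intros refl | simp; fail)+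
       (simp only: rat, use inv(1) z2[of s] L2[of s] SLz[of s] in algebra)
  have db: "(beta_a a has_real_derivative b') (at s)"
    using beta_a_deriv[of s] unfolding omega_a_eq b'_def .
  have "((\<lambda>s. e s / 2 + beta_a a s * v s) has_real_derivative e' / 2 + (b' * v s + v' * beta_a a s)) (at s)"
    by (intro DERIV_add DERIV_mult DERIV_cdivide de dv db)
  moreover have "e' / 2 + b' * v s = - c * sin (2 * s) / ((L s)\<^sup>2 * (z s)\<^sup>2) * (1 / (4 * c\<^sup>2) - 1/2 + 1 / (4 * (z s)\<^sup>2))"
    unfolding e'_def b'_def v_def
    by (simp only: rat, use inv trig_relations(1-5)[of s] c_relations(1) in algebra)
  ultimately show ?thesis
  proof -
    assume der: "((\<lambda>s. e s / 2 + beta_a a s * v s) has_real_derivative e' / 2 + (b' * v s + v' * beta_a a s)) (at s)"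
      and eq: "e' / 2 + b' * v s = - c * sin (2 * s) / ((L s)\<^sup>2 * (z s)\<^sup>2) * (1 / (4 * c\<^sup>2) - 1/2 + 1 / (4 * (z s)\<^sup>2))"
    have "e' / 2 + (b' * v s + v' * beta_a a s) = (e' / 2 + b' * v s) + beta_a a s * v'" by simp
    also have "\<dots> = ww1 a s" unfolding eq ww1_def v'_def ..
    finally have "((\<lambda>s. e s / 2 + beta_a a s * v s) has_real_derivative ww1 a s) (at s)" using der by simp
    moreover have "(\<lambda>s. e s / 2 + beta_a a s * v s) = ww a"
      by (simp add: fun_eq_iff ww_def e_def v_def mult.assoc)
    ultimately show ?thesis by simp
  qed
qed

text \<open>The rotationally invariant Jacobi equation \<open>w'' + (z'/z) w' + (2 c\<^sup>2/z\<^sup>4 + 2) w = 0\<close>, with \<open>z'/z = - S/z\<^sup>2\<close>.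
  The terms that contain \<open>\<partial>\<beta>/\<partial>a\<close> cancel because its cofactor \<open>S/z\<close> solves the same equation.\<close>

lemma ww1_deriv: "(ww1 a has_real_derivative S s / (z s)\<^sup>2 * ww1 a s - (2 * c\<^sup>2 / (z s) ^ 4 + 2) * ww a s) (at s)"
proof -
  define M where "M = (\<lambda>s. 1 / (4 * c\<^sup>2) - 1/2 + 1 / (4 * (z s)\<^sup>2))"
  define g where "g = (\<lambda>s. - c * sin (2 * s) / ((L s)\<^sup>2 * (z s)\<^sup>2))"
  define v where "v = (\<lambda>s. z s - c\<^sup>2 / (z s) ^ 3)"
  define b' where "b' = c / (z s * (L s)\<^sup>2) * (- a / c\<^sup>2 - cos (2 * s) / (2 * (z s)\<^sup>2) + cos (2 * s) / (L s)\<^sup>2)"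
  define M' where "M' = S s / (2 * (z s) ^ 4)"
  define g' where "g' = - 2 * c * cos (2 * s) / ((L s)\<^sup>2 * (z s)\<^sup>2) + 4 * c * sin (2 * s) * C s * S s / ((L s) ^ 4 * (z s) ^ 4)"
  define v' where "v' = - (S s / z s) * (1 + 3 * c\<^sup>2 / (z s) ^ 4)"
  define y p k where "y = inverse (z s)" and "p = inverse (L s)" and "k = inverse c"
  have inv: "z s * y = 1" "L s * p = 1" "c * k = 1" by (simp_all add: y_def p_def k_def)
  note rat = numeral_exponents rational y_def[symmetric] p_def[symmetric] k_def[symmetric]
  have dM: "(M has_real_derivative M') (at s)"
    unfolding M_def M'_def
    by (rule derivative_eq_intros refl | simp; fail)+
  have dg: "(g has_real_derivative g') (at s)"
    unfolding g_def g'_def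
    by (rule derivative_eq_intros refl | simp; fail)+
       (simp only: rat, use inv trig_relations(1,2,4,5)[of s] in algebra)
  have dv: "(v has_real_derivative v') (at s)"
    unfolding v_def v'_def
    by (rule derivative_eq_intros refl | simp; fail)+ (simp only: rat, use inv(1) in algebra)
  have db: "(beta_a a has_real_derivative b') (at s)"
    using beta_a_deriv[of s] unfolding omega_a_eq b'_def .
  have "((\<lambda>s. g s * M s + beta_a a s * v s) has_real_derivative
      (g' * M s + M' * g s) + (b' * v s + v' * beta_a a s)) (at s)"
    by (intro DERIV_add DERIV_mult dM dg dv db)
  moreover have "(g' * M s + M' * g s) + (b' * v s + v' * beta_a a s) =
      S s / (z s)\<^sup>2 * (g s * M s + beta_a a s * v s) - (2 * c\<^sup>2 / (z s) ^ 4 + 2) * ww a s"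
  proof -
    have "v' = S s / (z s)\<^sup>2 * v s - (2 * c\<^sup>2 / (z s) ^ 4 + 2) * (S s / z s)"
      unfolding v'_def v_def by (simp only: rat, use inv(1) in algebra)
    moreover have "g' * M s + M' * g s + b' * v s =
        S s / (z s)\<^sup>2 * (g s * M s) - (2 * c\<^sup>2 / (z s) ^ 4 + 2) * (c * cos (2 * s) / (2 * (L s)\<^sup>2 * (z s)\<^sup>2))"
    proof -
      have M: "M s = k\<^sup>2 / 4 - 1/2 + y\<^sup>2 / 4" unfolding M_def by (simp add: y_def k_def field_simps)
      show ?thesis
        unfolding M g'_def M'_def g_def b'_def v_def
        by (simp only: rat, use inv trig_relations(1-5)[of s] c_relations(1) in algebra)
    qed
    moreover have "A + B + (E + v' * b) = X * (w + b * v) - Y * (e + b * S / t)"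
      if "v' = X * v - Y * (S / t)" "A + B + E = X * w - Y * e" for A B E v' b X w v Y e S t :: real
      using that unfolding times_divide_eq_right[symmetric] by algebra
    ultimately show ?thesis unfolding ww_def by blast
  qed
  ultimately show ?thesis
    unfolding M_def g_def v_def ww1_def[abs_def] by simp
qed

text \<open>Implicit differentiation of \<open>HH = 0\<close>, with the boundary values of \<open>sin \<beta>\<close> and \<open>cos \<beta>\<close> inserted.\<close>

lemma s1_deriv_eq: "- HH_a a \<sigma> / HH_s a \<sigma> =
  (sin (2 * \<sigma>) * c * z \<sigma> + a / c * z \<sigma> * S \<sigma> - c * cos (2 * \<sigma>) * S \<sigma> / (2 * z \<sigma>)
    - beta_a a \<sigma> * ((S \<sigma>)\<^sup>2 + c\<^sup>2 * (z \<sigma>)\<^sup>2)) / ((L \<sigma>)\<^sup>2 * c * z \<sigma>)"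
  unfolding HH_s_s1 HH_a_def sin_B_s1 cos_B_s1
  by (simp add: field_simps power2_eq_square)

lemma s1_deriv_simplified:
  "- HH_a a \<sigma> / HH_s a \<sigma> = sin (2 * \<sigma>) * (1 / (4 * c\<^sup>2) - 1/2 + 1 / (4 * (z \<sigma>)\<^sup>2)) / (L \<sigma>)\<^sup>2
     - beta_a a \<sigma> * D\<^sup>2 / (c * z \<sigma>)"
proof -
  have 1: "(S \<sigma>)\<^sup>2 + c\<^sup>2 * (z \<sigma>)\<^sup>2 = (L \<sigma>)\<^sup>2 * D\<^sup>2"
    using D_sq SLz[of \<sigma>] Lz[of \<sigma>] by algebra
  have 2: "sin (2 * \<sigma>) * c * z \<sigma> + a / c * z \<sigma> * S \<sigma> - c * cos (2 * \<sigma>) * S \<sigma> / (2 * z \<sigma>)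
      = sin (2 * \<sigma>) * (1 / (4 * c\<^sup>2) - 1/2 + 1 / (4 * (z \<sigma>)\<^sup>2)) * (c * z \<sigma>)"
    by (simp only: rational, use trig_relations[of \<sigma>] c_relations in algebra)
  have 3: "(m * (c * z \<sigma>) - b * (l * d)) / (l * c * z \<sigma>) = m / l - b * d / (c * z \<sigma>)" if "l \<noteq> 0" for m b l d
    using that by (simp add: field_simps)
  show ?thesis unfolding s1_deriv_eq 1 2 by (rule 3) simp
qed

text \<open>Since \<open>cot R = - S/z\<^sup>2\<close>, the bracket is the Robin defect \<open>w' - cot(R) w\<close> at the boundary. The identity is the
  link between criticality of the radius and the kernel.\<close>

lemma Rad_deriv: "(Rad has_real_derivative - ((z \<sigma>)\<^sup>2 / c) * (ww1 a \<sigma> + S \<sigma> / (z \<sigma>)\<^sup>2 * ww a \<sigma>)) (at a)"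
proof -
  define s' where "s' = - HH_a a \<sigma> / HH_s a \<sigma>"
  let ?q = "\<lambda>b. (b * sin (2 * s1 b)) / (1/2 + b * cos (2 * s1 b))"
  have d: "(s1 has_real_derivative s') (at a)" unfolding s'_def by (rule s1_deriv)
  have z: "1/2 + a * cos (2 * \<sigma>) = (z \<sigma>)\<^sup>2" by (simp add: zz_sq)
  have q: "(?q has_real_derivative
      ((sin (2 * \<sigma>) + a * (cos (2 * \<sigma>) * (2 * s'))) * (z \<sigma>)\<^sup>2
        - S \<sigma> * (cos (2 * \<sigma>) - S \<sigma> * (2 * s'))) / ((z \<sigma>)\<^sup>2 * (z \<sigma>)\<^sup>2)) (at a)"
  proof -
    have 1: "((\<lambda>b. b * sin (2 * s1 b)) has_real_derivative sin (2 * \<sigma>) + a * (cos (2 * \<sigma>) * (2 * s'))) (at a)"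
      by (rule derivative_eq_intros d refl)+ simp
    have 2: "((\<lambda>b. 1/2 + b * cos (2 * s1 b)) has_real_derivative cos (2 * \<sigma>) - S \<sigma> * (2 * s')) (at a)"
      by (rule derivative_eq_intros d refl)+ (simp add: SS_def)
    show ?thesis using DERIV_divide[OF 1 2] by (simp add: z SS_def)
  qed
  have "((\<lambda>b. pi / 2 + arctan (?q b)) has_real_derivative
      inverse (1 + (?q a)\<^sup>2) * (((sin (2 * \<sigma>) + a * (cos (2 * \<sigma>) * (2 * s'))) * (z \<sigma>)\<^sup>2
        - S \<sigma> * (cos (2 * \<sigma>) - S \<sigma> * (2 * s'))) / ((z \<sigma>)\<^sup>2 * (z \<sigma>)\<^sup>2))) (at a)"
    by (rule derivative_eq_intros q refl)+ simp
  moreover have "inverse (1 + (?q a)\<^sup>2) = (z \<sigma>) ^ 4 / D\<^sup>2"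
  proof -
    have "1 + (?q a)\<^sup>2 = D\<^sup>2 / (z \<sigma>) ^ 4"
      unfolding z D_sq' power_divide by (simp add: SS_def add_divide_distrib)
    then show ?thesis by simp
  qed
  moreover have "(z \<sigma>) ^ 4 / D\<^sup>2 * (((sin (2 * \<sigma>) + a * (cos (2 * \<sigma>) * (2 * s'))) * (z \<sigma>)\<^sup>2
        - S \<sigma> * (cos (2 * \<sigma>) - S \<sigma> * (2 * s'))) / ((z \<sigma>)\<^sup>2 * (z \<sigma>)\<^sup>2))
      = - ((z \<sigma>)\<^sup>2 / c) * (ww1 a \<sigma> + S \<sigma> / (z \<sigma>)\<^sup>2 * ww a \<sigma>)" (is "?lhs = ?rhs")
  proof -
    define M where "M = 1 / (4 * c\<^sup>2) - 1/2 + 1 / (4 * (z \<sigma>)\<^sup>2)"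
    define b where "b = beta_a a \<sigma>"
    define y where "y = inverse (z \<sigma>)"
    define p where "p = inverse (L \<sigma>)"
    define k where "k = inverse c"
    have inv: "z \<sigma> * y = 1" "L \<sigma> * p = 1" "c * k = 1" by (simp_all add: y_def p_def k_def)
    note rat = rational y_def[symmetric] p_def[symmetric] k_def[symmetric] M_def[symmetric] b_def[symmetric]
    have s': "s' = sin (2 * \<sigma>) * M * p\<^sup>2 - b * D\<^sup>2 * (k * y)"
      unfolding s'_def s1_deriv_simplified M_def[symmetric] by (simp only: rat)
    have M: "4 * M * c\<^sup>2 * (z \<sigma>)\<^sup>2 = (z \<sigma>)\<^sup>2 - 2 * c\<^sup>2 * (z \<sigma>)\<^sup>2 + c\<^sup>2"
      unfolding M_def by (simp add: field_simps)
    have num: "(sin (2 * \<sigma>) + a * (cos (2 * \<sigma>) * (2 * s'))) * (z \<sigma>)\<^sup>2 - S \<sigma> * (cos (2 * \<sigma>) - S \<sigma> * (2 * s'))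
        = sin (2 * \<sigma>) / 2 + s' * ((z \<sigma>)\<^sup>2 - 2 * c\<^sup>2)"
      using trig_relations(1,2,4,5)[of \<sigma>] SLz[of \<sigma>] by algebra
    have rhs: "?rhs = sin (2 * \<sigma>) * M * p\<^sup>2 - b * ((z \<sigma>)\<^sup>2 - 2 * c\<^sup>2) * (k * y) - S \<sigma> * cos (2 * \<sigma>) * p\<^sup>2 * y\<^sup>2 / 2"
      unfolding ww1_def ww_def M_def[symmetric] b_def[symmetric]
      by (simp only: rat, use SLz[of \<sigma>] Lz[of \<sigma>] inv in algebra)
    have key: "sin (2 * \<sigma>) / 2 - sin (2 * \<sigma>) * M * p\<^sup>2 * c\<^sup>2 + D\<^sup>2 * (S \<sigma> * cos (2 * \<sigma>) * p\<^sup>2 * y\<^sup>2 / 2) = 0"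
      using trig_relations(1,2,4,5)[of \<sigma>] D_sq M inv(1,2) by algebra
    have "sin (2 * \<sigma>) / 2 + s' * ((z \<sigma>)\<^sup>2 - 2 * c\<^sup>2) = D\<^sup>2 * ?rhs"
    proof -
      have "h + (w - b * d * q) * (Z - 2 * C2) = d * (w - b * (Z - 2 * C2) * q - t)"
        if "h - w * C2 + d * t = 0" "d = Z - C2" for h w b d q Z C2 t :: real
        using that by algebra
      from this[OF key D_sq] show ?thesis unfolding rhs s' .
    qed
    note eq = this
    have cancel: "w / d * (d * r / w) = r" if "w \<noteq> 0" "d \<noteq> 0" for w d r :: real using that by simp
    have sq: "(z \<sigma>)\<^sup>2 * (z \<sigma>)\<^sup>2 = (z \<sigma>) ^ 4" by (simp flip: power_add)
    show ?thesis unfolding num eq sq by (rule cancel) simp_all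
  qed
  ultimately have der: "((\<lambda>b. pi / 2 + arctan (?q b)) has_real_derivative
      - ((z \<sigma>)\<^sup>2 / c) * (ww1 a \<sigma> + S \<sigma> / (z \<sigma>)\<^sup>2 * ww a \<sigma>)) (at a)" by simp
  show ?thesis
  proof (rule has_field_derivative_transform_within_open[OF der, where S = "{0<..<1/2}"])
    fix b :: real assume "b \<in> {0<..<1/2}"
    then interpret b: annulus_parameter b by (simp add: annulus_parameter_def)
    show "pi / 2 + arctan (?q b) = Rad b" by (simp add: b.Rad_eq b.zz_sq SS_def)
  qed (use a_pos a_less in auto)
qed

lemma ww_minus: "ww a (- s) = ww a s"
  by (simp add: ww_def beta_a_minus parity)

lemma ww_0_pos: "0 < ww a 0"
  using cc_pos zz_pos L_pos by (auto simp: ww_def intro!: divide_pos_pos mult_pos_pos)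

lemma Rad_le_small: "Rad a \<le> pi / 2 + a / (1/2 - a)"
proof -
  have "S \<sigma> / (z \<sigma>)\<^sup>2 \<le> a / (1/2 - a)"
  proof (rule frac_le)
    show "S \<sigma> \<le> a" using a_pos by (simp add: SS_def mult_left_le)
    have "- a \<le> a * cos (2 * \<sigma>)" using mult_left_mono[of "- 1" "cos (2 * \<sigma>)" a] a_pos by simp
    then show "1/2 - a \<le> (z \<sigma>)\<^sup>2" by (simp add: zz_sq)
  qed (use a_pos a_less in auto)
  moreover have "arctan (S \<sigma> / (z \<sigma>)\<^sup>2) \<le> S \<sigma> / (z \<sigma>)\<^sup>2"
    using S_s1_pos by (intro arctan_le_self) auto
  ultimately show ?thesis by (simp add: Rad_eq)
qed

text \<open>\<open>cos R = x = L cos \<beta>\<close> at the boundary, where \<open>L \<le> 1\<close> and \<open>cos \<beta> < 0\<close>; so \<open>cos R \<ge> cos \<beta>\<close>, that is \<open>R \<le> \<beta>\<close>.\<close>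

lemma Rad_le_large: "Rad a \<le> pi / 2 + sqrt c * (pi / 2)"
proof -
  have "(L \<sigma>)\<^sup>2 \<le> 1\<^sup>2" using Lz[of \<sigma>] zero_le_power2[of "z \<sigma>"] unfolding one_power2 by linarith
  then have "L \<sigma> \<le> 1" by (rule power2_le_imp_le) simp
  then have "cos (B \<sigma>) \<le> L \<sigma> * cos (B \<sigma>)"
    using mult_right_mono_neg[of "L \<sigma>" 1 "cos (B \<sigma>)"] cos_B_s1_neg by simp
  also have "\<dots> = cos (Rad a)" unfolding cos_Rad boundary_values(1)[symmetric] xx_eq ..
  finally have "Rad a \<le> B \<sigma>"
    using B_bounds[of \<sigma>] s1_pos s1_less Rad_gt Rad_less pi_gt_zero
    by (subst (asm) cos_mono_le_eq) auto
  also have "\<dots> \<le> B (pi / 2)" using B_strict_mono[OF s1_less] by simp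
  finally show ?thesis using B_pi_half_le by simp
qed

end

lemma Rad_tendsto_0: "(Rad \<longlongrightarrow> pi / 2) (at_right 0)"
proof (rule tendsto_sandwich)
  have ev: "\<forall>\<^sub>F a in at_right 0. annulus_parameter a"
    unfolding eventually_at_right_field by (intro exI[of _ "1/2"]) (auto simp: annulus_parameter_def)
  show "\<forall>\<^sub>F a in at_right 0. pi / 2 \<le> Rad a"
    using ev by eventually_elim (rule less_imp_le[OF annulus_parameter.Rad_gt])
  show "\<forall>\<^sub>F a in at_right 0. Rad a \<le> pi / 2 + a / (1/2 - a)"
    using ev by eventually_elim (rule annulus_parameter.Rad_le_small)
  show "((\<lambda>a. pi / 2 + a / (1/2 - a)) \<longlongrightarrow> pi / 2) (at_right (0::real))"
    by (rule tendsto_eq_intros refl | simp)+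
qed simp

lemma Rad_tendsto_half: "(Rad \<longlongrightarrow> pi / 2) (at_left (1/2))"
proof (rule tendsto_sandwich)
  have ev: "\<forall>\<^sub>F a in at_left (1/2). annulus_parameter a"
    unfolding eventually_at_left_field by (intro exI[of _ 0]) (auto simp: annulus_parameter_def)
  show "\<forall>\<^sub>F a in at_left (1/2). pi / 2 \<le> Rad a"
    using ev by eventually_elim (rule less_imp_le[OF annulus_parameter.Rad_gt])
  show "\<forall>\<^sub>F a in at_left (1/2). Rad a \<le> pi / 2 + sqrt (cc a) * (pi / 2)"
    using ev by eventually_elim (rule annulus_parameter.Rad_le_large)
  have "((\<lambda>a. pi / 2 + sqrt (sqrt (1/4 - a\<^sup>2)) * (pi / 2)) \<longlongrightarrow> pi / 2 + sqrt (sqrt (1/4 - (1/2)\<^sup>2)) * (pi / 2)) (at_left (1/2::real))"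
    by (intro tendsto_intros)
  then show "((\<lambda>a. pi / 2 + sqrt (cc a) * (pi / 2)) \<longlongrightarrow> pi / 2) (at_left (1/2))"
    by (simp add: cc_def power2_eq_square)
qed simp

section \<open>Analytic functions above their common limit at both ends\<close>

locale analytic_hump =
  fixes f :: "real \<Rightarrow> real" and l u m :: real
  assumes lu: "l < u" and analytic: "real_analytic_on {l<..<u} f"
    and above: "\<And>x. x \<in> {l<..<u} \<Longrightarrow> m < f x"
    and lim_l: "(f \<longlongrightarrow> m) (at_right l)" and lim_u: "(f \<longlongrightarrow> m) (at_left u)"
begin

lemma continuous: "S \<subseteq> {l<..<u} \<Longrightarrow> continuous_on S f"
  by (meson real_analytic_on_differentiable[OF analytic] continuous_at_imp_continuous_on
      field_differentiable_imp_continuous_at subsetD)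

lemma superlevel_bounds:
  assumes "m < r"
  obtains d e where "l < d" "e < u" "\<And>x. x \<in> {l<..<u} \<Longrightarrow> r \<le> f x \<Longrightarrow> d \<le> x \<and> x \<le> e"
proof -
  obtain d where d: "d > l" "\<And>y. y > l \<Longrightarrow> y < d \<Longrightarrow> f y < r"
    using order_tendstoD(2)[OF lim_l assms] unfolding eventually_at_right_field by blast
  obtain e where e: "e < u" "\<And>y. y > e \<Longrightarrow> y < u \<Longrightarrow> f y < r"
    using order_tendstoD(2)[OF lim_u assms] unfolding eventually_at_left_field by blast
  show thesis by (rule that[OF d(1) e(1)]) (use d(2) e(2) in force)
qed

lemma maximum: "\<exists>p\<in>{l<..<u}. \<forall>x\<in>{l<..<u}. f x \<le> f p"
proof -
  define k where "k = (l + u) / 2"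
  have k: "k \<in> {l<..<u}" using lu by (simp add: k_def)
  obtain d e where de: "l < d" "e < u" "\<And>x. x \<in> {l<..<u} \<Longrightarrow> f k \<le> f x \<Longrightarrow> d \<le> x \<and> x \<le> e"
    using superlevel_bounds[OF above[OF k]] by blast
  have "k \<in> {d..e}" using de(3)[OF k] by simp
  then have "\<exists>p\<in>{d..e}. \<forall>x\<in>{d..e}. f x \<le> f p"
    using de by (intro continuous_attains_sup continuous) auto
  then obtain p where p: "p \<in> {d..e}" "\<And>x. x \<in> {d..e} \<Longrightarrow> f x \<le> f p" by blast
  have "f x \<le> f p" if "x \<in> {l<..<u}" for x
    using de(3)[OF that] p(2)[of x] p(2)[OF \<open>k \<in> {d..e}\<close>] by (cases "f k \<le> f x") auto
  then show ?thesis using p(1) de by (intro bexI[of _ p]) auto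
qed

lemma nonconstant: "\<exists>x\<in>{l<..<u}. f x \<noteq> r"
proof (rule ccontr)
  assume "\<not> ?thesis"
  then have const: "\<And>x. x \<in> {l<..<u} \<Longrightarrow> f x = r" by blast
  define k where "k = (l + u) / 2"
  have k: "k \<in> {l<..<u}" using lu by (simp add: k_def)
  obtain d e where de: "l < d" "\<And>x. x \<in> {l<..<u} \<Longrightarrow> f k \<le> f x \<Longrightarrow> d \<le> x \<and> x \<le> e"
    using superlevel_bounds[OF above[OF k]] by blast
  define x where "x = (l + min d u) / 2"
  have "x \<in> {l<..<u}" "x < d" using de(1) lu by (auto simp: x_def)
  then show False using de(2)[of x] const[OF k] const[of x] by auto
qed

lemma not_mono: "\<not> mono_on {l<..<u} f" and not_antimono: "\<not> antimono_on {l<..<u} f"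
proof -
  define k where "k = (l + u) / 2"
  have k: "k \<in> {l<..<u}" using lu by (simp add: k_def)
  obtain d e where de: "l < d" "e < u" "\<And>x. x \<in> {l<..<u} \<Longrightarrow> f k \<le> f x \<Longrightarrow> d \<le> x \<and> x \<le> e"
    using superlevel_bounds[OF above[OF k]] by blast
  have k': "d \<le> k" "k \<le> e" using de(3)[OF k] by auto
  define x where "x = (l + d) / 2"
  define y where "y = (e + u) / 2"
  have x: "x \<in> {l<..<u}" "x < d" and y: "y \<in> {l<..<u}" "e < y"
    using de(1,2) k' k by (auto simp: x_def y_def)
  show "\<not> mono_on {l<..<u} f"
    using de(3)[OF y(1)] y k k' unfolding monotone_on_def by (meson less_le_not_le order.trans less_imp_le)
  show "\<not> antimono_on {l<..<u} f"
    using de(3)[OF x(1)] x k k' unfolding monotone_on_def by (meson less_le_not_le order.trans less_imp_le)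
qed

text \<open>A level above the limit is attained only in a compact subinterval, so an infinite level set would
  accumulate at an interior point, against the isolation of zeros of \<open>f - r\<close>.\<close>

lemma finite_level:
  assumes "m < r"
  shows "finite {x \<in> {l<..<u}. f x = r}"
proof (rule ccontr)
  assume inf: "infinite {x \<in> {l<..<u}. f x = r}"
  obtain d e where de: "l < d" "e < u" "\<And>x. x \<in> {l<..<u} \<Longrightarrow> r \<le> f x \<Longrightarrow> d \<le> x \<and> x \<le> e"
    using superlevel_bounds[OF assms] by blast
  have "{x \<in> {l<..<u}. f x = r} \<subseteq> {d..e}" using de(3) by auto
  then obtain x where x: "x \<in> {d..e}" "x islimpt {x \<in> {l<..<u}. f x = r}"
    using Heine_Borel_imp_Bolzano_Weierstrass[OF compact_Icc inf] by blast
  have "\<forall>\<^sub>F y in at x. f y + (- r) \<noteq> 0"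
  proof (rule real_analytic_isolated_zeros)
    show "real_analytic_on {l<..<u} (\<lambda>y. f y + (- r))" by (rule real_analytic_on_add_const[OF analytic])
    show "\<exists>x\<in>{l<..<u}. f x + - r \<noteq> 0" using nonconstant[of r] by simp
    show "x \<in> {l<..<u}" using x(1) de(1,2) by auto
  qed auto
  then have "\<forall>\<^sub>F y in at x. y \<notin> {x \<in> {l<..<u}. f x = r}"
    by (rule eventually_mono) auto
  then show False using x(2) by (simp add: islimpt_iff_eventually)
qed

lemma two_solutions:
  assumes "p \<in> {l<..<u}" "m < r" "r < f p"
  shows "\<exists>x y. x \<in> {l<..<u} \<and> y \<in> {l<..<u} \<and> x < y \<and> f x = r \<and> f y = r"
proof -
  obtain d e where de: "l < d" "e < u" "\<And>x. x \<in> {l<..<u} \<Longrightarrow> r \<le> f x \<Longrightarrow> d \<le> x \<and> x \<le> e"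
    using superlevel_bounds[OF assms(2)] by blast
  have p: "d \<le> p" "p \<le> e" using de(3)[OF assms(1)] assms(3) by auto
  define x y where "x = (l + d) / 2" and "y = (e + u) / 2"
  have x: "x \<in> {l<..<u}" "x < d" and y: "y \<in> {l<..<u}" "e < y"
    using de(1,2) p assms(1) by (auto simp: x_def y_def)
  have "f x < r" "f y < r" using de(3)[OF x(1)] de(3)[OF y(1)] x y by force+
  then obtain x' y' where "x \<le> x'" "x' \<le> p" "f x' = r" "p \<le> y'" "y' \<le> y" "f y' = r"
  proof -
    have "{x..p} \<subseteq> {l<..<u}" "{p..y} \<subseteq> {l<..<u}" using x y assms(1) by auto
    then show thesis
      using IVT'[of f x r p] IVT2'[of f y r p] continuous that x y p \<open>f x < r\<close> \<open>f y < r\<close> assms(3)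
      by (meson less_imp_le order.trans)
  qed
  moreover have "x' \<noteq> p" using assms(3) \<open>f x' = r\<close> by auto
  ultimately show ?thesis using x y by (intro exI[of _ x'] exI[of _ y']) auto
qed

lemma two_le_card_level:
  assumes "p \<in> {l<..<u}" "m < r" "r < f p"
  shows "2 \<le> card {x \<in> {l<..<u}. f x = r}"
proof -
  obtain x y where "x \<in> {l<..<u}" "y \<in> {l<..<u}" "x < y" "f x = r" "f y = r"
    using two_solutions[OF assms] by blast
  then have "card {x, y} \<le> card {x \<in> {l<..<u}. f x = r}"
    by (intro card_mono finite_level assms) auto
  then show ?thesis using \<open>x < y\<close> by simp
qed

lemma not_inj: "\<not> inj_on f {l<..<u}"
proof -
  define k where "k = (l + u) / 2"
  have k: "k \<in> {l<..<u}" using lu by (simp add: k_def)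
  obtain r where "m < r" "r < f k" using dense[OF above[OF k]] by blast
  then obtain x y where "x \<in> {l<..<u}" "y \<in> {l<..<u}" "x < y" "f x = r" "f y = r"
    using two_solutions[OF k] by blast
  then show ?thesis unfolding inj_on_def by (metis less_irrefl)
qed

lemma critical_discrete: "discrete {x \<in> {l<..<u}. deriv f x = 0}"
proof (rule discreteI)
  fix x assume x: "x \<in> {x \<in> {l<..<u}. deriv f x = 0}"
  have "\<exists>y\<in>{l<..<u}. deriv f y \<noteq> 0"
  proof (rule ccontr)
    assume neg: "\<not> ?thesis"
    have "(f has_real_derivative 0) (at y within {l<..<u})" if "y \<in> {l<..<u}" for y
      using real_analytic_on_differentiable[OF analytic that] neg that
      by (metis field_differentiable_derivI has_field_derivative_at_within)
    then have "\<exists>r. \<forall>y\<in>{l<..<u}. f y = r"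
      using has_field_derivative_zero_constant[of "{l<..<u}" f] by auto
    then show False using nonconstant by auto
  qed
  then have "\<forall>\<^sub>F y in at x. deriv f y \<noteq> 0"
    using x by (intro real_analytic_isolated_zeros[OF real_analytic_on_deriv[OF analytic]]) auto
  then have "\<not> x islimpt {x \<in> {l<..<u}. deriv f x = 0}"
    unfolding islimpt_iff_eventually not_not by (rule eventually_mono) auto
  then show "x isolated_in {x \<in> {l<..<u}. deriv f x = 0}"
    using x by (simp add: isolated_in_islimpt_iff)
qed

end

interpretation Rad: analytic_hump Rad 0 "1/2" "pi / 2"
proof unfold_locales
  show "pi / 2 < Rad a" if "a \<in> {0<..<1/2}" for a
    by (rule annulus_parameter.Rad_gt) (use that in \<open>simp add: annulus_parameter_def\<close>)
qed (use Rad_real_analytic Rad_tendsto_0 Rad_tendsto_half in auto)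

no_notation fps_nth (infixl "$" 75)

section \<open>Functions of class Ck\<close>

lemma Ck_Suc_imp_Ck: "Ck (Suc k) S f \<Longrightarrow> Ck k S f"
proof (induction k arbitrary: f)
  case 0
  then show ?case by (auto intro: has_derivative_continuous_on)
next
  case (Suc k)
  then obtain D where D: "\<And>x. x \<in> S \<Longrightarrow> (f has_derivative D x) (at x within S)" "\<And>v. Ck (Suc k) S (\<lambda>x. D x v)"
    unfolding Ck.simps(2)[of "Suc k"] by blast
  show ?case unfolding Ck.simps(2)[of k] using D Suc.IH by blast
qed

lemma Ck_SucI:
  assumes "\<And>x. x \<in> S \<Longrightarrow> (f has_derivative D x) (at x within S)" "\<And>v. Ck k S (\<lambda>x. D x v)"
  shows "Ck (Suc k) S f"
  using assms by auto

lemma Ck_SucE: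
  assumes "Ck (Suc k) S f"
  obtains D where "\<And>x. x \<in> S \<Longrightarrow> (f has_derivative D x) (at x within S)" "\<And>v. Ck k S (\<lambda>x. D x v)"
  using assms by auto

lemma Ck_const: "Ck k S (\<lambda>x. c)"
  by (induction k arbitrary: c) (auto intro!: exI[of _ "\<lambda>x v. 0"])

lemma Ck_bounded_linear: "bounded_linear f \<Longrightarrow> Ck k S f"
proof (cases k)
  case 0
  then show "bounded_linear f \<Longrightarrow> ?thesis" by (simp add: linear_continuous_on)
next
  case (Suc n)
  assume "bounded_linear f"
  then show ?thesis unfolding Suc
    by (intro Ck_SucI[where D = "\<lambda>_. f"] Ck_const bounded_linear_imp_has_derivative)
qed

lemma Ck_linear_compose:
  assumes T: "bounded_linear T"
  shows "Ck k S f \<Longrightarrow> Ck k S (\<lambda>x. T (f x))"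
proof (induction k arbitrary: f)
  case 0
  then show ?case using bounded_linear.continuous_on[OF T] by auto
next
  case (Suc k)
  obtain D where D: "\<And>x. x \<in> S \<Longrightarrow> (f has_derivative D x) (at x within S)" "\<And>v. Ck k S (\<lambda>x. D x v)"
    using Ck_SucE[OF Suc.prems] by blast
  show ?case
  proof (rule Ck_SucI[where D = "\<lambda>x v. T (D x v)"])
    show "((\<lambda>x. T (f x)) has_derivative (\<lambda>v. T (D x v))) (at x within S)" if "x \<in> S" for x
      by (rule bounded_linear.has_derivative[OF T D(1)[OF that]])
  qed (rule Suc.IH[OF D(2)])
qed

lemma Ck_add: "Ck k S f \<Longrightarrow> Ck k S g \<Longrightarrow> Ck k S (\<lambda>x. f x + g x)"
proof (induction k arbitrary: f g)
  case (Suc k)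
  obtain D where D: "\<And>x. x \<in> S \<Longrightarrow> (f has_derivative D x) (at x within S)" "\<And>v. Ck k S (\<lambda>x. D x v)"
    using Ck_SucE[OF Suc.prems(1)] by blast
  obtain E where E: "\<And>x. x \<in> S \<Longrightarrow> (g has_derivative E x) (at x within S)" "\<And>v. Ck k S (\<lambda>x. E x v)"
    using Ck_SucE[OF Suc.prems(2)] by blast
  show ?case
    by (rule Ck_SucI[where D = "\<lambda>x v. D x v + E x v"]) (use D E Suc.IH in \<open>auto intro: has_derivative_add\<close>)
qed (auto intro: continuous_intros)

lemma Ck_mult:
  fixes f g :: "'a::real_normed_vector \<Rightarrow> real"
  shows "Ck k S f \<Longrightarrow> Ck k S g \<Longrightarrow> Ck k S (\<lambda>x. f x * g x)"
proof (induction k arbitrary: f g)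
  case (Suc k)
  obtain D where D: "\<And>x. x \<in> S \<Longrightarrow> (f has_derivative D x) (at x within S)" "\<And>v. Ck k S (\<lambda>x. D x v)"
    using Ck_SucE[OF Suc.prems(1)] by blast
  obtain E where E: "\<And>x. x \<in> S \<Longrightarrow> (g has_derivative E x) (at x within S)" "\<And>v. Ck k S (\<lambda>x. E x v)"
    using Ck_SucE[OF Suc.prems(2)] by blast
  have fg: "Ck k S f" "Ck k S g" using Suc.prems Ck_Suc_imp_Ck by blast+
  show ?case
  proof (rule Ck_SucI[where D = "\<lambda>x v. f x * E x v + D x v * g x"])
    show "((\<lambda>x. f x * g x) has_derivative (\<lambda>v. f x * E x v + D x v * g x)) (at x within S)" if "x \<in> S" for x
      using D(1)[OF that] E(1)[OF that] by (rule has_derivative_mult)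
    show "Ck k S (\<lambda>x. f x * E x v + D x v * g x)" for v
      by (intro Ck_add Suc.IH fg D(2) E(2))
  qed
qed (auto intro: continuous_intros)

text \<open>The outer function is a function of a real variable, so its derivative in direction \<open>v\<close> is \<open>v\<close> times a
  function of one variable and the induction stays within real-valued functions.\<close>

lemma Ck_compose:
  fixes f :: "'a::real_normed_vector \<Rightarrow> real" and g :: "real \<Rightarrow> real"
  assumes "f ` S \<subseteq> T"
  shows "Ck k T g \<Longrightarrow> Ck k S f \<Longrightarrow> Ck k S (\<lambda>x. g (f x))"
proof (induction k arbitrary: g)
  case 0
  then show ?case using assms continuous_on_compose2 by auto
next
  case (Suc k)
  obtain D where D: "\<And>x. x \<in> S \<Longrightarrow> (f has_derivative D x) (at x within S)" "\<And>v. Ck k S (\<lambda>x. D x v)"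
    using Ck_SucE[OF Suc.prems(2)] by blast
  obtain E where E: "\<And>x. x \<in> T \<Longrightarrow> (g has_derivative E x) (at x within T)" "\<And>v. Ck k T (\<lambda>x. E x v)"
    using Ck_SucE[OF Suc.prems(1)] by blast
  have f: "Ck k S f" using Suc.prems Ck_Suc_imp_Ck by blast
  show ?case
  proof (rule Ck_SucI[where D = "\<lambda>x v. D x v * E (f x) 1"])
    fix x assume x: "x \<in> S"
    have g: "(g has_derivative E (f x)) (at (f x) within f ` S)"
      using E(1)[of "f x"] x assms by (auto intro: has_derivative_subset)
    have linear: "(\<lambda>v. E (f x) (D x v)) = (\<lambda>v. D x v * E (f x) 1)"
    proof
      show "E (f x) (D x v) = D x v * E (f x) 1" for v
        using linear.scaleR[OF has_derivative_linear[OF g], of "D x v" 1] by simp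
    qed
    show "((\<lambda>x. g (f x)) has_derivative (\<lambda>v. D x v * E (f x) 1)) (at x within S)"
      using has_derivative_in_compose[OF D(1)[OF x] g] unfolding linear .
  next
    show "Ck k S (\<lambda>x. D x v * E (f x) 1)" for v
      by (rule Ck_mult[OF D(2) Suc.IH[OF E(2) f]])
  qed
qed

lemma Ck_Suc_real:
  fixes f f' :: "real \<Rightarrow> real"
  assumes "\<And>x. x \<in> T \<Longrightarrow> (f has_real_derivative f' x) (at x)" "Ck k T f'"
  shows "Ck (Suc k) T f"
proof (rule Ck_SucI[where D = "\<lambda>x v. f' x * v"])
  show "(f has_derivative (*) (f' x)) (at x within T)" if "x \<in> T" for x
    by (rule has_derivative_at_withinI[OF assms(1)[OF that, unfolded has_field_derivative_def]])
  show "Ck k T (\<lambda>x. f' x * v)" for v by (intro Ck_mult assms(2) Ck_const)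
qed

lemma smooth_const: "smooth S (\<lambda>x. c)"
  by (simp add: smooth_def Ck_const)

lemma smooth_bounded_linear: "bounded_linear f \<Longrightarrow> smooth S f"
  by (simp add: smooth_def Ck_bounded_linear)

lemma smooth_add: "smooth S f \<Longrightarrow> smooth S g \<Longrightarrow> smooth S (\<lambda>x. f x + g x)"
  by (simp add: smooth_def Ck_add)

lemma smooth_linear_compose: "bounded_linear T \<Longrightarrow> smooth S f \<Longrightarrow> smooth S (\<lambda>x. T (f x))"
  by (simp add: smooth_def Ck_linear_compose)

lemma smooth_mult: "smooth S f \<Longrightarrow> smooth S g \<Longrightarrow> smooth S (\<lambda>x. f x * g x :: real)"
  by (simp add: smooth_def Ck_mult)

lemma smooth_compose:
  fixes f :: "'a::real_normed_vector \<Rightarrow> real" and g :: "real \<Rightarrow> real"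
  shows "smooth T g \<Longrightarrow> f ` S \<subseteq> T \<Longrightarrow> smooth S f \<Longrightarrow> smooth S (\<lambda>x. g (f x))"
  by (simp add: smooth_def Ck_compose)

lemma smooth_minus:
  fixes f :: "'a::real_normed_vector \<Rightarrow> real"
  shows "smooth S f \<Longrightarrow> smooth S (\<lambda>x. - f x)"
  by (rule smooth_linear_compose[OF bounded_linear_minus[OF bounded_linear_ident]])

lemma smooth_diff:
  fixes f g :: "'a::real_normed_vector \<Rightarrow> real"
  shows "smooth S f \<Longrightarrow> smooth S g \<Longrightarrow> smooth S (\<lambda>x. f x - g x)"
  using smooth_add[OF _ smooth_minus, of S f g] by simp

lemma smooth_power: "smooth S f \<Longrightarrow> smooth S (\<lambda>x. f x ^ n :: real)"
  by (induction n) (simp_all add: smooth_const smooth_mult)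

lemma smooth_antiderivative:
  fixes f f' :: "real \<Rightarrow> real"
  assumes "\<And>x. x \<in> T \<Longrightarrow> (f has_real_derivative f' x) (at x)" "smooth T f'"
  shows "smooth T f"
  unfolding smooth_def using Ck_Suc_real[OF assms(1)] assms(2) Ck_Suc_imp_Ck by (metis smooth_def)

lemma smooth_sin: "smooth UNIV (sin :: real \<Rightarrow> real)" and smooth_cos: "smooth UNIV (cos :: real \<Rightarrow> real)"
proof -
  have "Ck k UNIV (sin :: real \<Rightarrow> real) \<and> Ck k UNIV (cos :: real \<Rightarrow> real)" for k
  proof (induction k)
    case 0
    then show ?case by (auto intro: continuous_intros)
  next
    case (Suc k)
    have "Ck k UNIV (\<lambda>x::real. - sin x)"
      using Ck_mult[OF Ck_const[of k UNIV "- 1"], of sin] Suc by simp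
    then show ?case using Suc Ck_Suc_real[of UNIV sin cos k] Ck_Suc_real[of UNIV cos "\<lambda>x. - sin x" k]
      by (simp add: DERIV_sin DERIV_cos)
  qed
  then show "smooth UNIV (sin :: real \<Rightarrow> real)" "smooth UNIV (cos :: real \<Rightarrow> real)"
    by (simp_all add: smooth_def)
qed

lemma smooth_inverse: "smooth {0<..} (inverse :: real \<Rightarrow> real)"
proof -
  have "Ck k {0<..} (inverse :: real \<Rightarrow> real)" for k
  proof (induction k)
    case 0
    then show ?case by (auto intro!: continuous_intros)
  next
    case (Suc k)
    have "Ck k {0<..} (\<lambda>x::real. - 1 * (inverse x * inverse x))"
      by (intro Ck_mult Ck_const Suc)
    then show ?case
      by (rule Ck_Suc_real[rotated]) (auto intro!: derivative_eq_intros)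
  qed
  then show ?thesis by (simp add: smooth_def)
qed

lemma smooth_sqrt: "smooth {0<..} sqrt"
proof -
  have "Ck k {0<..} sqrt" for k
  proof (induction k)
    case 0
    then show ?case by (auto intro!: continuous_intros)
  next
    case (Suc k)
    have "Ck k {0<..} (\<lambda>x. inverse (sqrt x) * (1 / 2))"
      by (intro Ck_mult Ck_const Ck_compose[OF _ smooth_inverse[unfolded smooth_def, rule_format]] Suc) auto
    then show ?case
      by (rule Ck_Suc_real[rotated]) (auto intro!: derivative_eq_intros simp: divide_simps)
  qed
  then show ?thesis by (simp add: smooth_def)
qed

lemma smooth_divide:
  "smooth S f \<Longrightarrow> smooth S g \<Longrightarrow> (\<And>x. x \<in> S \<Longrightarrow> 0 < g x) \<Longrightarrow> smooth S (\<lambda>x. f x / g x :: real)"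
  unfolding divide_inverse by (intro smooth_mult smooth_compose[OF smooth_inverse]) auto

lemma smooth_congI:
  assumes "smooth S f" "\<And>x. x \<in> S \<Longrightarrow> f x = g x"
  shows "smooth S g"
proof -
  have "Ck k S f \<Longrightarrow> Ck k S g" for k
  proof (cases k)
    case 0
    then show "Ck k S f \<Longrightarrow> Ck k S g" using assms(2) by (simp cong: continuous_on_cong)
  next
    case (Suc n)
    assume "Ck k S f"
    then obtain D where D: "\<And>x. x \<in> S \<Longrightarrow> (f has_derivative D x) (at x within S)" "\<And>v. Ck n S (\<lambda>x. D x v)"
      unfolding Suc using Ck_SucE by blast
    show ?thesis unfolding Suc
    proof (rule Ck_SucI[where D = D])
      show "(g has_derivative D x) (at x within S)" if "x \<in> S" for x
        by (rule has_derivative_transform[OF that _ D(1)[OF that]]) (simp add: assms(2))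
    qed (rule D(2))
  qed
  then show ?thesis using assms(1) by (simp add: smooth_def)
qed

lemma smooth_imp_continuous_on: "smooth S f \<Longrightarrow> continuous_on S f"
  unfolding smooth_def by (metis Ck.simps(1))

section \<open>Maps of revolution over the strip\<close>

definition revol :: "(real \<Rightarrow> real) \<Rightarrow> (real \<Rightarrow> real) \<Rightarrow> (real \<Rightarrow> real) \<Rightarrow> real^2 \<Rightarrow> real^4" where
  "revol f g h p = vector [f (p $ 1), g (p $ 1), h (p $ 1) * cos (p $ 2), h (p $ 1) * sin (p $ 2)]"

lemma vector_4 [simp]:
  "(vector [u, v, w, x] :: real^4) $ 1 = u" "(vector [u, v, w, x] :: real^4) $ 2 = v"
  "(vector [u, v, w, x] :: real^4) $ 3 = w" "(vector [u, v, w, x] :: real^4) $ 4 = x"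
  unfolding vector_def by simp_all

lemma vector_4_eq: "(vector [u, v, w, x] :: real^4) = u *\<^sub>R axis 1 1 + v *\<^sub>R axis 2 1 + w *\<^sub>R axis 3 1 + x *\<^sub>R axis 4 1"
  by (simp add: vec_eq_iff forall_4 axis_def)

lemma vector_4_inner: "(vector [u, v, w, x] :: real^4) \<bullet> q = u * q $ 1 + v * q $ 2 + w * q $ 3 + x * q $ 4"
  by (simp add: inner_vec_def sum_4)

lemma revol_nth [simp]:
  "revol f g h p $ 1 = f (p $ 1)" "revol f g h p $ 2 = g (p $ 1)"
  "revol f g h p $ 3 = h (p $ 1) * cos (p $ 2)" "revol f g h p $ 4 = h (p $ 1) * sin (p $ 2)"
  by (simp_all add: revol_def)

lemma inner_4: "(u :: real^4) \<bullet> v = u $ 1 * v $ 1 + u $ 2 * v $ 2 + u $ 3 * v $ 3 + u $ 4 * v $ 4"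
  by (simp add: inner_vec_def sum_4)

lemma revol_inner: "revol f g h p \<bullet> revol f' g' h' p = f (p $ 1) * f' (p $ 1) + g (p $ 1) * g' (p $ 1) + h (p $ 1) * h' (p $ 1)"
proof -
  have "h (p $ 1) * cos (p $ 2) * (h' (p $ 1) * cos (p $ 2)) + h (p $ 1) * sin (p $ 2) * (h' (p $ 1) * sin (p $ 2))
     = h (p $ 1) * h' (p $ 1)"
    using sin_cos_squared_add[of "p $ 2"] by algebra
  then show ?thesis unfolding inner_4 revol_nth by simp
qed

lemma smooth_coordinate: "smooth S (\<lambda>p::real^2. p $ i)"
  by (rule smooth_bounded_linear[OF bounded_linear_vec_nth])

lemma smooth_separable:
  fixes f g :: "real \<Rightarrow> real"
  assumes "smooth UNIV f" "smooth UNIV g"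
  shows "smooth S (\<lambda>p::real^2. f (p $ 1) * g (p $ 2))"
  by (rule smooth_mult[OF smooth_compose[OF assms(1) _ smooth_coordinate] smooth_compose[OF assms(2) _ smooth_coordinate]]) auto

lemma smooth_revol:
  assumes "smooth UNIV f" "smooth UNIV g" "smooth UNIV h"
  shows "smooth S (revol f g h)"
proof -
  have "smooth S (\<lambda>p. f (p $ 1) *\<^sub>R (axis 1 1 :: real^4) + g (p $ 1) *\<^sub>R axis 2 1
      + (h (p $ 1) * cos (p $ 2)) *\<^sub>R axis 3 1 + (h (p $ 1) * sin (p $ 2)) *\<^sub>R axis 4 1)"
    by (rule smooth_add smooth_linear_compose[OF bounded_linear_scaleR_left]
        smooth_compose[OF assms(1) _ smooth_coordinate] smooth_compose[OF assms(2) _ smooth_coordinate]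
        smooth_separable assms(3) smooth_sin smooth_cos subset_UNIV)+
  then show ?thesis by (simp add: revol_def[abs_def] vector_4_eq)
qed

lemma periodic_revol: "periodic (revol f g h)"
  by (simp add: periodic_def revol_def axis_def)

lemma has_derivative_vec_nth: "((\<lambda>p. p $ i) has_derivative (\<lambda>v. v $ i)) F"
  by (rule bounded_linear_imp_has_derivative[OF bounded_linear_vec_nth])

lemma has_derivative_revol:
  assumes "(f has_real_derivative f' (p $ 1)) (at (p $ 1))" "(g has_real_derivative g' (p $ 1)) (at (p $ 1))"
    "(h has_real_derivative h' (p $ 1)) (at (p $ 1))"
  shows "(revol f g h has_derivative (\<lambda>v. v $ 1 *\<^sub>R revol f' g' h' p
      + v $ 2 *\<^sub>R vector [0, 0, - h (p $ 1) * sin (p $ 2), h (p $ 1) * cos (p $ 2)])) (at p within S)"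
proof -
  have fgh: "((\<lambda>p. f (p $ 1)) has_derivative (\<lambda>v. v $ 1 * f' (p $ 1))) (at p within S)"
    "((\<lambda>p. g (p $ 1)) has_derivative (\<lambda>v. v $ 1 * g' (p $ 1))) (at p within S)"
    "((\<lambda>p. h (p $ 1)) has_derivative (\<lambda>v. v $ 1 * h' (p $ 1))) (at p within S)"
    "((\<lambda>p. cos (p $ 2)) has_derivative (\<lambda>v. v $ 2 * (- sin (p $ 2)))) (at p within S)"
    "((\<lambda>p. sin (p $ 2)) has_derivative (\<lambda>v. v $ 2 * cos (p $ 2))) (at p within S)"
    by (rule DERIV_compose_FDERIV[OF _ has_derivative_vec_nth], rule assms DERIV_cos DERIV_sin)+
  show ?thesis unfolding revol_def[abs_def] vector_4_eq
    by (rule derivative_eq_intros fgh refl)+ (simp add: fun_eq_iff algebra_simps)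
qed

text \<open>Every point of the strip can be approached within the strip in each coordinate direction, which makes
  derivatives within the strip unique up to its boundary.\<close>

lemma strip_approach:
  assumes "p \<in> strip" "0 < e"
  shows "\<exists>d. 0 < \<bar>d\<bar> \<and> \<bar>d\<bar> < e \<and> p + d *\<^sub>R axis i 1 \<in> strip"
proof -
  define m where "m = min (e / 2) 1"
  have m: "0 < m" "m < e" "m \<le> 1" using assms(2) by (auto simp: m_def)
  show ?thesis
  proof (cases "p $ 1 \<ge> 0")
    case True
    then show ?thesis using m assms by (intro exI[of _ "- m"]) (auto simp: strip_def axis_def)
  next
    case False
    then show ?thesis using m assms by (intro exI[of _ m]) (auto simp: strip_def axis_def)
  qed
qed

lemma pushfwd_eq:
  assumes "p \<in> strip" "(f has_derivative D) (at p within strip)"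
  shows "pushfwd f p = D"
proof -
  have "(f has_derivative frechet_derivative f (at p within strip)) (at p within strip)"
    using assms(2) frechet_derivative_works differentiable_def by blast
  then show ?thesis unfolding pushfwd_def
    by (rule frechet_derivative_unique_within[OF _ assms(2)])
       (use strip_approach[OF assms(1)] in \<open>auto simp: Basis_vec_def\<close>)
qed

lemma pushfwd_cong:
  assumes "p \<in> strip" "\<And>q. q \<in> strip \<Longrightarrow> f q = g q"
  shows "pushfwd f p = pushfwd g p"
proof -
  have "(f has_derivative D) (at p within strip) = (g has_derivative D) (at p within strip)" for D
    using has_derivative_transform[OF assms(1), of f g D] has_derivative_transform[OF assms(1), of g f D] assms(2)
    by metis
  then show ?thesis by (simp add: pushfwd_def frechet_derivative_def)
qed

lemma pd_cong: "p \<in> strip \<Longrightarrow> (\<And>q. q \<in> strip \<Longrightarrow> f q = g q) \<Longrightarrow> pd i f p = pd i g p"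
  using pushfwd_cong unfolding pd_def by metis

lemma pushfwd_separable:
  assumes "p \<in> strip" "(U has_real_derivative U') (at (p $ 1) within {-1..1})" "(V has_real_derivative V') (at (p $ 2))"
  shows "pushfwd (\<lambda>p. U (p $ 1) * V (p $ 2)) p = (\<lambda>v. v $ 1 * (U' * V (p $ 2)) + v $ 2 * (U (p $ 1) * V'))"
proof (rule pushfwd_eq[OF assms(1)])
  have "(U has_derivative (*) U') (at (p $ 1) within (\<lambda>p. p $ 1) ` strip)"
    by (rule has_derivative_subset[OF assms(2)[unfolded has_field_derivative_def]])
       (auto simp: strip_def abs_le_iff)
  from has_derivative_in_compose[OF has_derivative_vec_nth this]
  have "((\<lambda>p. U (p $ 1)) has_derivative (\<lambda>v. U' * v $ 1)) (at p within strip)" .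
  moreover have "((\<lambda>p. V (p $ 2)) has_derivative (\<lambda>v. v $ 2 * V')) (at p within strip)"
    by (rule DERIV_compose_FDERIV[OF assms(3) has_derivative_vec_nth])
  ultimately show "((\<lambda>p. U (p $ 1) * V (p $ 2)) has_derivative
      (\<lambda>v. v $ 1 * (U' * V (p $ 2)) + v $ 2 * (U (p $ 1) * V'))) (at p within strip)"
    by (rule has_derivative_eq_rhs[OF has_derivative_mult]) (simp add: fun_eq_iff algebra_simps)
qed

lemma pd_separable:
  assumes "p \<in> strip" "(U has_real_derivative U') (at (p $ 1) within {-1..1})" "(V has_real_derivative V') (at (p $ 2))"
  shows "pd 1 (\<lambda>p. U (p $ 1) * V (p $ 2)) p = U' * V (p $ 2)" "pd 2 (\<lambda>p. U (p $ 1) * V (p $ 2)) p = U (p $ 1) * V'"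
  unfolding pd_def pushfwd_separable[OF assms] by (simp_all add: axis_def)

definition diag2 :: "real \<Rightarrow> real \<Rightarrow> real^2^2" where
  "diag2 u v = (\<chi> i j. if i = j then if i = 1 then u else v else 0)"

lemma diag2_nth [simp]: "diag2 u v $ 1 $ 1 = u" "diag2 u v $ 1 $ 2 = 0" "diag2 u v $ 2 $ 1 = 0" "diag2 u v $ 2 $ 2 = v"
  by (simp_all add: diag2_def)

lemma matrix_inv_diag2:
  assumes "u \<noteq> 0" "v \<noteq> 0"
  shows "matrix_inv (diag2 u v) = diag2 (1 / u) (1 / v)"
proof -
  have 1: "diag2 u v ** diag2 (1 / u) (1 / v) = mat 1" "diag2 (1 / u) (1 / v) ** diag2 u v = mat 1"
    using assms by (simp_all add: vec_eq_iff forall_2 matrix_matrix_mult_def sum_2 mat_def)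
  have "B = diag2 (1 / u) (1 / v)" if "B ** diag2 u v = mat 1" for B
  proof -
    have "B = B ** (diag2 u v ** diag2 (1 / u) (1 / v))" unfolding 1 by (simp add: matrix_mul_rid)
    also have "\<dots> = diag2 (1 / u) (1 / v)" unfolding matrix_mul_assoc that by (simp add: matrix_mul_lid)
    finally show ?thesis .
  qed
  note unique = this
  show ?thesis unfolding matrix_inv_def
  proof (rule some_equality)
    show "diag2 u v ** diag2 (1 / u) (1 / v) = mat 1 \<and> diag2 (1 / u) (1 / v) ** diag2 u v = mat 1"
      using 1 by blast
  qed (rule unique, blast)
qed

section \<open>Metric, frame and Laplacian of the annuli\<close>

context annulus_parameter
begin

lemma Psi_revol: "Psi a = revol (\<lambda>\<tau>. xx a (\<sigma> * \<tau>)) (\<lambda>\<tau>. yy a (\<sigma> * \<tau>)) (\<lambda>\<tau>. z (\<sigma> * \<tau>))"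
  by (simp add: fun_eq_iff Psi_def X_imm_def revol_def)

definition NN :: "real^2 \<Rightarrow> real^4" where
  "NN = revol (\<lambda>\<tau>. n1 a (\<sigma> * \<tau>)) (\<lambda>\<tau>. n2 a (\<sigma> * \<tau>)) (\<lambda>\<tau>. n3 a (\<sigma> * \<tau>))"

definition TT :: "real^2 \<Rightarrow> real^4" where
  "TT = revol (\<lambda>\<tau>. t1 a (\<sigma> * \<tau>)) (\<lambda>\<tau>. t2 a (\<sigma> * \<tau>)) (\<lambda>\<tau>. t3 a (\<sigma> * \<tau>))"

definition EE :: "real^2 \<Rightarrow> real^4" where
  "EE p = vector [0, 0, - sin (p $ 2), cos (p $ 2)]"

lemma rescaled_deriv:
  assumes "\<And>s. (f has_real_derivative f' s) (at s)"
  shows "((\<lambda>\<tau>. f (\<sigma> * \<tau>)) has_real_derivative \<sigma> * f' (\<sigma> * \<tau>)) (at \<tau> within X)"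
  by (rule has_field_derivative_at_within, rule DERIV_cong[OF DERIV_chain2[OF assms]])
     (auto intro!: derivative_eq_intros)

lemma revol_scale: "revol (\<lambda>\<tau>. k * f \<tau>) (\<lambda>\<tau>. k * g \<tau>) (\<lambda>\<tau>. k * h \<tau>) p = k *\<^sub>R revol f g h p"
  by (simp add: vec_eq_iff forall_4 revol_def)

lemma pushfwd_Psi: "p \<in> strip \<Longrightarrow> pushfwd (Psi a) p = (\<lambda>v. (\<sigma> * v $ 1) *\<^sub>R TT p + (z (\<sigma> * p $ 1) * v $ 2) *\<^sub>R EE p)"
proof (rule pushfwd_eq)
  have "(Psi a has_derivative (\<lambda>v. v $ 1 *\<^sub>R revol (\<lambda>\<tau>. \<sigma> * t1 a (\<sigma> * \<tau>)) (\<lambda>\<tau>. \<sigma> * t2 a (\<sigma> * \<tau>)) (\<lambda>\<tau>. \<sigma> * t3 a (\<sigma> * \<tau>)) p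
      + v $ 2 *\<^sub>R vector [0, 0, - z (\<sigma> * p $ 1) * sin (p $ 2), z (\<sigma> * p $ 1) * cos (p $ 2)])) (at p within strip)"
    unfolding Psi_revol by (intro has_derivative_revol rescaled_deriv x_deriv y_deriv z_deriv')
  also have "(\<lambda>v. v $ 1 *\<^sub>R revol (\<lambda>\<tau>. \<sigma> * t1 a (\<sigma> * \<tau>)) (\<lambda>\<tau>. \<sigma> * t2 a (\<sigma> * \<tau>)) (\<lambda>\<tau>. \<sigma> * t3 a (\<sigma> * \<tau>)) p
      + v $ 2 *\<^sub>R vector [0, 0, - z (\<sigma> * p $ 1) * sin (p $ 2), z (\<sigma> * p $ 1) * cos (p $ 2)])
     = (\<lambda>v. (\<sigma> * v $ 1) *\<^sub>R TT p + (z (\<sigma> * p $ 1) * v $ 2) *\<^sub>R EE p)"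
    by (simp add: fun_eq_iff revol_scale TT_def EE_def vec_eq_iff forall_4)
  finally show "(Psi a has_derivative (\<lambda>v. (\<sigma> * v $ 1) *\<^sub>R TT p + (z (\<sigma> * p $ 1) * v $ 2) *\<^sub>R EE p)) (at p within strip)" .
qed

lemma pd_Psi:
  assumes "p \<in> strip"
  shows "pd 1 (Psi a) p = \<sigma> *\<^sub>R TT p" "pd 2 (Psi a) p = z (\<sigma> * p $ 1) *\<^sub>R EE p"
  using assms by (simp_all add: pd_def pushfwd_Psi axis_def)

text \<open>The coefficients \<open>- c/z\<^sup>2\<close> and \<open>c/z\<^sup>2\<close> relative to \<open>pd_Psi\<close> are the two principal curvatures.\<close>

lemma pd_NN:
  assumes "p \<in> strip"
  shows "pd 1 NN p = (- \<sigma> * (c / (z (\<sigma> * p $ 1))\<^sup>2)) *\<^sub>R TT p" "pd 2 NN p = (c / z (\<sigma> * p $ 1)) *\<^sub>R EE p"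
proof -
  let ?f = "\<lambda>k \<tau>. \<sigma> * (- (c / (z (\<sigma> * \<tau>))\<^sup>2) * k a (\<sigma> * \<tau>))"
  have "(NN has_derivative (\<lambda>v. v $ 1 *\<^sub>R revol (?f t1) (?f t2) (?f t3) p
      + v $ 2 *\<^sub>R vector [0, 0, - n3 a (\<sigma> * p $ 1) * sin (p $ 2), n3 a (\<sigma> * p $ 1) * cos (p $ 2)])) (at p within strip)"
    unfolding NN_def by (intro has_derivative_revol rescaled_deriv n1_deriv n2_deriv n3_deriv)
  note * = pushfwd_eq[OF assms this]
  show "pd 1 NN p = (- \<sigma> * (c / (z (\<sigma> * p $ 1))\<^sup>2)) *\<^sub>R TT p" "pd 2 NN p = (c / z (\<sigma> * p $ 1)) *\<^sub>R EE p"
    unfolding pd_def * by (simp_all add: axis_def vec_eq_iff forall_4 TT_def EE_def revol_def n3_def)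
qed

lemma frame:
  "Psi a p \<bullet> Psi a p = 1" "TT p \<bullet> TT p = 1" "EE p \<bullet> EE p = 1" "NN p \<bullet> NN p = 1"
  "Psi a p \<bullet> TT p = 0" "Psi a p \<bullet> EE p = 0" "NN p \<bullet> Psi a p = 0" "NN p \<bullet> TT p = 0" "NN p \<bullet> EE p = 0" "TT p \<bullet> EE p = 0"
proof -
  define s where "s = \<sigma> * p $ 1"
  note o = orthonormal[of s]
  show "Psi a p \<bullet> Psi a p = 1" "TT p \<bullet> TT p = 1" "NN p \<bullet> NN p = 1" "Psi a p \<bullet> TT p = 0"
    "NN p \<bullet> Psi a p = 0" "NN p \<bullet> TT p = 0"
    unfolding Psi_revol TT_def NN_def revol_inner s_def[symmetric] using o
    by (simp_all add: power2_eq_square)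
  have E: "revol f g h p \<bullet> EE p = 0" for f g h
    by (simp add: EE_def inner_4)
  show "Psi a p \<bullet> EE p = 0" "NN p \<bullet> EE p = 0" "TT p \<bullet> EE p = 0"
    unfolding Psi_revol TT_def NN_def by (rule E)+
  show "EE p \<bullet> EE p = 1" by (simp add: EE_def inner_4 flip: power2_eq_square)
qed

lemma metric_Psi: "p \<in> strip \<Longrightarrow> metric (Psi a) p = diag2 (\<sigma>\<^sup>2) ((z (\<sigma> * p $ 1))\<^sup>2)"
  unfolding metric_def vec_eq_iff forall_2
  by (simp add: pd_Psi frame power2_eq_square inner_commute[of "EE p" "TT p"])

lemma metric_inv_Psi: "p \<in> strip \<Longrightarrow> metric_inv (Psi a) p = diag2 (1 / \<sigma>\<^sup>2) (1 / (z (\<sigma> * p $ 1))\<^sup>2)"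
  unfolding metric_inv_def using s1_pos by (simp add: metric_Psi matrix_inv_diag2)

lemma sqrt_det_metric_Psi: "p \<in> strip \<Longrightarrow> sqrt (det (metric (Psi a) p)) = \<sigma> * z (\<sigma> * p $ 1)"
  using s1_pos zz_pos[of "\<sigma> * p $ 1"] by (simp add: metric_Psi det_2 real_sqrt_mult)

lemma conormal_Psi: "p \<in> strip \<Longrightarrow> conormal (Psi a) p = (sgn (p $ 1) / \<sigma>) *\<^sub>R axis 1 1"
proof -
  assume p: "p \<in> strip"
  have "sqrt (1 / \<sigma>\<^sup>2) = 1 / \<sigma>" using s1_pos by (simp add: real_sqrt_divide)
  moreover have "k * (1 / \<sigma>\<^sup>2) / (1 / \<sigma>) = k / \<sigma>" for k
    using s1_pos by (simp add: power2_eq_square)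
  ultimately show ?thesis
    unfolding conormal_def metric_inv_Psi[OF p] vec_eq_iff forall_2 by (simp add: axis_def)
qed

text \<open>Derivatives of \<open>U\<close> are taken within \<open>[-1, 1]\<close>, because the lemma is also applied to arbitrary elements of
  the kernel, which are smooth on the strip alone.\<close>

lemma laplacian_separable:
  assumes p: "p \<in> strip" and u: "\<And>q. q \<in> strip \<Longrightarrow> u q = U (q $ 1) * V (q $ 2)"
    and U: "\<And>t. t \<in> {-1..1} \<Longrightarrow> (U has_real_derivative U1 t) (at t within {-1..1})"
    and U1: "\<And>t. t \<in> {-1..1} \<Longrightarrow> (U1 has_real_derivative U2 t) (at t within {-1..1})"
    and V: "\<And>t. (V has_real_derivative V1 t) (at t)" and V1: "\<And>t. (V1 has_real_derivative V2 t) (at t)"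
  shows "laplacian (Psi a) u p =
    (U2 (p $ 1) / \<sigma>\<^sup>2 + t3 a (\<sigma> * p $ 1) / z (\<sigma> * p $ 1) * (U1 (p $ 1) / \<sigma>)) * V (p $ 2)
      + U (p $ 1) * V2 (p $ 2) / (z (\<sigma> * p $ 1))\<^sup>2"
proof -
  have s: "q $ 1 \<in> {-1..1}" if "q \<in> strip" for q using that by (auto simp: strip_def abs_le_iff)
  have pu: "pd 1 u q = U1 (q $ 1) * V (q $ 2)" "pd 2 u q = U (q $ 1) * V1 (q $ 2)" if q: "q \<in> strip" for q
    using pd_cong[OF q u] pd_separable[OF q U[OF s[OF q]] V] by simp_all
  let ?G = "\<lambda>i q. sqrt (det (metric (Psi a) q)) * (\<Sum>j\<in>UNIV. metric_inv (Psi a) q $ i $ j * pd j u q)"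
  have 1: "pd 1 (?G 1) p = (t3 a (\<sigma> * p $ 1) * U1 (p $ 1) + z (\<sigma> * p $ 1) * U2 (p $ 1) / \<sigma>) * V (p $ 2)"
  proof -
    have "?G 1 q = (z (\<sigma> * q $ 1) * U1 (q $ 1) / \<sigma>) * V (q $ 2)" if "q \<in> strip" for q
      using that s1_pos by (simp add: sqrt_det_metric_Psi metric_inv_Psi sum_2 pu field_simps power2_eq_square)
    then have "pd 1 (?G 1) p = pd 1 (\<lambda>q. (z (\<sigma> * q $ 1) * U1 (q $ 1) / \<sigma>) * V (q $ 2)) p"
      by (rule pd_cong[OF p])
    also have "\<dots> = (t3 a (\<sigma> * p $ 1) * U1 (p $ 1) + z (\<sigma> * p $ 1) * U2 (p $ 1) / \<sigma>) * V (p $ 2)"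
    proof (rule pd_separable(1)[OF p _ V])
      have "((\<lambda>t. z (\<sigma> * t) * U1 t / \<sigma>) has_real_derivative
          (\<sigma> * t3 a (\<sigma> * p $ 1) * U1 (p $ 1) + U2 (p $ 1) * z (\<sigma> * p $ 1)) / \<sigma>) (at (p $ 1) within {-1..1})"
        by (intro DERIV_cdivide DERIV_mult rescaled_deriv z_deriv' U1 s p)
      then show "((\<lambda>t. z (\<sigma> * t) * U1 t / \<sigma>) has_real_derivative
          t3 a (\<sigma> * p $ 1) * U1 (p $ 1) + z (\<sigma> * p $ 1) * U2 (p $ 1) / \<sigma>) (at (p $ 1) within {-1..1})"
        using s1_pos by (simp add: field_simps)
    qed
    finally show ?thesis .
  qed
  have 2: "pd 2 (?G 2) p = \<sigma> / z (\<sigma> * p $ 1) * U (p $ 1) * V2 (p $ 2)"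
  proof -
    have "?G 2 q = (\<sigma> / z (\<sigma> * q $ 1) * U (q $ 1)) * V1 (q $ 2)" if "q \<in> strip" for q
      using that by (simp add: sqrt_det_metric_Psi metric_inv_Psi sum_2 pu field_simps power2_eq_square)
    then have "pd 2 (?G 2) p = pd 2 (\<lambda>q. (\<sigma> / z (\<sigma> * q $ 1) * U (q $ 1)) * V1 (q $ 2)) p"
      by (rule pd_cong[OF p])
    also have "\<dots> = \<sigma> / z (\<sigma> * p $ 1) * U (p $ 1) * V2 (p $ 2)"
    proof (rule pd_separable(2)[OF p _ V1])
      show "((\<lambda>t. \<sigma> / z (\<sigma> * t) * U t) has_real_derivative
          (0 * z (\<sigma> * p $ 1) - \<sigma> * (\<sigma> * t3 a (\<sigma> * p $ 1))) / (z (\<sigma> * p $ 1) * z (\<sigma> * p $ 1)) * U (p $ 1)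
            + U1 (p $ 1) * (\<sigma> / z (\<sigma> * p $ 1))) (at (p $ 1) within {-1..1})"
        by (intro DERIV_mult DERIV_divide DERIV_const rescaled_deriv z_deriv' U s p) simp
    qed
    finally show ?thesis .
  qed
  show ?thesis unfolding laplacian_def sum_2[where f = "\<lambda>i. pd i (?G i) p"] 1 2 sqrt_det_metric_Psi[OF p]
    using s1_pos by (simp add: field_simps power2_eq_square)
qed

end

section \<open>Smoothness and embeddedness\<close>

lemma smooth_ident: "smooth S (\<lambda>x. x)"
  by (rule smooth_bounded_linear[OF bounded_linear_ident])

lemma smooth_rescaled:
  fixes f :: "real \<Rightarrow> real"
  shows "smooth UNIV f \<Longrightarrow> smooth UNIV (\<lambda>\<tau>. f (k * \<tau>))"
  by (rule smooth_compose[OF _ _ smooth_mult[OF smooth_const smooth_ident]]) auto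

context annulus_parameter
begin

lemma smooth_C: "smooth UNIV C" and smooth_S: "smooth UNIV S"
  unfolding SS_def[abs_def] CC_def[abs_def]
  by (intro smooth_mult smooth_const smooth_rescaled smooth_sin smooth_cos)+

lemma smooth_cos2: "smooth UNIV (\<lambda>s::real. cos (2 * s))"
  by (rule smooth_rescaled[OF smooth_cos])

lemma smooth_z: "smooth UNIV z"
proof -
  have "smooth UNIV (\<lambda>s. sqrt (1/2 + C s))"
    by (rule smooth_compose[OF smooth_sqrt _ smooth_add[OF smooth_const smooth_C]])
       (use zz_arg_pos in \<open>auto simp: CC_def\<close>)
  then show ?thesis by (simp add: zz_def[abs_def] CC_def)
qed

lemma smooth_L: "smooth UNIV L"
proof -
  have "smooth UNIV (\<lambda>s. sqrt (1/2 - C s))"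
    by (rule smooth_compose[OF smooth_sqrt _ smooth_diff[OF smooth_const smooth_C]])
       (use lam_pos in \<open>auto simp: CC_def lam_def\<close>)
  then show ?thesis by (simp add: LL_def[abs_def] lam_def CC_def)
qed

lemma smooth_B: "smooth UNIV B"
  by (rule smooth_antiderivative[OF B_deriv])
     (intro smooth_divide smooth_const smooth_mult smooth_z smooth_power smooth_L,
      use zz_pos L_pos in \<open>auto intro: mult_pos_pos\<close>)

lemma smooth_sin_B: "smooth UNIV (\<lambda>s. sin (B s))" and smooth_cos_B: "smooth UNIV (\<lambda>s. cos (B s))"
  by (rule smooth_compose[OF smooth_sin _ smooth_B] smooth_compose[OF smooth_cos _ smooth_B]; simp)+

lemma smooth_beta_a: "smooth UNIV (beta_a a)"
  by (rule smooth_antiderivative[OF beta_a_deriv[unfolded omega_a_eq]],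
      intro smooth_divide smooth_const smooth_mult smooth_z smooth_power smooth_L smooth_add smooth_diff smooth_cos2)
     (use zz_pos L_pos cc_pos in \<open>auto intro: mult_pos_pos\<close>)

lemma smooth_profile:
  "smooth UNIV (xx a)" "smooth UNIV (yy a)"
  "smooth UNIV (t1 a)" "smooth UNIV (t3 a)"
  "smooth UNIV (n1 a)" "smooth UNIV (n2 a)" "smooth UNIV (n3 a)"
  "smooth UNIV (ww a)"
  unfolding xx_eq[abs_def] yy_eq[abs_def] t1_def[abs_def] t3_def[abs_def]
    n1_def[abs_def] n2_def[abs_def] n3_def[abs_def] ww_def[abs_def]
  by (intro smooth_divide smooth_const smooth_mult smooth_z smooth_power smooth_L smooth_add smooth_diff smooth_minus
      smooth_cos2 smooth_sin_B smooth_cos_B smooth_S smooth_beta_a,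
      use zz_pos L_pos cc_pos in \<open>auto intro: mult_pos_pos\<close>)+

lemma strip_param: "p \<in> strip \<Longrightarrow> \<bar>\<sigma> * p $ 1\<bar> \<le> \<sigma>"
  using s1_pos by (simp add: strip_def abs_mult mult_left_le)

lemma immersed: "immersed_annulus (Psi a)"
  unfolding immersed_annulus_def
proof (intro conjI ballI)
  show "smooth strip (Psi a)" unfolding Psi_revol
    by (intro smooth_revol smooth_rescaled smooth_profile smooth_z)
  show "periodic (Psi a)" unfolding Psi_revol by (rule periodic_revol)
  show "Psi a ` strip \<subseteq> S3" using frame(1) by (auto simp: norm_eq_1)
  fix p assume p: "p \<in> strip"
  show "inj (pushfwd (Psi a) p)"
    unfolding pushfwd_Psi[OF p]
  proof (rule injI)
    fix v w :: "real^2"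
    assume eq: "(\<sigma> * v $ 1) *\<^sub>R TT p + (z (\<sigma> * p $ 1) * v $ 2) *\<^sub>R EE p
      = (\<sigma> * w $ 1) *\<^sub>R TT p + (z (\<sigma> * p $ 1) * w $ 2) *\<^sub>R EE p"
    have "\<sigma> * v $ 1 = \<sigma> * w $ 1"
      using arg_cong[OF eq, of "\<lambda>u. TT p \<bullet> u"] by (simp add: inner_add_right frame)
    moreover have "z (\<sigma> * p $ 1) * v $ 2 = z (\<sigma> * p $ 1) * w $ 2"
      using arg_cong[OF eq, of "\<lambda>u. u \<bullet> EE p"] by (simp add: inner_add_left frame)
    ultimately show "v = w" using s1_pos by (simp add: vec_eq_iff forall_2)
  qed
qed

lemma B_abs_less:
  assumes "\<bar>s\<bar> \<le> \<sigma>"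
  shows "\<bar>B s\<bar> < pi"
proof -
  have "\<bar>B s\<bar> = B \<bar>s\<bar>"
    using B_bounds(1)[of "\<bar>s\<bar>"] assms s1_less by (cases "s = 0"; cases "s > 0") (auto simp: beta_minus)
  also have "\<dots> < pi" using B_bounds(2)[of "\<bar>s\<bar>"] assms s1_less by (cases "s = 0") auto
  finally show ?thesis .
qed

lemma B_inj: "B s = B t \<Longrightarrow> s = t"
  using B_strict_mono[of s t] B_strict_mono[of t s] by (cases s t rule: linorder_cases) auto

lemma polar_34: "(z s * cos \<theta>)\<^sup>2 + (z s * sin \<theta>)\<^sup>2 = (z s)\<^sup>2"
  by (simp add: power_mult_distrib flip: distrib_left)

text \<open>The last two coordinates give \<open>z\<close> and \<open>\<theta>\<close>, hence \<open>L\<close>; then the first two give \<open>\<beta>\<close> modulo \<open>2\<pi>\<close>, and \<open>|\<beta>| < \<pi>\<close> on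
  the annulus.\<close>

lemma X_imm_injective:
  assumes "\<bar>s\<bar> \<le> \<sigma>" "\<bar>t\<bar> \<le> \<sigma>" "X_imm a (vector [s, \<theta>]) = X_imm a (vector [t, \<phi>])"
  shows "s = t" "cos \<theta> = cos \<phi>" "sin \<theta> = sin \<phi>"
proof -
  have e: "xx a s = xx a t" "yy a s = yy a t" "z s * cos \<theta> = z t * cos \<phi>" "z s * sin \<theta> = z t * sin \<phi>"
    using assms(3) by (simp_all add: X_imm_def vec_eq_iff forall_4)
  have "(z s)\<^sup>2 = (z t)\<^sup>2" using polar_34[of s \<theta>] polar_34[of t \<phi>] e by simp
  then have zz: "z s = z t" using zz_pos[of s] zz_pos[of t] by (simp add: power2_eq_iff_nonneg)
  then show "cos \<theta> = cos \<phi>" "sin \<theta> = sin \<phi>" using e zz_pos[of t] by auto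
  have "(L s)\<^sup>2 = (L t)\<^sup>2" using Lz[of s] Lz[of t] zz by simp
  then have "L s = L t" using L_pos[of s] L_pos[of t] by (simp add: power2_eq_iff_nonneg)
  then have "cos (B s) = cos (B t)" "sin (B s) = sin (B t)"
    using e L_pos[of t] by (auto simp: xx_eq yy_eq)
  then obtain n :: int where n: "B s = B t + 2 * pi * n" using sin_cos_eq_iff by blast
  have "\<bar>2 * pi * n\<bar> < 2 * pi" using n B_abs_less[OF assms(1)] B_abs_less[OF assms(2)] by linarith
  then have "n = 0" by (simp add: abs_mult)
  then show "s = t" using n B_inj by simp
qed

lemma embedded: "embedded_annulus (Psi a)"
  unfolding embedded_annulus_def
proof (intro conjI ballI impI immersed)
  fix p q :: "real^2" assume pq: "p \<in> strip" "q \<in> strip" "Psi a p = Psi a q"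
  note inj = X_imm_injective[OF strip_param[OF pq(1)] strip_param[OF pq(2)] pq(3)[unfolded Psi_def]]
  show "p $ 1 = q $ 1" using inj(1) s1_pos by simp
  obtain n :: int where "p $ 2 = q $ 2 + 2 * pi * n" using inj(2,3) sin_cos_eq_iff by blast
  then show "\<exists>k::int. p $ 2 - q $ 2 = 2 * pi * of_int k" by (intro exI[of _ n]) simp
qed

section \<open>The unit normal, minimality and the free boundary\<close>

lemma unit_normal_NN: "unit_normal (Psi a) NN"
  unfolding unit_normal_def
proof (intro conjI ballI allI)
  show "smooth strip NN" unfolding NN_def by (intro smooth_revol smooth_rescaled smooth_profile)
  show "periodic NN" unfolding NN_def by (rule periodic_revol)
  fix p assume p: "p \<in> strip"
  show "norm (NN p) = 1" by (simp add: norm_eq_1 frame)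
  show "NN p \<bullet> Psi a p = 0" by (rule frame)
  show "NN p \<bullet> pd i (Psi a) p = 0" for i
    using exhaust_2[of i] by (auto simp: pd_Psi[OF p] frame)
qed

text \<open>The rows \<open>\<gamma>\<close>, \<open>\<gamma>'\<close>, \<open>n\<close> form an orthogonal matrix, so its columns are orthonormal too.\<close>

lemma orthonormal_columns:
  "(xx a s)\<^sup>2 + (t1 a s)\<^sup>2 + (n1 a s)\<^sup>2 = 1"
  "(yy a s)\<^sup>2 + (t2 a s)\<^sup>2 + (n2 a s)\<^sup>2 = 1"
  "(z s)\<^sup>2 + (t3 a s)\<^sup>2 + (n3 a s)\<^sup>2 = 1"
  "xx a s * yy a s + t1 a s * t2 a s + n1 a s * n2 a s = 0"
  "xx a s * z s + t1 a s * t3 a s + n1 a s * n3 a s = 0"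
  "yy a s * z s + t2 a s * t3 a s + n2 a s * n3 a s = 0"
proof -
  define u v where "u = sin (B s)" and "v = cos (B s)"
  have uv: "u\<^sup>2 + v\<^sup>2 = 1" by (simp add: u_def v_def)
  note d = xx_eq yy_eq t1_def t2_def t3_def n1_def n2_def n3_def u_def[symmetric] v_def[symmetric]
  note eqs = uv Lz[of s] SLz[of s] inverses[of s]
  show "(xx a s)\<^sup>2 + (t1 a s)\<^sup>2 + (n1 a s)\<^sup>2 = 1" "(yy a s)\<^sup>2 + (t2 a s)\<^sup>2 + (n2 a s)\<^sup>2 = 1"
    "(z s)\<^sup>2 + (t3 a s)\<^sup>2 + (n3 a s)\<^sup>2 = 1"
    "xx a s * yy a s + t1 a s * t2 a s + n1 a s * n2 a s = 0"
    "xx a s * z s + t1 a s * t3 a s + n1 a s * n3 a s = 0"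
    "yy a s * z s + t2 a s * t3 a s + n2 a s * n3 a s = 0"
    unfolding d by ((simp only: rational)?, use eqs in algebra)+
qed

lemma normal_pointwise:
  assumes "v \<bullet> Psi a p = 0" "v \<bullet> TT p = 0" "v \<bullet> EE p = 0"
  shows "v = (v \<bullet> NN p) *\<^sub>R NN p"
proof -
  define s where "s = \<sigma> * p $ 1"
  define C' where "C' = cos (p $ 2)"
  define S' where "S' = sin (p $ 2)"
  define r where "r = v $ 3 * C' + v $ 4 * S'"
  define m where "m = v $ 1 * n1 a s + v $ 2 * n2 a s + r * n3 a s"
  have cs: "C'\<^sup>2 + S'\<^sup>2 = 1" by (simp add: C'_def S'_def)
  have e: "v $ 4 * C' = v $ 3 * S'" using assms(3) by (simp add: inner_4 EE_def C'_def S'_def)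
  have v34: "v $ 3 = r * C'" "v $ 4 = r * S'" unfolding r_def using e cs by algebra+
  have 1: "v $ 1 * xx a s + v $ 2 * yy a s + r * z s = 0"
    using assms(1) by (simp add: inner_4 Psi_revol s_def r_def C'_def S'_def algebra_simps)
  have 2: "v $ 1 * t1 a s + v $ 2 * t2 a s + r * t3 a s = 0"
    using assms(2) by (simp add: inner_4 TT_def s_def r_def C'_def S'_def algebra_simps)
  have m: "v \<bullet> NN p = m"
    by (simp add: inner_4 NN_def m_def s_def r_def C'_def S'_def algebra_simps)
  note o = orthonormal_columns[of s]
  have "v $ 1 = m * n1 a s" "v $ 2 = m * n2 a s" "r = m * n3 a s"
    unfolding m_def using 1 2 o by algebra+
  then show ?thesis unfolding m
    using v34 by (simp add: vec_eq_iff forall_4 NN_def s_def[symmetric] C'_def[symmetric] S'_def[symmetric])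
qed

text \<open>The coefficient of a unit normal with respect to \<open>NN\<close> is a continuous function on the connected strip with
  values \<open>\<plusminus> 1\<close>.\<close>

lemma unit_normal_unique:
  assumes "unit_normal (Psi a) \<nu>"
  obtains \<epsilon> :: real where "\<epsilon> = 1 \<or> \<epsilon> = - 1" "\<And>p. p \<in> strip \<Longrightarrow> \<nu> p = \<epsilon> *\<^sub>R NN p"
proof -
  have nu: "\<nu> p = (\<nu> p \<bullet> NN p) *\<^sub>R NN p" "norm (\<nu> p) = 1" if p: "p \<in> strip" for p
  proof -
    have h: "norm (\<nu> p) = 1" "\<nu> p \<bullet> Psi a p = 0" "\<And>i. \<nu> p \<bullet> pd i (Psi a) p = 0"
      using assms p by (auto simp: unit_normal_def)
    have "\<nu> p \<bullet> TT p = 0" "\<nu> p \<bullet> EE p = 0"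
      using h(3)[of 1] h(3)[of 2] s1_pos by (simp_all add: pd_Psi[OF p])
    then show "\<nu> p = (\<nu> p \<bullet> NN p) *\<^sub>R NN p" by (rule normal_pointwise[OF h(2)])
    show "norm (\<nu> p) = 1" by (rule h)
  qed
  have pm: "\<nu> p \<bullet> NN p \<in> {1, - 1}" if p: "p \<in> strip" for p
  proof -
    have "norm ((\<nu> p \<bullet> NN p) *\<^sub>R NN p) = 1" using nu[OF p] by metis
    then have "\<bar>\<nu> p \<bullet> NN p\<bar> = 1" using frame(4)[of p] by (simp add: norm_eq_1[symmetric])
    then show ?thesis by (auto simp: abs_eq_iff)
  qed
  have "smooth strip \<nu>" "smooth strip NN" using assms unit_normal_NN by (auto simp: unit_normal_def)
  then have "continuous_on strip (\<lambda>p. \<nu> p \<bullet> NN p)"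
    by (intro continuous_on_inner smooth_imp_continuous_on)
  moreover have "connected strip"
  proof (rule convex_connected)
    have eq: "strip = {p. p $ 1 \<le> 1} \<inter> {p. p $ 1 \<ge> - 1}" by (auto simp: strip_def)
    have "convex {p::real^2. p $ 1 \<le> 1}" "convex {p::real^2. p $ 1 \<ge> - 1}"
      using convex_halfspace_le[of "axis 1 1 :: real^2" 1] convex_halfspace_ge[of "- 1" "axis 1 1 :: real^2"]
      by (simp_all add: inner_axis inner_commute)
    then show "convex strip" unfolding eq by (rule convex_Int)
  qed
  ultimately have "connected ((\<lambda>p. \<nu> p \<bullet> NN p) ` strip)" by (rule connected_continuous_image)
  moreover have "finite ((\<lambda>p. \<nu> p \<bullet> NN p) ` strip)"
    by (rule finite_subset[of _ "{1, - 1}"]) (use pm in auto)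
  moreover have z: "0 \<in> strip" by (simp add: strip_def)
  ultimately obtain \<epsilon> where e: "(\<lambda>p. \<nu> p \<bullet> NN p) ` strip = {\<epsilon>}"
    using connected_finite_iff_sing[of "(\<lambda>p. \<nu> p \<bullet> NN p) ` strip"] by auto
  show thesis
  proof (rule that[of \<epsilon>])
    show "\<epsilon> = 1 \<or> \<epsilon> = - 1" using pm[OF z] e z by auto
    show "\<nu> p = \<epsilon> *\<^sub>R NN p" if "p \<in> strip" for p
      using nu(1)[OF that] e that by force
  qed
qed

lemma sff_unit_normal:
  assumes "\<And>p. p \<in> strip \<Longrightarrow> \<nu> p = \<epsilon> *\<^sub>R NN p" and p: "p \<in> strip"
  shows "sff (Psi a) \<nu> p = diag2 (- \<epsilon> * \<sigma>\<^sup>2 * (c / (z (\<sigma> * p $ 1))\<^sup>2)) (\<epsilon> * c)"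
proof -
  have "Ck (Suc 0) strip NN" using unit_normal_NN by (simp add: unit_normal_def smooth_def del: Ck.simps)
  then obtain D' where D': "(NN has_derivative D') (at p within strip)" using p by auto
  have pd: "pd i \<nu> p = \<epsilon> *\<^sub>R pd i NN p" for i
  proof -
    have "pushfwd \<nu> p = pushfwd (\<lambda>p. \<epsilon> *\<^sub>R NN p) p" by (rule pushfwd_cong[OF p assms(1)])
    also have "\<dots> = (\<lambda>v. \<epsilon> *\<^sub>R D' v)" by (rule pushfwd_eq[OF p has_derivative_scaleR_right[OF D']])
    finally show ?thesis by (simp add: pd_def pushfwd_eq[OF p D'])
  qed
  show ?thesis unfolding sff_def pd vec_eq_iff forall_2
    by (simp add: pd_NN[OF p] pd_Psi[OF p] frame inner_commute[of "EE p" "TT p"] power2_eq_square)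
qed

lemma mean_curvature_NN: "p \<in> strip \<Longrightarrow> mean_curvature (Psi a) NN p = 0"
  using s1_pos by (simp add: mean_curvature_def sum_2 metric_inv_Psi sff_unit_normal[of NN 1])

lemma sff_norm2_Psi:
  assumes "unit_normal (Psi a) \<nu>" and p: "p \<in> strip"
  shows "sff_norm2 (Psi a) \<nu> p = 2 * c\<^sup>2 / (z (\<sigma> * p $ 1)) ^ 4"
proof -
  obtain \<epsilon> :: real where e: "\<epsilon> = 1 \<or> \<epsilon> = - 1" "\<And>p. p \<in> strip \<Longrightarrow> \<nu> p = \<epsilon> *\<^sub>R NN p"
    using unit_normal_unique[OF assms(1)] by blast
  have sq: "\<epsilon> * \<epsilon> = 1" using e(1) by auto
  have sff: "sff (Psi a) \<nu> p = diag2 (- \<epsilon> * \<sigma>\<^sup>2 * (c / (z (\<sigma> * p $ 1))\<^sup>2)) (\<epsilon> * c)"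
    by (rule sff_unit_normal[OF _ p]) (rule e(2))
  have "1 / s2 * (1 / s2) * (- x * s2 * (k / w)) * (- x * s2 * (k / w)) + 1 / w * (1 / w) * (x * k) * (x * k) = 2 * k\<^sup>2 / w\<^sup>2"
    if "x * x = 1" "s2 \<noteq> 0" "w \<noteq> 0" for s2 x k w :: real
  proof -
    have "1 / s2 * (1 / s2) * (- x * s2 * (k / w)) * (- x * s2 * (k / w)) + 1 / w * (1 / w) * (x * k) * (x * k)
        = (x * x) * (2 * k\<^sup>2 / w\<^sup>2)"
      using that(2,3) by (simp add: field_simps power2_eq_square)
    then show ?thesis using that(1) by simp
  qed
  from this[OF sq, of "\<sigma>\<^sup>2" "(z (\<sigma> * p $ 1))\<^sup>2" c] show ?thesis
    using s1_pos unfolding sff_norm2_def sum_2 metric_inv_Psi[OF p] sff by (simp flip: power_mult)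
qed

lemma sdist_Psi: "sdist p0 (Psi a p) = arccos (xx a (\<sigma> * p $ 1))"
  by (simp add: sdist_def p0_def vector_4_inner Psi_revol)

lemma sdist_Psi_bdry:
  assumes "p \<in> bdry"
  shows "sdist p0 (Psi a p) = Rad a"
proof -
  have "p $ 1 = 1 \<or> p $ 1 = - 1" using assms by (auto simp: bdry_def)
  then show ?thesis by (auto simp: sdist_Psi Rad_def parity)
qed

lemma xx_bounds: "- 1 \<le> xx a s" "xx a s \<le> 1"
proof -
  have "(xx a s)\<^sup>2 \<le> 1" using orthonormal(1)[of s] zero_le_power2[of "yy a s"] zero_le_power2[of "z s"] by linarith
  then have "\<bar>xx a s\<bar> \<le> 1" by (simp add: abs_square_le_1)
  then show "- 1 \<le> xx a s" "xx a s \<le> 1" by auto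
qed

lemma conormal_is_radial:
  assumes "p \<in> bdry"
  shows "pushfwd (Psi a) p (conormal (Psi a) p) = d_rho (Psi a p)"
proof -
  have p: "p \<in> strip" using assms by (auto simp: bdry_def strip_def)
  have pm: "p $ 1 = 1 \<or> p $ 1 = - 1" using assms by (auto simp: bdry_def)
  have z4: "(z \<sigma>)\<^sup>2 * (z \<sigma>)\<^sup>2 + S \<sigma> * S \<sigma> = D * D"
    using D_sq' by (simp add: power2_eq_square power4_eq_xxxx)
  have "pushfwd (Psi a) p (conormal (Psi a) p) = sgn (p $ 1) *\<^sub>R TT p"
    using s1_pos by (simp add: pushfwd_Psi[OF p] conormal_Psi[OF p] axis_def)
  also have "\<dots> = (cos (Rad a) *\<^sub>R Psi a p - p0) /\<^sub>R sin (Rad a)"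
  proof -
    have "((- S \<sigma> / D) * (- S \<sigma> / D) - 1) / ((z \<sigma>)\<^sup>2 / D) = - (z \<sigma>)\<^sup>2 / D"
    proof -
      have "(- S \<sigma> / D) * (- S \<sigma> / D) - 1 = (S \<sigma> * S \<sigma> - D * D) / (D * D)"
        by (simp add: diff_divide_distrib)
      also have "S \<sigma> * S \<sigma> - D * D = - ((z \<sigma>)\<^sup>2 * (z \<sigma>)\<^sup>2)" using z4 by simp
      finally have eq: "(- S \<sigma> / D) * (- S \<sigma> / D) - 1 = - ((z \<sigma>)\<^sup>2 * (z \<sigma>)\<^sup>2) / (D * D)" .
      have cancel: "- (w * w) / (D * D) / (w / D) = - w / D" if "w \<noteq> 0" for w using that by simp
      show ?thesis unfolding eq by (rule cancel) simp
    qed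
    moreover have "(- S \<sigma> / D) * (c * z \<sigma> / D) / ((z \<sigma>)\<^sup>2 / D) = - c * S \<sigma> / (z \<sigma> * D)"
      "(- S \<sigma> / D) * z \<sigma> / ((z \<sigma>)\<^sup>2 / D) = - S \<sigma> / z \<sigma>"
      by (simp_all add: field_simps power2_eq_square)
    moreover have "D * D = S \<sigma> * S \<sigma> + z \<sigma> ^ 4"
      using D_sq' by (simp add: power2_eq_square)
    ultimately show ?thesis
      using pm by (auto simp: vec_eq_iff forall_4 TT_def Psi_revol p0_def parity boundary_values cos_Rad sin_Rad t3_def
          divide_inverse[symmetric] field_simps)
  qed
  finally show ?thesis by (simp add: d_rho_def sdist_Psi_bdry[OF assms])
qed

lemma free_boundary: "free_boundary_minimal_annulus (Rad a) (Psi a)"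
  unfolding free_boundary_minimal_annulus_def
proof (intro conjI immersed)
  show "0 < Rad a" "Rad a < pi" using Rad_gt Rad_less pi_gt_zero by linarith+
  have S3: "Psi a p \<in> S3" if "p \<in> strip" for p
    using immersed that by (auto simp: immersed_annulus_def)
  have bs: "bdry \<subseteq> strip" by (auto simp: bdry_def strip_def)
  show "Psi a ` strip \<subseteq> gball (Rad a)"
  proof (intro image_subsetI)
    fix p assume p: "p \<in> strip"
    have "arccos (xx a (\<sigma> * p $ 1)) \<le> Rad a"
      unfolding Rad_def by (rule arccos_le_arccos) (use xx_ge_boundary[OF strip_param[OF p]] xx_bounds in auto)
    then show "Psi a p \<in> gball (Rad a)" using S3[OF p] by (simp add: gball_def sdist_Psi)
  qed
  show "Psi a ` bdry \<subseteq> gsphere (Rad a)"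
    using S3 bs sdist_Psi_bdry by (auto simp: gsphere_def)
  show "\<exists>\<nu>. unit_normal (Psi a) \<nu> \<and> (\<forall>p\<in>strip. mean_curvature (Psi a) \<nu> p = 0)"
    using unit_normal_NN mean_curvature_NN by blast
  show "\<forall>p\<in>bdry. pushfwd (Psi a) p (conormal (Psi a) p) = d_rho (Psi a p)"
    using conormal_is_radial by blast
qed

section \<open>Fields in the Jacobi--Robin kernel\<close>

definition field :: "(real \<Rightarrow> real) \<Rightarrow> (real \<Rightarrow> real) \<Rightarrow> real^2 \<Rightarrow> real" where
  "field f V p = (if p \<in> strip then f (\<sigma> * p $ 1) * V (p $ 2) else 0)"

text \<open>Separation of variables: \<open>V'' = - m V\<close> turns the Jacobi equation into the ordinary equation for \<open>f\<close>, and the two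
  Robin conditions belong to the two boundary circles.\<close>

lemma field_in_kernel:
  assumes f: "smooth UNIV f" "\<And>s. (f has_real_derivative f1 s) (at s)" "\<And>s. (f1 has_real_derivative f2 s) (at s)"
    and V: "smooth UNIV V" "\<And>t. (V has_real_derivative V1 t) (at t)" "\<And>t. (V1 has_real_derivative - m * V t) (at t)"
      "\<And>t. V (t + 2 * pi) = V t"
    and ode: "\<And>s. f2 s - S s / (z s)\<^sup>2 * f1 s + (2 * c\<^sup>2 / (z s) ^ 4 + 2) * f s - m * f s / (z s)\<^sup>2 = 0"
    and robin: "f1 \<sigma> + S \<sigma> / (z \<sigma>)\<^sup>2 * f \<sigma> = 0" "- f1 (- \<sigma>) + S \<sigma> / (z \<sigma>)\<^sup>2 * f (- \<sigma>) = 0"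
  shows "field f V \<in> jacobi_robin_kernel (Psi a) (Rad a)"
proof -
  let ?U = "\<lambda>t. f (\<sigma> * t)"
  have u: "field f V q = ?U (q $ 1) * V (q $ 2)" if "q \<in> strip" for q using that by (simp add: field_def)
  have smooth: "smooth strip (field f V)"
    by (rule smooth_congI[OF smooth_separable[OF smooth_rescaled[OF f(1), of \<sigma>] V(1)]]) (simp add: u)
  have per: "periodic (field f V)"
    by (simp add: periodic_def field_def strip_def axis_def V(4))
  have eq: "laplacian (Psi a) (field f V) p + (sff_norm2 (Psi a) NN p + 2) * field f V p = 0" if p: "p \<in> strip" for p
  proof -
    define s where "s = \<sigma> * p $ 1"
    have "laplacian (Psi a) (field f V) p =
      (\<sigma>\<^sup>2 * f2 s / \<sigma>\<^sup>2 + t3 a s / z s * (\<sigma> * f1 s / \<sigma>)) * V (p $ 2) + f s * (- m * V (p $ 2)) / (z s)\<^sup>2"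
      unfolding s_def
    proof (rule laplacian_separable[OF p u _ _ V(2,3)])
      show "(?U has_real_derivative \<sigma> * f1 (\<sigma> * t)) (at t within {- 1..1})" for t
        by (rule rescaled_deriv[OF f(2)])
      show "((\<lambda>t. \<sigma> * f1 (\<sigma> * t)) has_real_derivative \<sigma>\<^sup>2 * f2 (\<sigma> * t)) (at t within {- 1..1})" for t
        using DERIV_cmult[OF rescaled_deriv[OF f(3)], of \<sigma>] by (simp add: power2_eq_square mult.assoc)
    qed
    also have "\<dots> = (f2 s - S s / (z s)\<^sup>2 * f1 s - m * f s / (z s)\<^sup>2) * V (p $ 2)"
      using s1_pos by (simp add: t3_def field_simps power2_eq_square)
    finally show ?thesis
      unfolding sff_norm2_Psi[OF unit_normal_NN p] u[OF p] s_def[symmetric]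
      using ode[of s] by algebra
  qed
  have rob: "pushfwd (field f V) p (conormal (Psi a) p) - cot (Rad a) * field f V p = 0" if b: "p \<in> bdry" for p
  proof -
    have p: "p \<in> strip" using b by (auto simp: bdry_def strip_def)
    have pm: "p $ 1 = 1 \<or> p $ 1 = - 1" using b by (auto simp: bdry_def)
    have "pushfwd (field f V) p = pushfwd (\<lambda>q. ?U (q $ 1) * V (q $ 2)) p" by (rule pushfwd_cong[OF p u])
    also have "\<dots> = (\<lambda>v. v $ 1 * (\<sigma> * f1 (\<sigma> * p $ 1) * V (p $ 2)) + v $ 2 * (?U (p $ 1) * V1 (p $ 2)))"
      by (rule pushfwd_separable[OF p rescaled_deriv[OF f(2)] V(2)])
    finally have "pushfwd (field f V) p (conormal (Psi a) p) = sgn (p $ 1) * f1 (\<sigma> * p $ 1) * V (p $ 2)"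
      using s1_pos by (simp add: conormal_Psi[OF p] axis_def)
    note eq = this
    have fac: "x * v - (- S \<sigma> / (z \<sigma>)\<^sup>2) * (y * v) = 0" if "x + S \<sigma> / (z \<sigma>)\<^sup>2 * y = 0" for x y v :: real
    proof -
      have "x * v - (- S \<sigma> / (z \<sigma>)\<^sup>2) * (y * v) = (x + S \<sigma> / (z \<sigma>)\<^sup>2 * y) * v" by (simp add: algebra_simps)
      then show ?thesis using that by simp
    qed
    show ?thesis unfolding eq u[OF p] cot_Rad using pm
    proof
      assume 1: "p $ 1 = 1"
      show "sgn (p $ 1) * f1 (\<sigma> * p $ 1) * V (p $ 2) - - S \<sigma> / (z \<sigma>)\<^sup>2 * (f (\<sigma> * p $ 1) * V (p $ 2)) = 0"
        by (rule fac) (use robin(1) 1 in simp)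
    next
      assume 1: "p $ 1 = - 1"
      show "sgn (p $ 1) * f1 (\<sigma> * p $ 1) * V (p $ 2) - - S \<sigma> / (z \<sigma>)\<^sup>2 * (f (\<sigma> * p $ 1) * V (p $ 2)) = 0"
        by (rule fac) (use robin(2) 1 in simp)
    qed
  qed
  show ?thesis unfolding jacobi_robin_kernel_def annulus_functions_def
    using smooth per eq rob unit_normal_NN by (auto simp: field_def)
qed

text \<open>\<open>x\<close> is an eigenfunction of the Laplacian with eigenvalue 2.\<close>

lemma t1_ode: "(t1 a has_real_derivative - 2 * xx a s + S s / (z s)\<^sup>2 * t1 a s) (at s)"
  unfolding xx_eq t1_def[abs_def]
  by (rule derivative_eq_intros refl | simp; fail)+
     (simp only: rational, use relations[of s] in algebra)

text \<open>With \<open>V\<close> the cosine or the sine these are, up to sign, the normal parts of the rotations that fix \<open>p0\<close> and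
  move the second coordinate.\<close>

lemma t1_field_in_kernel:
  assumes "smooth UNIV V" "\<And>t. (V has_real_derivative V1 t) (at t)" "\<And>t. (V1 has_real_derivative - V t) (at t)"
    "\<And>t. V (t + 2 * pi) = V t"
  shows "field (t1 a) V \<in> jacobi_robin_kernel (Psi a) (Rad a)"
proof (rule field_in_kernel[OF smooth_profile(3) t1_ode, where m = 1])
  let ?q = "\<lambda>s. S s / (z s)\<^sup>2"
  let ?q' = "\<lambda>s. (2 * C s * (z s)\<^sup>2 + 2 * (S s)\<^sup>2) / (z s) ^ 4"
  have q: "(?q has_real_derivative ?q' s) (at s)" for s
    by (rule derivative_eq_intros refl | simp; fail)+ (simp add: field_simps power2_eq_square power4_eq_xxxx)
  show "((\<lambda>s. - 2 * xx a s + S s / (z s)\<^sup>2 * t1 a s) has_real_derivative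
      - 2 * t1 a s + (?q' s * t1 a s + (- 2 * xx a s + ?q s * t1 a s) * ?q s)) (at s)" for s
    by (intro DERIV_add DERIV_cmult x_deriv DERIV_mult q t1_ode)
  fix s
  have "2 * C s * (z s)\<^sup>2 + 2 * (S s)\<^sup>2 + 2 * c\<^sup>2 = (z s)\<^sup>2"
    using relations(1-3)[of s] by algebra
  then have "(2 * C s * (z s)\<^sup>2 + 2 * (S s)\<^sup>2) + 2 * c\<^sup>2 = (z s)\<^sup>2" by simp
  then have "((2 * C s * (z s)\<^sup>2 + 2 * (S s)\<^sup>2) + 2 * c\<^sup>2) / (z s) ^ 4 = 1 / (z s)\<^sup>2"
    by (simp add: power2_eq_square power4_eq_xxxx)
  then have k: "?q' s + 2 * c\<^sup>2 / (z s) ^ 4 = 1 / (z s)\<^sup>2" by (simp add: add_divide_distrib)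
  show "- 2 * t1 a s + (?q' s * t1 a s + (- 2 * xx a s + ?q s * t1 a s) * ?q s)
      - S s / (z s)\<^sup>2 * (- 2 * xx a s + S s / (z s)\<^sup>2 * t1 a s)
      + (2 * c\<^sup>2 / (z s) ^ 4 + 2) * t1 a s - 1 * t1 a s / (z s)\<^sup>2 = 0"
  proof -
    have "- 2 * t + (q' * t + (- 2 * x + q * t) * q) - q * (- 2 * x + q * t) + (k + 2) * t - 1 * t / w = 0"
      if "q' + k = 1 / w" for t q' x q k w :: real
    proof -
      have "- 2 * t + (q' * t + (- 2 * x + q * t) * q) - q * (- 2 * x + q * t) + (k + 2) * t - 1 * t / w
        = (q' + k) * t - t / w" by (simp add: algebra_simps)
      then show ?thesis using that by simp
    qed
    from this[OF k] show ?thesis .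
  qed
next
  have *: "- 2 * xx a \<sigma> + S \<sigma> / (z \<sigma>)\<^sup>2 * t1 a \<sigma> + S \<sigma> / (z \<sigma>)\<^sup>2 * t1 a \<sigma> = 0"
    unfolding boundary_values by (simp add: field_simps)
  then show "- 2 * xx a \<sigma> + S \<sigma> / (z \<sigma>)\<^sup>2 * t1 a \<sigma> + S \<sigma> / (z \<sigma>)\<^sup>2 * t1 a \<sigma> = 0" .
  show "- (- 2 * xx a (- \<sigma>) + S (- \<sigma>) / (z (- \<sigma>))\<^sup>2 * t1 a (- \<sigma>)) + S \<sigma> / (z \<sigma>)\<^sup>2 * t1 a (- \<sigma>) = 0"
    unfolding parity using * by simp
qed (use assms in auto)

lemma ww1_minus: "ww1 a (- s) = - ww1 a s"
  by (simp add: ww1_def parity beta_a_minus)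

text \<open>By the formula for \<open>R'\<close> the Robin condition for this field is the equation \<open>R'(a) = 0\<close>;
  the condition at the other boundary component follows by parity.\<close>

lemma ww_field_in_kernel:
  assumes "deriv Rad a = 0"
  shows "field (\<lambda>s. k * ww a s) (\<lambda>_. 1) \<in> jacobi_robin_kernel (Psi a) (Rad a)"
proof (rule field_in_kernel[where m = 0 and ?V1.0 = "\<lambda>_. 0"])
  have "- ((z \<sigma>)\<^sup>2 / c) * (ww1 a \<sigma> + S \<sigma> / (z \<sigma>)\<^sup>2 * ww a \<sigma>) = 0"
    using DERIV_imp_deriv[OF Rad_deriv] assms by simp
  then have robin: "ww1 a \<sigma> + S \<sigma> / (z \<sigma>)\<^sup>2 * ww a \<sigma> = 0"
    by (simp only: mult_eq_0_iff neg_equal_0_iff_equal divide_eq_0_iff power_eq_0_iff nonzero) simp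
  show "smooth UNIV (\<lambda>s. k * ww a s)" by (intro smooth_mult smooth_const smooth_profile)
  show "((\<lambda>s. k * ww a s) has_real_derivative k * ww1 a s) (at s)" for s by (rule DERIV_cmult[OF ww_deriv])
  show "((\<lambda>s. k * ww1 a s) has_real_derivative k * (S s / (z s)\<^sup>2 * ww1 a s - (2 * c\<^sup>2 / (z s) ^ 4 + 2) * ww a s)) (at s)" for s
    by (rule DERIV_cmult[OF ww1_deriv])
  have "k * ww1 a \<sigma> + S \<sigma> / (z \<sigma>)\<^sup>2 * (k * ww a \<sigma>) = k * (ww1 a \<sigma> + S \<sigma> / (z \<sigma>)\<^sup>2 * ww a \<sigma>)"
    by (simp add: algebra_simps)
  then show *: "k * ww1 a \<sigma> + S \<sigma> / (z \<sigma>)\<^sup>2 * (k * ww a \<sigma>) = 0" using robin by simp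
  show "- (k * ww1 a (- \<sigma>)) + S \<sigma> / (z \<sigma>)\<^sup>2 * (k * ww a (- \<sigma>)) = 0"
    using * by (simp add: ww_minus ww1_minus)
qed (auto simp: smooth_const algebra_simps)

text \<open>The three fields are separated by their values at three angles of a boundary circle, where \<open>x' \<noteq> 0\<close>, and at one
  point of the central circle, where \<open>ww \<noteq> 0\<close>.\<close>

lemma nul_ge_3:
  assumes "deriv Rad a = 0"
  shows "3 \<le> nul (Psi a) (Rad a)"
proof -
  let ?u = "field (t1 a) cos" and ?v = "field (t1 a) sin" and ?w = "field (ww a) (\<lambda>_. 1)"
  have t: "t1 a \<sigma> < 0" using zz_pos[of \<sigma>] D_pos by (simp add: boundary_values)
  have w0: "ww a 0 > 0" by (rule ww_0_pos)
  define P where "P = (\<lambda>\<tau> \<theta>. vector [\<tau>, \<theta>] :: real^2)"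
  have P: "field f V (P \<tau> \<theta>) = f (\<sigma> * \<tau>) * V \<theta>" if "\<tau> = 0 \<or> \<tau> = 1" for f V \<tau> \<theta>
    using that by (auto simp: field_def P_def strip_def)
  have comb: "x = 0 \<and> y = 0 \<and> w = 0" if "\<And>p. x * ?u p + y * ?v p + w * ?w p = 0" for x y w
  proof -
    have 1: "x * t1 a \<sigma> + w * ww a \<sigma> = 0" using that[of "P 1 0"] by (simp add: P)
    have 2: "- x * t1 a \<sigma> + w * ww a \<sigma> = 0" using that[of "P 1 pi"] by (simp add: P)
    have 3: "y * t1 a \<sigma> + w * ww a \<sigma> = 0" using that[of "P 1 (pi / 2)"] by (simp add: P)
    have 4: "x * t1 a 0 + w * ww a 0 = 0" using that[of "P 0 0"] by (simp add: P)
    have "x * t1 a \<sigma> = 0" using 1 2 by simp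
    then have x: "x = 0" using t by simp
    then have "w = 0" using 4 w0 by simp
    then show ?thesis using 3 x t by simp
  qed
  have ne: "?u \<noteq> ?v" "?u \<noteq> ?w" "?v \<noteq> ?w"
    using comb[of 1 "- 1" 0] comb[of 1 0 "- 1"] comb[of 0 1 "- 1"] by auto
  let ?B = "{?u, ?v, ?w}"
  have "real_fun.independent ?B"
    unfolding real_fun.independent_explicit_finite_subsets
  proof (intro allI impI ballI)
    fix T g f assume T: "T \<subseteq> ?B" "finite T" "(\<Sum>v\<in>T. (\<lambda>x. g v * v x)) = 0" "f \<in> T"
    define h where "h v = (if v \<in> T then g v else 0)" for v
    have "(\<Sum>v\<in>?B. (\<lambda>x. h v * v x)) = (\<Sum>v\<in>T. (\<lambda>x. h v * v x))"
      by (rule sum.mono_neutral_right) (use T in \<open>auto simp: h_def fun_eq_iff\<close>)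
    also have "\<dots> = (\<Sum>v\<in>T. (\<lambda>x. g v * v x))" by (rule sum.cong) (auto simp: h_def)
    finally have "(\<Sum>v\<in>?B. (\<lambda>x. h v * v x)) = 0" using T by simp
    then have "h ?u * ?u p + h ?v * ?v p + h ?w * ?w p = 0" for p
      using ne by (simp add: fun_eq_iff add.assoc)
    then have "h ?u = 0 \<and> h ?v = 0 \<and> h ?w = 0" by (rule comb)
    then show "g f = 0" using T(1,4) by (auto simp: h_def split: if_splits)
  qed
  moreover have "?B \<subseteq> jacobi_robin_kernel (Psi a) (Rad a)"
  proof -
    have "?u \<in> jacobi_robin_kernel (Psi a) (Rad a)"
      by (rule t1_field_in_kernel[OF smooth_cos, where ?V1.0 = "\<lambda>t. - sin t"]) (auto intro!: derivative_eq_intros)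
    moreover have "?v \<in> jacobi_robin_kernel (Psi a) (Rad a)"
      by (rule t1_field_in_kernel[OF smooth_sin, where ?V1.0 = cos]) (auto intro!: derivative_eq_intros)
    ultimately show ?thesis using ww_field_in_kernel[OF assms, of 1] by simp
  qed
  moreover have "card ?B = 3" using ne by simp
  ultimately have "enat 3 \<le> fun_dim (jacobi_robin_kernel (Psi a) (Rad a))"
    unfolding fun_dim_def by (intro SUP_upper2[of ?B]) auto
  then show ?thesis by (simp add: nul_def numeral_eq_enat)
qed

end

section \<open>The parametric field\<close>

context annulus_parameter
begin

text \<open>The change of the domain with the parameter contributes only a tangential term, a multiple of \<open>\<gamma>'\<close>. In the plane of
  the first two coordinates the variation is split into its radial part \<open>\<partial>L/\<partial>a\<close> and its angular part \<open>L \<partial>\<beta>/\<partial>a\<close>.\<close>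

lemma variation_field:
  assumes p: "p \<in> strip"
  shows "vector_derivative (\<lambda>b. Psi b p) (at a) \<bullet> NN p = ww a (\<sigma> * p $ 1)"
proof -
  define \<tau> where "\<tau> = p $ 1"
  define s where "s = \<sigma> * \<tau>"
  define m where "m = - HH_a a \<sigma> / HH_s a \<sigma> * \<tau>"
  define b where "b = beta_a a s"
  have d: "((\<lambda>b. s1 b * \<tau>) has_real_derivative m) (at a)"
    unfolding m_def by (rule DERIV_cmult_right[OF s1_deriv])
  define dL where "dL = - cos (2 * s) / (2 * L s) + S s / L s * m"
  define dz where "dz = cos (2 * s) / (2 * z s) - S s / z s * m"
  define dB where "dB = b + c / (z s * (L s)\<^sup>2) * m"
  have L: "((\<lambda>b. LL b (s1 b * \<tau>)) has_real_derivative dL) (at a)"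
  proof -
    have "((\<lambda>b. 1/2 - b * cos (2 * (s1 b * \<tau>))) has_real_derivative - cos (2 * s) + S s * (2 * m)) (at a)"
      by (rule derivative_eq_intros d refl)+ (simp add: s_def SS_def)
    from DERIV_chain2[OF DERIV_real_sqrt this]
    have "((\<lambda>b. sqrt (1/2 - b * cos (2 * (s1 b * \<tau>)))) has_real_derivative
        inverse (sqrt (1/2 - a * cos (2 * s))) / 2 * (- cos (2 * s) + S s * (2 * m))) (at a)"
      using lam_pos[of s] by (simp add: s_def lam_def)
    moreover have "sqrt (1/2 - a * cos (2 * s)) = L s" by (simp add: LL_def lam_def)
    moreover have "inverse (L s) / 2 * (- cos (2 * s) + S s * (2 * m)) = dL"
      by (simp add: dL_def field_simps)
    ultimately show ?thesis unfolding LL_def lam_def by simp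
  qed
  have z: "((\<lambda>b. zz b (s1 b * \<tau>)) has_real_derivative dz) (at a)"
  proof -
    have "((\<lambda>b. 1/2 + b * cos (2 * (s1 b * \<tau>))) has_real_derivative cos (2 * s) - S s * (2 * m)) (at a)"
      by (rule derivative_eq_intros d refl)+ (simp add: s_def SS_def)
    from DERIV_chain2[OF DERIV_real_sqrt this]
    have "((\<lambda>b. sqrt (1/2 + b * cos (2 * (s1 b * \<tau>)))) has_real_derivative
        inverse (sqrt (1/2 + a * cos (2 * s))) / 2 * (cos (2 * s) - S s * (2 * m))) (at a)"
      using zz_arg_pos[of s] by (simp add: s_def)
    moreover have "sqrt (1/2 + a * cos (2 * s)) = z s" by (simp add: zz_def)
    moreover have "inverse (z s) / 2 * (cos (2 * s) - S s * (2 * m)) = dz"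
      by (simp add: dz_def field_simps)
    ultimately show ?thesis unfolding zz_def by simp
  qed
  have B: "((\<lambda>b. beta b (s1 b * \<tau>)) has_real_derivative dB) (at a)"
  proof -
    have pair: "((\<lambda>b. (b, s1 b * \<tau>)) has_derivative (\<lambda>h. (h, m * h))) (at a)"
      using d unfolding has_field_derivative_def by (intro has_derivative_Pair has_derivative_ident)
    have "((\<lambda>(a, s). beta a s) has_derivative (\<lambda>(da, ds). beta_a a s * da + omega a s * ds)) (at (a, s1 a * \<tau>))"
      using beta_has_derivative[of s] by (simp add: s_def)
    from has_derivative_compose[OF pair this]
    have "((\<lambda>b. beta b (s1 b * \<tau>)) has_derivative (\<lambda>h. beta_a a s * h + omega a s * (m * h))) (at a)" by simp
    then show ?thesis unfolding has_field_derivative_def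
      by (rule has_derivative_eq_rhs) (simp add: fun_eq_iff dB_def b_def omega_def lam_L algebra_simps)
  qed
  define u v where "u = sin (B s)" and "v = cos (B s)"
  define dx where "dx = dL * v - L s * (u * dB)"
  define dy where "dy = dL * u + L s * (v * dB)"
  have x: "((\<lambda>b. xx b (s1 b * \<tau>)) has_real_derivative dx) (at a)"
    unfolding xx_eq dx_def by (rule derivative_eq_intros L B refl)+ (simp add: u_def v_def s_def)
  have y: "((\<lambda>b. yy b (s1 b * \<tau>)) has_real_derivative dy) (at a)"
    unfolding yy_eq dy_def by (rule derivative_eq_intros L B refl)+ (simp add: u_def v_def s_def)
  have "((\<lambda>b. Psi b p) has_vector_derivative
      dx *\<^sub>R axis 1 1 + dy *\<^sub>R axis 2 1 + (dz * cos (p $ 2)) *\<^sub>R axis 3 1 + (dz * sin (p $ 2)) *\<^sub>R axis 4 1) (at a)"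
    unfolding Psi_def X_imm_def vector_4_eq \<tau>_def[symmetric] vector_2
    using x y DERIV_cmult_right[OF z] unfolding has_real_derivative_iff_has_vector_derivative
    by (intro has_vector_derivative_add)
       (auto intro!: bounded_linear.has_vector_derivative[OF bounded_linear_scaleR_left])
  then have "vector_derivative (\<lambda>b. Psi b p) (at a) = vector [dx, dy, dz * cos (p $ 2), dz * sin (p $ 2)]"
    by (simp add: vector_derivative_at vector_4_eq)
  then have "vector_derivative (\<lambda>b. Psi b p) (at a) \<bullet> NN p
      = dx * n1 a s + dy * n2 a s + (dz * cos (p $ 2) * (n3 a s * cos (p $ 2)) + dz * sin (p $ 2) * (n3 a s * sin (p $ 2)))"
    by (simp add: vector_4_inner NN_def s_def \<tau>_def)
  also have "dz * cos (p $ 2) * (n3 a s * cos (p $ 2)) + dz * sin (p $ 2) * (n3 a s * sin (p $ 2)) = dz * n3 a s"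
    using sin_cos_squared_add[of "p $ 2"] by algebra
  also have "dx * n1 a s + dy * n2 a s + dz * n3 a s = ww a s"
  proof -
    have uv: "u\<^sup>2 + v\<^sup>2 = 1" by (simp add: u_def v_def)
    have rad: "v * n1 a s + u * n2 a s = - c / L s" and rot: "- u * n1 a s + v * n2 a s = S s / (z s * L s)"
      unfolding n1_def n2_def u_def[symmetric] v_def[symmetric]
      by (simp only: rational, use uv in algebra)+
    have "dx * n1 a s + dy * n2 a s = dL * (v * n1 a s + u * n2 a s) + L s * dB * (- u * n1 a s + v * n2 a s)"
      by (simp add: dx_def dy_def algebra_simps)
    then have "dx * n1 a s + dy * n2 a s + dz * n3 a s = dL * (- c / L s) + L s * dB * (S s / (z s * L s)) + dz * (c / z s)"
      unfolding rad rot n3_def by simp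
    also have "\<dots> = ww a s"
      unfolding dL_def dB_def dz_def ww_def b_def[symmetric]
      by (simp only: rational, use inverses[of s] Lz[of s] in algebra)
    finally show ?thesis .
  qed
  finally show ?thesis by (simp add: s_def \<tau>_def)
qed

lemma phi_eq_field:
  assumes "unit_normal (Psi a) (\<nu> a)"
  obtains \<epsilon> :: real where "\<epsilon> = 1 \<or> \<epsilon> = - 1" "phi \<nu> a = field (\<lambda>s. \<epsilon> * ww a s) (\<lambda>_. 1)"
proof -
  obtain \<epsilon> :: real where e: "\<epsilon> = 1 \<or> \<epsilon> = - 1" "\<And>p. p \<in> strip \<Longrightarrow> \<nu> a p = \<epsilon> *\<^sub>R NN p"
    using unit_normal_unique[OF assms] by blast
  have "phi \<nu> a p = field (\<lambda>s. \<epsilon> * ww a s) (\<lambda>_. 1) p" for p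
    by (simp add: phi_def field_def e(2) variation_field)
  then show thesis using that[OF e(1)] by blast
qed

lemma field_rotation_invariant: "rotation_invariant (field f (\<lambda>_. k))"
  by (auto simp: rotation_invariant_def field_def strip_def)

lemma field_reflection_even:
  assumes "\<And>s. f (- s) = f s"
  shows "reflection_even (field f V)"
  by (simp add: reflection_even_def field_def strip_def assms)

end

section \<open>Killing fields along great circles\<close>

text \<open>The derivative of \<open>\<langle>Z, g'\<rangle>\<close> along a great circle \<open>g\<close> is \<open>\<langle>D Z(g'), g'\<rangle> - \<langle>Z, g\<rangle>\<close>. The first term vanishes by the
  Killing equation, the second because \<open>Z\<close> is tangent to the sphere.\<close>

lemma killing_along_great_circle:
  assumes Z: "killing_field Z" and P: "P \<bullet> P = 1" and Q: "Q \<bullet> Q = 1" and PQ: "P \<bullet> Q = 0"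
  shows "Z (cos t *\<^sub>R P + sin t *\<^sub>R Q) \<bullet> (- sin t *\<^sub>R P + cos t *\<^sub>R Q) = Z P \<bullet> Q"
proof -
  define g where "g = (\<lambda>t. cos t *\<^sub>R P + sin t *\<^sub>R Q)"
  define h where "h = (\<lambda>t. - sin t *\<^sub>R P + cos t *\<^sub>R Q)"
  have gS: "g t \<in> S3" for t
  proof -
    have "g t \<bullet> g t = (cos t)\<^sup>2 + (sin t)\<^sup>2"
      using P Q PQ by (simp add: g_def inner_add_left inner_add_right inner_commute[of Q P] power2_eq_square)
    then show ?thesis by (simp add: norm_eq_1)
  qed
  have gh: "h t \<bullet> g t = 0" for t
    using P Q PQ by (simp add: g_def h_def inner_add_left inner_add_right inner_diff_left inner_commute[of Q P])
  have g': "(g has_derivative (\<lambda>x. x *\<^sub>R h t)) (at t)" for t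
    unfolding g_def h_def by (auto intro!: derivative_eq_intros simp: scaleR_diff_right)
  have h': "(h has_derivative (\<lambda>x. x *\<^sub>R (- g t))) (at t)" for t
    unfolding g_def h_def by (auto intro!: derivative_eq_intros simp: scaleR_add_right algebra_simps)
  have "((\<lambda>t. Z (g t) \<bullet> h t) has_real_derivative 0) (at t)" for t
  proof -
    have "Ck (Suc 0) S3 Z" using Z by (simp add: killing_field_def smooth_def del: Ck.simps)
    then have "Z differentiable (at (g t) within S3)" using gS[of t] by (auto simp: differentiable_def)
    then have D: "(Z has_derivative frechet_derivative Z (at (g t) within S3)) (at (g t) within S3)" (is "(_ has_derivative ?D) _")
      by (simp add: frechet_derivative_works)
    have "(Z has_derivative ?D) (at (g t) within range g)"
      by (rule has_derivative_subset[OF D]) (use gS in blast)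
    from has_derivative_in_compose[OF g' this]
    have Zg: "((\<lambda>t. Z (g t)) has_derivative (\<lambda>x. ?D (x *\<^sub>R h t))) (at t)" .
    have "?D (h t) \<bullet> h t + h t \<bullet> ?D (h t) = 0"
      using Z gS[of t] gh[of t] unfolding killing_field_def by blast
    then have k: "?D (h t) \<bullet> h t = 0" by (simp add: inner_commute)
    have tan: "Z (g t) \<bullet> g t = 0" using Z gS[of t] by (auto simp: killing_field_def)
    have "((\<lambda>t. Z (g t) \<bullet> h t) has_derivative (\<lambda>x. Z (g t) \<bullet> (x *\<^sub>R (- g t)) + ?D (x *\<^sub>R h t) \<bullet> h t)) (at t)"
      by (rule has_derivative_inner[OF Zg h'])
    moreover have "?D (x *\<^sub>R h t) = x *\<^sub>R ?D (h t)" for x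
      by (rule linear.scaleR[OF has_derivative_linear[OF D]])
    ultimately show ?thesis unfolding has_field_derivative_def
      using k tan by (simp add: lambda_zero)
  qed
  then have "Z (g t) \<bullet> h t = Z (g 0) \<bullet> h 0" by (rule DERIV_isconst_all[rule_format])
  then show ?thesis by (simp add: g_def h_def)
qed

context annulus_parameter
begin

text \<open>On the central circle \<open>s = 0\<close> the position and the normal span the plane of \<open>p0\<close> and the direction \<open>\<theta>\<close>; the normal great circle
  reaches \<open>p0\<close> with velocity equal to that direction.\<close>

lemma killing_at_central_circle:
  assumes "killing_field Z"
  shows "Z (Psi a (vector [0, \<theta>])) \<bullet> NN (vector [0, \<theta>]) = Z p0 \<bullet> vector [0, 0, cos \<theta>, sin \<theta>]"
proof -
  let ?p = "vector [0, \<theta>] :: real^2"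
  have S0: "S 0 = 0" by (simp add: SS_def)
  have "(L 0 * z 0)\<^sup>2 = c\<^sup>2" using SLz[of 0] S0 by (simp add: power_mult_distrib)
  then have cLz: "c = L 0 * z 0"
    using cc_pos L_pos[of 0] zz_pos[of 0] by (simp add: power2_eq_iff_nonneg)
  have Psi: "Psi a ?p = vector [L 0, 0, z 0 * cos \<theta>, z 0 * sin \<theta>]"
    by (simp add: vec_eq_iff forall_4 Psi_revol xx_eq yy_eq)
  have N: "NN ?p = vector [- z 0, 0, L 0 * cos \<theta>, L 0 * sin \<theta>]"
    by (simp add: vec_eq_iff forall_4 NN_def n1_def n2_def n3_def S0 cLz)
  obtain t where t: "L 0 = cos t" "- z 0 = sin t"
    using sincos_total_2pi[of "L 0" "- z 0"] Lz[of 0] by auto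
  have one: "L 0 * L 0 + z 0 * z 0 = 1" using Lz[of 0] by (simp add: power2_eq_square)
  have s: "z 0 = - sin t" using t(2) by simp
  have "cos t *\<^sub>R Psi a ?p + sin t *\<^sub>R NN ?p = p0"
    unfolding t(1)[symmetric] t(2)[symmetric] Psi N p0_def using one by (simp add: vec_eq_iff forall_4)
  moreover have "- sin t *\<^sub>R Psi a ?p + cos t *\<^sub>R NN ?p = vector [0, 0, cos \<theta>, sin \<theta>]"
  proof -
    have "z 0 * (z 0 * x) + L 0 * (L 0 * x) = x" for x using one by algebra
    then show ?thesis
      unfolding t(1)[symmetric] t(2)[symmetric] Psi N by (simp add: vec_eq_iff forall_4)
  qed
  ultimately show ?thesis
    using killing_along_great_circle[OF assms frame(1)[of ?p] frame(4)[of ?p], of t] frame(7)[of ?p]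
    by (simp add: inner_commute)
qed

text \<open>At the two ends of a diameter of the central circle the normal geodesics pass through \<open>p0\<close> in
  opposite directions, so an induced field takes opposite values there.\<close>

lemma rotation_invariant_killing_vanishes_at_centre:
  assumes "killing_induced (Psi a) r u" "rotation_invariant u"
  shows "u (vector [0, 0]) = 0"
proof -
  obtain Z \<nu> where Z: "killing_field Z" "unit_normal (Psi a) \<nu>" "\<And>p. p \<in> strip \<Longrightarrow> u p = Z (Psi a p) \<bullet> \<nu> p"
    using assms(1) unfolding killing_induced_def by blast
  obtain \<epsilon> :: real where e: "\<And>p. p \<in> strip \<Longrightarrow> \<nu> p = \<epsilon> *\<^sub>R NN p"
    using unit_normal_unique[OF Z(2)] by blast
  have val: "u (vector [0, \<theta>]) = \<epsilon> * (Z p0 \<bullet> vector [0, 0, cos \<theta>, sin \<theta>])" for \<theta>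
  proof -
    have s: "vector [0, \<theta>] \<in> strip" by (simp add: strip_def)
    show ?thesis by (simp add: Z(3)[OF s] e[OF s] killing_at_central_circle[OF Z(1)])
  qed
  have "u (vector [0, pi]) = - u (vector [0, 0])"
    unfolding val by (simp add: inner_4)
  moreover have "u (vector [0, pi]) = u (vector [0, 0])"
    using assms(2) by (auto simp: rotation_invariant_def)
  ultimately show ?thesis by simp
qed

lemma ww_field_not_killing: "\<not> killing_induced (Psi a) r (field (ww a) (\<lambda>_. 1))"
  using rotation_invariant_killing_vanishes_at_centre[OF _ field_rotation_invariant] ww_0_pos
  by (fastforce simp: field_def strip_def)

lemma degenerate_critical: "deriv Rad a = 0 \<Longrightarrow> degenerate (Psi a) (Rad a)"
  unfolding degenerate_def using ww_field_in_kernel[of 1] ww_field_not_killing by auto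

lemma phi_properties:
  assumes "smooth_normal_family \<nu>" "deriv Rad a = 0"
  shows "phi \<nu> a \<in> jacobi_robin_kernel (Psi a) (Rad a)" "phi \<nu> a \<noteq> (\<lambda>_. 0)"
    "rotation_invariant (phi \<nu> a)" "reflection_even (phi \<nu> a)"
    "\<not> killing_induced (Psi a) (Rad a) (phi \<nu> a)"
proof -
  have "unit_normal (Psi a) (\<nu> a)" using assms(1) a_pos a_less by (auto simp: smooth_normal_family_def)
  then obtain \<epsilon> :: real where e: "\<epsilon> = 1 \<or> \<epsilon> = - 1" "phi \<nu> a = field (\<lambda>s. \<epsilon> * ww a s) (\<lambda>_. 1)"
    by (rule phi_eq_field)
  show "rotation_invariant (phi \<nu> a)" unfolding e(2) by (rule field_rotation_invariant)
  show "reflection_even (phi \<nu> a)" unfolding e(2) by (rule field_reflection_even) (simp add: ww_minus)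
  have v: "phi \<nu> a (vector [0, 0]) \<noteq> 0" using e ww_0_pos by (auto simp: field_def strip_def)
  then show "phi \<nu> a \<noteq> (\<lambda>_. 0)" by auto
  show "\<not> killing_induced (Psi a) (Rad a) (phi \<nu> a)"
    using rotation_invariant_killing_vanishes_at_centre[OF _ \<open>rotation_invariant (phi \<nu> a)\<close>] v by blast
  show "phi \<nu> a \<in> jacobi_robin_kernel (Psi a) (Rad a)"
    unfolding e(2) by (rule ww_field_in_kernel[OF assms(2)])
qed

section \<open>Even fields at noncritical parameters\<close>

text \<open>The rotationally invariant Jacobi equation in the parameter \<open>\<tau> = s / s1\<close> of the strip, as a first-order system
  for a function and its derivative.\<close>

definition jacobi_solution :: "(real \<Rightarrow> real) \<Rightarrow> (real \<Rightarrow> real) \<Rightarrow> bool" where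
  "jacobi_solution f f1 \<longleftrightarrow> (\<forall>\<tau>\<in>{-1..1}. (f has_real_derivative f1 \<tau>) (at \<tau> within {-1..1}) \<and>
     (f1 has_real_derivative - (\<sigma> * t3 a (\<sigma> * \<tau>) / z (\<sigma> * \<tau>)) * f1 \<tau>
        - \<sigma>\<^sup>2 * (2 * c\<^sup>2 / z (\<sigma> * \<tau>) ^ 4 + 2) * f \<tau>) (at \<tau> within {-1..1}))"

lemma wronskian_constant:
  assumes f: "jacobi_solution f f1" and g: "jacobi_solution g g1" and \<tau>: "\<tau> \<in> {-1..1}" "\<tau>' \<in> {-1..1}"
  shows "z (\<sigma> * \<tau>) * (f \<tau> * g1 \<tau> - f1 \<tau> * g \<tau>) = z (\<sigma> * \<tau>') * (f \<tau>' * g1 \<tau>' - f1 \<tau>' * g \<tau>')"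
proof -
  let ?W = "\<lambda>\<tau>. z (\<sigma> * \<tau>) * (f \<tau> * g1 \<tau> - f1 \<tau> * g \<tau>)"
  have "(?W has_real_derivative 0) (at \<tau> within {-1..1})" if t: "\<tau> \<in> {-1..1}" for \<tau>
  proof -
    define k q where "k = \<sigma> * t3 a (\<sigma> * \<tau>) / z (\<sigma> * \<tau>)" and "q = \<sigma>\<^sup>2 * (2 * c\<^sup>2 / z (\<sigma> * \<tau>) ^ 4 + 2)"
    have "(f has_real_derivative f1 \<tau>) (at \<tau> within {-1..1})" "(f1 has_real_derivative - k * f1 \<tau> - q * f \<tau>) (at \<tau> within {-1..1})"
      "(g has_real_derivative g1 \<tau>) (at \<tau> within {-1..1})" "(g1 has_real_derivative - k * g1 \<tau> - q * g \<tau>) (at \<tau> within {-1..1})"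
      using f g t unfolding jacobi_solution_def k_def q_def by blast+
    note d = this
    have "(?W has_real_derivative (\<sigma> * t3 a (\<sigma> * \<tau>)) * (f \<tau> * g1 \<tau> - f1 \<tau> * g \<tau>) +
        ((f1 \<tau> * g1 \<tau> + (- k * g1 \<tau> - q * g \<tau>) * f \<tau>) - ((- k * f1 \<tau> - q * f \<tau>) * g \<tau> + g1 \<tau> * f1 \<tau>)) * z (\<sigma> * \<tau>))
        (at \<tau> within {-1..1})"
      by (intro DERIV_mult DERIV_diff rescaled_deriv z_deriv' d)
    moreover have "\<sigma> * t3 a (\<sigma> * \<tau>) = k * z (\<sigma> * \<tau>)" by (simp add: k_def)
    then have "(\<sigma> * t3 a (\<sigma> * \<tau>)) * (f \<tau> * g1 \<tau> - f1 \<tau> * g \<tau>) +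
        ((f1 \<tau> * g1 \<tau> + (- k * g1 \<tau> - q * g \<tau>) * f \<tau>) - ((- k * f1 \<tau> - q * f \<tau>) * g \<tau> + g1 \<tau> * f1 \<tau>)) * z (\<sigma> * \<tau>) = 0"
      by algebra
    ultimately show ?thesis by (simp only:)
  qed
  then have "\<exists>w. \<forall>\<tau>\<in>{-1..1}. ?W \<tau> = w"
    by (intro has_field_derivative_zero_constant) auto
  then show ?thesis using \<tau> by metis
qed

lemma jacobi_solution_rescaled:
  assumes "\<And>s. (f has_real_derivative f1 s) (at s)"
    "\<And>s. (f1 has_real_derivative S s / (z s)\<^sup>2 * f1 s - (2 * c\<^sup>2 / (z s) ^ 4 + 2) * f s) (at s)"
  shows "jacobi_solution (\<lambda>\<tau>. f (\<sigma> * \<tau>)) (\<lambda>\<tau>. \<sigma> * f1 (\<sigma> * \<tau>))"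
  unfolding jacobi_solution_def
proof (intro ballI conjI)
  fix \<tau> :: real
  show "((\<lambda>\<tau>. f (\<sigma> * \<tau>)) has_real_derivative \<sigma> * f1 (\<sigma> * \<tau>)) (at \<tau> within {-1..1})"
    by (rule rescaled_deriv[OF assms(1)])
  show "((\<lambda>\<tau>. \<sigma> * f1 (\<sigma> * \<tau>)) has_real_derivative - (\<sigma> * t3 a (\<sigma> * \<tau>) / z (\<sigma> * \<tau>)) * (\<sigma> * f1 (\<sigma> * \<tau>))
        - \<sigma>\<^sup>2 * (2 * c\<^sup>2 / z (\<sigma> * \<tau>) ^ 4 + 2) * f (\<sigma> * \<tau>)) (at \<tau> within {-1..1})"
    by (rule DERIV_cong[OF DERIV_cmult[OF rescaled_deriv[OF assms(2)]]])
       (simp add: t3_def algebra_simps power2_eq_square)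
qed

text \<open>The second solution \<open>z'\<close>, induced by rotation of the first two coordinates.\<close>

lemma t3_jacobi:
  "(t3 a has_real_derivative - z s + c\<^sup>2 / (z s) ^ 3) (at s)"
  "((\<lambda>s. - z s + c\<^sup>2 / (z s) ^ 3) has_real_derivative
     S s / (z s)\<^sup>2 * (- z s + c\<^sup>2 / (z s) ^ 3) - (2 * c\<^sup>2 / (z s) ^ 4 + 2) * t3 a s) (at s)"
proof -
  show "(t3 a has_real_derivative - z s + c\<^sup>2 / (z s) ^ 3) (at s)"
    by (rule DERIV_cong[OF t3_deriv]) (simp add: n3_def power2_eq_square power3_eq_cube)
  show "((\<lambda>s. - z s + c\<^sup>2 / (z s) ^ 3) has_real_derivative
     S s / (z s)\<^sup>2 * (- z s + c\<^sup>2 / (z s) ^ 3) - (2 * c\<^sup>2 / (z s) ^ 4 + 2) * t3 a s) (at s)"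
    unfolding t3_def
    by (rule derivative_eq_intros refl | simp; fail)+
       (simp only: numeral_exponents rational, use inverses(1)[of s] in algebra)
qed

text \<open>The Wronskian with \<open>ww\<close> vanishes at the centre, hence at the boundary. If \<open>U\<close> were nonzero there, \<open>ww\<close> would
  satisfy the same Robin condition as \<open>U\<close>, which it does not. So \<open>U\<close> has zero Cauchy data at the boundary, and its
  Wronskians with two independent solutions vanish everywhere.\<close>

lemma even_solution_vanishes:
  assumes U: "jacobi_solution U U1" and U0: "U1 0 = 0"
    and robin: "U1 1 + \<sigma> * (S \<sigma> / (z \<sigma>)\<^sup>2) * U 1 = 0"
    and noncritical: "deriv Rad a \<noteq> 0" and \<tau>: "\<tau> \<in> {-1..1}"
  shows "U \<tau> = 0"
proof -
  (* w is the even solution and v the odd one; their Wronskian is computed at the centre *)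
  let ?w = "\<lambda>\<tau>. ww a (\<sigma> * \<tau>)" and ?w1 = "\<lambda>\<tau>. \<sigma> * ww1 a (\<sigma> * \<tau>)"
  let ?v = "\<lambda>\<tau>. t3 a (\<sigma> * \<tau>)" and ?v1 = "\<lambda>\<tau>. \<sigma> * (- z (\<sigma> * \<tau>) + c\<^sup>2 / z (\<sigma> * \<tau>) ^ 3)"
  have w: "jacobi_solution ?w ?w1" by (rule jacobi_solution_rescaled[OF ww_deriv ww1_deriv])
  have v: "jacobi_solution ?v ?v1" by (rule jacobi_solution_rescaled[OF t3_jacobi])
  have ww10: "ww1 a 0 = 0" by (simp add: ww1_def)
  have W: "U t * ?w1 t - U1 t * ?w t = 0" if "t \<in> {-1..1}" for t
    using wronskian_constant[OF U w that, of 0] U0 ww10 by simp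
  have "U 1 * (\<sigma> * (ww1 a \<sigma> + S \<sigma> / (z \<sigma>)\<^sup>2 * ww a \<sigma>)) = 0"
  proof -
    have 1: "U 1 * (\<sigma> * ww1 a \<sigma>) - U1 1 * ww a \<sigma> = 0" using W[of 1] by simp
    show ?thesis using 1 robin by algebra
  qed
  moreover have "ww1 a \<sigma> + S \<sigma> / (z \<sigma>)\<^sup>2 * ww a \<sigma> \<noteq> 0"
    using noncritical DERIV_imp_deriv[OF Rad_deriv] by auto
  ultimately have U_1: "U 1 = 0" using s1_pos by simp
  then have U1_1: "U1 1 = 0" using robin by simp
  have V: "U t * ?v1 t - U1 t * ?v t = 0" if "t \<in> {-1..1}" for t
    using wronskian_constant[OF U v that, of 1] U_1 U1_1 by simp
  have "z (\<sigma> * \<tau>) * (?w \<tau> * ?v1 \<tau> - ?w1 \<tau> * ?v \<tau>) = z 0 * (ww a 0 * (\<sigma> * (- z 0 + c\<^sup>2 / (z 0) ^ 3)) - 0)"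
    using wronskian_constant[OF w v \<tau>, of 0] ww10 by simp
  also have "- z 0 + c\<^sup>2 / (z 0) ^ 3 = - (2 * a) / z 0"
  proof -
    have "c\<^sup>2 = (1/2 - a) * (z 0)\<^sup>2" "(z 0)\<^sup>2 = 1/2 + a"
      unfolding cc_sq zz_sq by (simp_all add: algebra_simps power2_eq_square)
    then have "c\<^sup>2 / (z 0) ^ 3 = (1/2 - a) / z 0"
      by (simp only: power3_eq_cube power2_eq_square) (use a_pos in simp)
    moreover have "- z 0 = - (z 0)\<^sup>2 / z 0" by (simp add: power2_eq_square)
    ultimately show ?thesis unfolding \<open>(z 0)\<^sup>2 = 1/2 + a\<close>
      by (simp add: diff_divide_distrib add_divide_distrib)
  qed
  finally have eq: "z (\<sigma> * \<tau>) * (?w \<tau> * ?v1 \<tau> - ?w1 \<tau> * ?v \<tau>) = z 0 * (ww a 0 * (\<sigma> * (- (2 * a) / z 0)) - 0)" .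
  have "?w \<tau> * ?v1 \<tau> - ?w1 \<tau> * ?v \<tau> \<noteq> 0"
  proof
    assume 0: "?w \<tau> * ?v1 \<tau> - ?w1 \<tau> * ?v \<tau> = 0"
    show False using eq ww_0_pos s1_pos a_pos unfolding 0 by simp
  qed
  moreover have "U \<tau> * (?w \<tau> * ?v1 \<tau> - ?w1 \<tau> * ?v \<tau>) = 0"
    using V[OF \<tau>] W[OF \<tau>] by algebra
  ultimately show ?thesis by simp
qed

end

lemma strip_slice:
  assumes "Ck (Suc k) strip (u :: real^2 \<Rightarrow> real)"
  obtains w where "Ck k strip w"
    "\<And>\<tau>. \<tau> \<in> {-1..1} \<Longrightarrow> ((\<lambda>\<tau>. u (\<tau> *\<^sub>R axis 1 1)) has_real_derivative w (\<tau> *\<^sub>R axis 1 1)) (at \<tau> within {-1..1})"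
proof -
  obtain D where D: "\<And>x. x \<in> strip \<Longrightarrow> (u has_derivative D x) (at x within strip)" "\<And>v. Ck k strip (\<lambda>x. D x v)"
    using Ck_SucE[OF assms] by blast
  show thesis
  proof (rule that[OF D(2)[of "axis 1 1"]])
    fix \<tau> :: real assume \<tau>: "\<tau> \<in> {-1..1}"
    let ?i = "\<lambda>\<tau>. \<tau> *\<^sub>R (axis 1 1 :: real^2)"
    have s: "?i \<tau> \<in> strip" "?i ` {-1..1} \<subseteq> strip" using \<tau> by (auto simp: strip_def axis_def abs_le_iff)
    have i: "(?i has_derivative ?i) (at \<tau> within {-1..1})" by (auto intro!: derivative_eq_intros)
    have "(u has_derivative D (?i \<tau>)) (at (?i \<tau>) within ?i ` {-1..1})"
      by (rule has_derivative_subset[OF D(1)[OF s(1)] s(2)])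
    from has_derivative_in_compose[OF i this]
    have "((\<lambda>\<tau>. u (?i \<tau>)) has_derivative (\<lambda>h. D (?i \<tau>) (?i h))) (at \<tau> within {-1..1})" .
    moreover have "(\<lambda>h. D (?i \<tau>) (?i h)) = (*) (D (?i \<tau>) (axis 1 1))"
      using linear.scaleR[OF has_derivative_linear[OF D(1)[OF s(1)]], of _ "axis 1 1"]
      by (simp add: fun_eq_iff mult.commute)
    ultimately show "((\<lambda>\<tau>. u (?i \<tau>)) has_real_derivative D (?i \<tau>) (axis 1 1)) (at \<tau> within {-1..1})"
      unfolding has_field_derivative_def by (simp only:)
  qed
qed

lemma (in annulus_parameter) kernel_ev_noncritical:
  assumes u: "u \<in> kernel_ev (Psi a) (Rad a)" and noncritical: "deriv Rad a \<noteq> 0"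
  shows "u = (\<lambda>_. 0)"
proof -
  have uk: "smooth strip u" "\<And>p. p \<notin> strip \<Longrightarrow> u p = 0" "rotation_invariant u" "reflection_even u"
    "\<And>p. p \<in> bdry \<Longrightarrow> pushfwd u p (conormal (Psi a) p) - cot (Rad a) * u p = 0"
    using u by (auto simp: kernel_ev_def jacobi_robin_kernel_def annulus_functions_def)
  obtain \<nu> where \<nu>: "unit_normal (Psi a) \<nu>"
      "\<And>p. p \<in> strip \<Longrightarrow> laplacian (Psi a) u p + (sff_norm2 (Psi a) \<nu> p + 2) * u p = 0"
    using u by (auto simp: kernel_ev_def jacobi_robin_kernel_def)
  let ?i = "\<lambda>\<tau>. \<tau> *\<^sub>R (axis 1 1 :: real^2)"
  have i1: "?i t $ 1 = t" for t by (simp add: axis_def)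
  define U where "U = (\<lambda>\<tau>. u (?i \<tau>))"
  have uU: "u p = U (p $ 1) * 1" for p
    using uk(3) unfolding rotation_invariant_def U_def by (metis i1 mult_1_right)
  have "Ck (Suc (Suc 0)) strip u" using uk(1) by (simp add: smooth_def del: Ck.simps)
  from strip_slice[OF this] obtain w where w: "Ck (Suc 0) strip w"
    "\<And>\<tau>. \<tau> \<in> {-1..1} \<Longrightarrow> (U has_real_derivative w (?i \<tau>)) (at \<tau> within {-1..1})"
    unfolding U_def by blast
  obtain w' where w': "\<And>\<tau>. \<tau> \<in> {-1..1} \<Longrightarrow> ((\<lambda>\<tau>. w (?i \<tau>)) has_real_derivative w' (?i \<tau>)) (at \<tau> within {-1..1})"
    using strip_slice[OF w(1)] by blast
  define U1 U2 where "U1 = (\<lambda>\<tau>. w (?i \<tau>))" and "U2 = (\<lambda>\<tau>. w' (?i \<tau>))"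
  have d: "\<And>\<tau>. \<tau> \<in> {-1..1} \<Longrightarrow> (U has_real_derivative U1 \<tau>) (at \<tau> within {-1..1})"
    "\<And>\<tau>. \<tau> \<in> {-1..1} \<Longrightarrow> (U1 has_real_derivative U2 \<tau>) (at \<tau> within {-1..1})"
    using w(2) w' by (simp_all add: U1_def U2_def)
  have ode: "U2 \<tau> = - (\<sigma> * t3 a (\<sigma> * \<tau>) / z (\<sigma> * \<tau>)) * U1 \<tau> - \<sigma>\<^sup>2 * (2 * c\<^sup>2 / z (\<sigma> * \<tau>) ^ 4 + 2) * U \<tau>"
    if \<tau>: "\<tau> \<in> {-1..1}" for \<tau>
  proof -
    have p: "?i \<tau> \<in> strip" using \<tau> by (auto simp: strip_def axis_def abs_le_iff)
    have "laplacian (Psi a) u (?i \<tau>) = (U2 \<tau> / \<sigma>\<^sup>2 + t3 a (\<sigma> * \<tau>) / z (\<sigma> * \<tau>) * (U1 \<tau> / \<sigma>)) * 1 + U \<tau> * 0 / (z (\<sigma> * \<tau>))\<^sup>2"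
      using laplacian_separable[OF p uU d, where ?V1.0 = "\<lambda>_. 0" and ?V2.0 = "\<lambda>_. 0"] unfolding i1 by simp
    then have "U2 \<tau> / \<sigma>\<^sup>2 + t3 a (\<sigma> * \<tau>) / z (\<sigma> * \<tau>) * (U1 \<tau> / \<sigma>) + (2 * c\<^sup>2 / z (\<sigma> * \<tau>) ^ 4 + 2) * U \<tau> = 0"
      using \<nu>(2)[OF p] sff_norm2_Psi[OF \<nu>(1) p] unfolding i1 uU by simp
    then have "\<sigma>\<^sup>2 * (U2 \<tau> / \<sigma>\<^sup>2 + t3 a (\<sigma> * \<tau>) / z (\<sigma> * \<tau>) * (U1 \<tau> / \<sigma>) + (2 * c\<^sup>2 / z (\<sigma> * \<tau>) ^ 4 + 2) * U \<tau>) = 0"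
      by simp
    note eq = this
    have r: "\<sigma>\<^sup>2 * (x / \<sigma>\<^sup>2 + k * (y / \<sigma>) + q * e) = x + \<sigma> * k * y + \<sigma>\<^sup>2 * q * e" for x k y q e
      using s1_pos by (simp add: field_simps power2_eq_square)
    have "U2 \<tau> + \<sigma> * (t3 a (\<sigma> * \<tau>) / z (\<sigma> * \<tau>)) * U1 \<tau> + \<sigma>\<^sup>2 * (2 * c\<^sup>2 / z (\<sigma> * \<tau>) ^ 4 + 2) * U \<tau> = 0"
      using eq unfolding r .
    then show ?thesis by (simp add: algebra_simps)
  qed
  have sol: "jacobi_solution U U1"
    unfolding jacobi_solution_def using d ode by simp
  have even: "U (- \<tau>) = U \<tau>" for \<tau>
  proof -
    have "u (vector [- \<tau>, 0]) = u (vector [\<tau>, 0])" using uk(4) by (simp add: reflection_even_def)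
    then show ?thesis unfolding uU by simp
  qed
  have U10: "U1 0 = 0"
  proof -
    have at: "at (0::real) within {-1..1} = at 0" by (rule at_within_interior) simp
    have "(U has_real_derivative U1 0) (at 0)" using d(1)[of 0] unfolding at by simp
    moreover have "((\<lambda>t. U (- t)) has_real_derivative U1 0 * - 1) (at 0)"
      by (rule DERIV_chain2[where g = uminus]) (use \<open>(U has_real_derivative U1 0) (at 0)\<close> in \<open>auto intro!: derivative_eq_intros\<close>)
    ultimately have "U1 0 = U1 0 * - 1" unfolding even by (rule DERIV_unique)
    then show ?thesis by simp
  qed
  have robin: "U1 1 + \<sigma> * (S \<sigma> / (z \<sigma>)\<^sup>2) * U 1 = 0"
  proof -
    have b: "?i 1 \<in> bdry" and p: "?i 1 \<in> strip" by (simp_all add: bdry_def strip_def axis_def)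
    have "pushfwd u (?i 1) = pushfwd (\<lambda>q. U (q $ 1) * (\<lambda>_. 1) (q $ 2)) (?i 1)" by (rule pushfwd_cong[OF p]) (simp add: uU)
    also have "\<dots> = (\<lambda>v. v $ 1 * (U1 (?i 1 $ 1) * 1) + v $ 2 * (U (?i 1 $ 1) * 0))"
      by (rule pushfwd_separable[OF p]) (use d(1)[of 1] in \<open>simp_all add: i1\<close>)
    finally have pf: "pushfwd u (?i 1) = (\<lambda>v. v $ 1 * (U1 (?i 1 $ 1) * 1) + v $ 2 * (U (?i 1 $ 1) * 0))" .
    have "pushfwd u (?i 1) (conormal (Psi a) (?i 1)) = U1 1 / \<sigma>"
      unfolding pf conormal_Psi[OF p] i1 by (simp add: axis_def)
    then have "U1 1 / \<sigma> + S \<sigma> / (z \<sigma>)\<^sup>2 * U 1 = 0" using uk(5)[OF b] unfolding cot_Rad uU i1 by simp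
    then have "\<sigma> * (U1 1 / \<sigma> + S \<sigma> / (z \<sigma>)\<^sup>2 * U 1) = 0" by simp
    then show ?thesis using s1_pos by (simp add: distrib_left mult.assoc)
  qed
  show ?thesis
  proof
    fix p
    show "u p = 0"
    proof (cases "p \<in> strip")
      case True
      then have "p $ 1 \<in> {-1..1}" by (auto simp: strip_def abs_le_iff)
      from even_solution_vanishes[OF sol U10 robin noncritical this] show ?thesis by (simp add: uU)
    qed (rule uk(2))
  qed
qed

lemma fun_dim_subset_zero:
  assumes "V \<subseteq> {\<lambda>_. 0}"
  shows "fun_dim V = 0"
proof -
  have "B = {}" if "finite B" "B \<subseteq> V" "real_fun.independent B" for B
  proof (rule ccontr)
    assume "B \<noteq> {}"
    then have "0 \<in> B" using that(2) assms by (force simp: zero_fun_def)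
    then show False using that(3) real_fun.dependent_zero by blast
  qed
  then have "fun_dim V \<le> 0"
    unfolding fun_dim_def by (intro SUP_least) (auto simp: zero_enat_def)
  then show ?thesis by simp
qed

section \<open>Non-congruence of different members\<close>

lemma S3_isometry_inner:
  assumes "S3_isometry f" "p \<in> S3" "q \<in> S3"
  shows "f p \<bullet> f q = p \<bullet> q"
proof -
  have S: "f p \<in> S3" "f q \<in> S3" using assms by (auto simp: S3_isometry_def)
  have bound: "\<bar>u \<bullet> v\<bar> \<le> 1" if "u \<in> S3" "v \<in> S3" for u v :: "real^4"
    using Cauchy_Schwarz_ineq2[of u v] that by simp
  have "arccos (f p \<bullet> f q) = arccos (p \<bullet> q)"
    using assms by (auto simp: S3_isometry_def sdist_def)
  then show ?thesis using bound[OF S] bound[OF assms(2,3)] by (simp add: arccos_eq_iff)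
qed

lemma S3_isometry_dist:
  assumes "S3_isometry f" "p \<in> S3" "q \<in> S3"
  shows "dist (f p) (f q) = dist p q"
proof -
  have S: "f p \<in> S3" "f q \<in> S3" using assms by (auto simp: S3_isometry_def)
  have "(dist u v)\<^sup>2 = 2 - 2 * (u \<bullet> v)" if "u \<in> S3" "v \<in> S3" for u v :: "real^4"
    using that by (simp add: dist_norm power2_norm_eq_inner inner_diff_left inner_diff_right inner_commute norm_eq_1)
  then have "(dist (f p) (f q))\<^sup>2 = (dist p q)\<^sup>2" using S assms S3_isometry_inner[OF assms] by simp
  then show ?thesis by (simp add: power2_eq_iff_nonneg)
qed

lemma S3_isometry_minus:
  assumes "S3_isometry f" "p \<in> S3"
  shows "f (- p) = - f p"
proof -
  have m: "- p \<in> S3" using assms by simp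
  have S: "f p \<in> S3" "f (- p) \<in> S3" using assms m by (auto simp: S3_isometry_def)
  have "f (- p) \<bullet> f p = - 1" using S3_isometry_inner[OF assms(1) m assms(2)] assms(2) by (simp add: norm_eq_1)
  then have "(f (- p) + f p) \<bullet> (f (- p) + f p) = 0"
    using S by (simp add: inner_add_left inner_add_right inner_commute norm_eq_1)
  then show ?thesis by (simp add: eq_neg_iff_add_eq_0)
qed

lemma congruent_sets_sym:
  assumes "congruent_sets M N" "M \<subseteq> S3"
  shows "congruent_sets N M"
proof -
  obtain f where f: "S3_isometry f" "f ` M = N" using assms(1) by (auto simp: congruent_sets_def)
  have inj: "inj_on f S3"
    using S3_isometry_dist[OF f(1)] by (metis dist_eq_0_iff inj_onI)
  define g where "g = inv_into S3 f"
  have fS: "f ` S3 = S3" using f(1) by (simp add: S3_isometry_def)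
  have g: "f (g q) = q" "g q \<in> S3" if "q \<in> S3" for q
    using f_inv_into_f[of q f S3] inv_into_into[of q f S3] that unfolding g_def fS by blast+
  have gf: "g (f p) = p" if "p \<in> S3" for p using inj that by (simp add: g_def)
  have "g ` S3 = S3"
  proof
    show "g ` S3 \<subseteq> S3" using g(2) by blast
    show "S3 \<subseteq> g ` S3"
    proof
      fix p assume p: "p \<in> S3"
      then have "f p \<in> S3" using fS by blast
      then show "p \<in> g ` S3" using gf[OF p] by (metis image_eqI)
    qed
  qed
  moreover have "sdist (g p) (g q) = sdist p q" if "p \<in> S3" "q \<in> S3" for p q
    using f(1) g that unfolding S3_isometry_def by metis
  ultimately have "S3_isometry g" by (simp add: S3_isometry_def)
  moreover have "g ` N = M" using f(2) gf assms(2) by (force simp: image_image)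
  ultimately show ?thesis by (auto simp: congruent_sets_def)
qed

context annulus_parameter
begin

lemma X_imm_in_S3: "X_imm a p \<in> S3"
proof -
  have "X_imm a p = Psi a (vector [p $ 1 / \<sigma>, p $ 2])"
    using s1_pos by (simp add: Psi_def X_imm_def)
  then show ?thesis using frame(1) by (simp add: norm_eq_1)
qed

lemma Sigma_set_eq: "Sigma_set a = {X_imm a (vector [s, \<theta>]) |s \<theta>. \<bar>s\<bar> \<le> \<sigma>}"
proof -
  have "p = vector [p $ 1, p $ 2]" for p :: "real^2" by (simp add: vec_eq_iff forall_2)
  then show ?thesis unfolding Sigma_set_def by (smt (verit) Collect_cong image_Collect vector_2(1))
qed

lemma antipodal_height_exists: "\<exists>s. 0 < s \<and> s < \<sigma> \<and> B s = pi / 2"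
proof -
  have "pi / 2 < B \<sigma>"
  proof (rule ccontr)
    assume "\<not> ?thesis"
    then have "0 \<le> cos (B \<sigma>)" using B_bounds(1)[of \<sigma>] s1_pos s1_less by (intro cos_ge_zero) auto
    then show False using cos_B_s1_neg by simp
  qed
  moreover have "continuous_on {0..\<sigma>} B"
    by (rule DERIV_continuous_on, rule has_field_derivative_at_within, rule B_deriv)
  ultimately obtain s where s: "0 \<le> s" "s \<le> \<sigma>" "B s = pi / 2"
    using IVT'[of B 0 "pi / 2" \<sigma>] s1_pos by auto
  moreover have "s \<noteq> 0" using s by auto
  moreover have "s \<noteq> \<sigma>" using s \<open>pi / 2 < B \<sigma>\<close> by auto
  ultimately show ?thesis by (intro exI[of _ s]) auto
qed

definition s0 where "s0 = (SOME s. 0 < s \<and> s < \<sigma> \<and> B s = pi / 2)"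

lemma s0: "0 < s0" "s0 < \<sigma>" "B s0 = pi / 2"
  using someI_ex[OF antipodal_height_exists] by (auto simp: s0_def)

lemma X_imm_s0: "X_imm a (vector [s0, \<theta>]) = vector [0, L s0, z s0 * cos \<theta>, z s0 * sin \<theta>]"
  by (simp add: X_imm_def xx_eq yy_eq s0(3))

lemma antipodal_circle:
  "X_imm a (vector [s0, \<theta>]) \<in> Sigma_set a" "- X_imm a (vector [s0, \<theta>]) \<in> Sigma_set a"
proof -
  show "X_imm a (vector [s0, \<theta>]) \<in> Sigma_set a"
    unfolding Sigma_set_eq using s0 by (intro CollectI exI[of _ s0] exI[of _ \<theta>]) auto
  have "- X_imm a (vector [s0, \<theta>]) = X_imm a (vector [- s0, \<theta> + pi])"
    by (simp add: vec_eq_iff forall_4 X_imm_s0) (simp add: X_imm_def parity xx_eq yy_eq s0(3) beta_minus)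
  then show "- X_imm a (vector [s0, \<theta>]) \<in> Sigma_set a"
    unfolding Sigma_set_eq using s0 by (intro CollectI exI[of _ "- s0"] exI[of _ "\<theta> + pi"]) auto
qed

text \<open>Equal \<open>z\<close> forces \<open>t = \<plusminus> s\<close>. The sign \<open>+\<close> would make \<open>x\<close> and \<open>y\<close> vanish together; the sign \<open>-\<close> gives \<open>x = 0\<close>,
  that is \<open>\<beta> = \<plusminus> \<pi>/2\<close>.\<close>

lemma antipodal_pair:
  assumes "q \<in> Sigma_set a" "- q \<in> Sigma_set a"
  shows "q $ 1 = 0" "q $ 2 \<in> {L s0, - L s0}"
proof -
  obtain s \<theta> where q: "q = X_imm a (vector [s, \<theta>])" "\<bar>s\<bar> \<le> \<sigma>"
    using assms(1) unfolding Sigma_set_eq by blast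
  obtain t \<phi> where q': "- q = X_imm a (vector [t, \<phi>])" "\<bar>t\<bar> \<le> \<sigma>"
    using assms(2) unfolding Sigma_set_eq by blast
  have eq: "- X_imm a (vector [s, \<theta>]) = X_imm a (vector [t, \<phi>])" using q q' by simp
  have e: "- xx a s = xx a t" "- yy a s = yy a t" "- (z s * cos \<theta>) = z t * cos \<phi>" "- (z s * sin \<theta>) = z t * sin \<phi>"
    using arg_cong[OF eq, of "\<lambda>v. v $ 1"] arg_cong[OF eq, of "\<lambda>v. v $ 2"]
      arg_cong[OF eq, of "\<lambda>v. v $ 3"] arg_cong[OF eq, of "\<lambda>v. v $ 4"] by (simp_all add: X_imm_def)
  have "(z t)\<^sup>2 = (z s)\<^sup>2"
    using polar_34[of t \<phi>] polar_34[of s \<theta>] unfolding e(3,4)[symmetric] by simp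
  then have "cos (2 * t) = cos (2 * s)" using a_pos by (simp add: zz_sq)
  then have "cos (2 * \<bar>t\<bar>) = cos (2 * \<bar>s\<bar>)" by (cases "t \<ge> 0"; cases "s \<ge> 0") auto
  then have "2 * \<bar>t\<bar> = 2 * \<bar>s\<bar>"
    by (rule cos_inj_pi[rotated 4]) (use q(2) q'(2) s1_less in auto)
  then have ts: "t = s \<or> t = - s" by (auto simp: abs_eq_iff)
  have "t \<noteq> s"
  proof
    assume "t = s"
    then have "xx a s = 0" "yy a s = 0" using e(1,2) by auto
    then have "cos (B s) = 0" "sin (B s) = 0" by (auto simp: xx_eq yy_eq)
    then show False using sin_cos_squared_add[of "B s"] by simp
  qed
  then have t: "t = - s" using ts by blast
  then have x0: "xx a s = 0" using e(1) by (simp add: parity)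
  then show "q $ 1 = 0" by (simp add: q X_imm_def)
  have "cos (B s) = 0" using x0 by (simp add: xx_eq)
  then have "cos \<bar>B s\<bar> = cos (pi / 2)" by simp
  then have "\<bar>B s\<bar> = pi / 2"
    by (rule cos_inj_pi[rotated 4]) (use B_abs_less[OF q(2)] in auto)
  then have "B s = B s0 \<or> B s = B (- s0)" using s0(3) by (auto simp: beta_minus abs_if split: if_splits)
  then have "s = s0 \<or> s = - s0" using B_inj by blast
  then show "q $ 2 \<in> {L s0, - L s0}"
    by (auto simp: q X_imm_def parity yy_eq s0(3) beta_minus)
qed

end

text \<open>The maximal radius \<open>\<surd>(1/2 + a)\<close> of the circles of rotation is recovered from the set alone: the points whose antipode also lies in
  the surface form two parallel circles, and an isometry maps the plane of such a circle to the plane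
  of the corresponding circle.\<close>

lemma congruent_imp_le:
  assumes "annulus_parameter a" "annulus_parameter b" "congruent_sets (Sigma_set a) (Sigma_set b)"
  shows "a \<le> b"
proof -
  interpret a: annulus_parameter a by fact
  interpret b: annulus_parameter b by fact
  obtain f where f: "S3_isometry f" "f ` Sigma_set a = Sigma_set b"
    using assms(3) by (auto simp: congruent_sets_def)
  define P where "P = (\<lambda>\<theta>. X_imm a (vector [a.s0, \<theta>]))"
  have PS: "P \<theta> \<in> S3" for \<theta> unfolding P_def by (rule a.X_imm_in_S3)
  have img: "f (P \<theta>) $ 1 = 0" "f (P \<theta>) $ 2 \<in> {b.L b.s0, - b.L b.s0}" for \<theta>
  proof -
    have "f (P \<theta>) \<in> Sigma_set b" "f (- P \<theta>) \<in> Sigma_set b"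
      using a.antipodal_circle[of \<theta>] f(2) by (auto simp: P_def)
    then have *: "f (P \<theta>) \<in> Sigma_set b" "- f (P \<theta>) \<in> Sigma_set b"
      using S3_isometry_minus[OF f(1) PS] by auto
    show "f (P \<theta>) $ 1 = 0" "f (P \<theta>) $ 2 \<in> {b.L b.s0, - b.L b.s0}"
      by (rule b.antipodal_pair[OF *])+
  qed
  (* the second coordinate takes two values on the image of a circle, hence only one *)
  have "continuous_on S3 f"
    unfolding continuous_on_iff using S3_isometry_dist[OF f(1)] by metis
  moreover have "continuous_on UNIV P"
    unfolding P_def a.X_imm_s0 vector_4_eq by (intro continuous_intros)
  ultimately have "continuous_on UNIV (\<lambda>\<theta>. f (P \<theta>))"
    by (rule continuous_on_compose2) (use PS in auto)
  then have "continuous_on UNIV (\<lambda>\<theta>. f (P \<theta>) $ 2)" by (intro continuous_intros)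
  then have "connected (range (\<lambda>\<theta>. f (P \<theta>) $ 2))" by (rule connected_continuous_image) simp
  moreover have "finite (range (\<lambda>\<theta>. f (P \<theta>) $ 2))"
    by (rule finite_subset[of _ "{b.L b.s0, - b.L b.s0}"]) (use img(2) in blast)+
  ultimately obtain h where h: "range (\<lambda>\<theta>. f (P \<theta>) $ 2) = {h}"
    using connected_finite_iff_sing[of "range (\<lambda>\<theta>. f (P \<theta>) $ 2)"] by auto
  then have h: "f (P \<theta>) $ 2 = h" for \<theta> by blast
  define v where "v = f (P 0) - f (P pi)"
  have v12: "v $ 1 = 0" "v $ 2 = 0" using img(1) h by (simp_all add: v_def)
  have nv: "norm v = 2 * a.z a.s0"
  proof -
    have "norm v = dist (P 0) (P pi)"
      unfolding v_def dist_norm[symmetric] by (rule S3_isometry_dist[OF f(1) PS PS])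
    also have "P 0 - P pi = (2 * a.z a.s0) *\<^sub>R axis 3 1"
      by (simp add: P_def a.X_imm_s0 vec_eq_iff forall_4 axis_def)
    then have "dist (P 0) (P pi) = 2 * a.z a.s0"
      unfolding dist_norm using a.zz_pos[of a.s0] by simp
    finally show ?thesis .
  qed
  define w where "w = X_imm a (vector [0, 0])"
  have w: "w \<in> Sigma_set a" "w \<in> S3"
    unfolding w_def a.Sigma_set_eq using a.s1_pos a.X_imm_in_S3 by (auto intro!: exI[of _ 0])
  have "f w \<in> Sigma_set b" using w f(2) by blast
  then obtain s \<theta> where fw: "f w = X_imm b (vector [s, \<theta>])" unfolding b.Sigma_set_eq by blast
  have "2 * a.z a.s0 * a.z 0 = w \<bullet> P 0 - w \<bullet> P pi"
    by (simp add: w_def P_def a.X_imm_s0 X_imm_def inner_4)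
  also have "\<dots> = f w \<bullet> v"
    unfolding v_def inner_diff_right using S3_isometry_inner[OF f(1) w(2) PS] by simp
  also have "\<dots> = b.z s * (vector [0, 0, cos \<theta>, sin \<theta>] \<bullet> v)"
    by (simp add: fw X_imm_def inner_4 v12 algebra_simps)
  also have "\<dots> \<le> b.z s * norm v"
  proof -
    have "(vector [0, 0, cos \<theta>, sin \<theta>] :: real^4) \<bullet> vector [0, 0, cos \<theta>, sin \<theta>] = 1"
      by (simp add: inner_4 flip: power2_eq_square)
    then have "norm (vector [0, 0, cos \<theta>, sin \<theta>] :: real^4) = 1" by (simp add: norm_eq_1)
    then have "vector [0, 0, cos \<theta>, sin \<theta>] \<bullet> v \<le> norm v"
      using norm_cauchy_schwarz[of "vector [0, 0, cos \<theta>, sin \<theta>] :: real^4" v] by simp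
    then show ?thesis using b.zz_pos[of s] by (intro mult_left_mono) auto
  qed
  finally have "a.z 0 \<le> b.z s" unfolding nv using a.zz_pos[of a.s0] by simp
  then have "(a.z 0)\<^sup>2 \<le> (b.z s)\<^sup>2" using a.zz_pos[of 0] by (intro power_mono) auto
  then have "a \<le> b * cos (2 * s)" by (simp add: a.zz_sq b.zz_sq)
  also have "\<dots> \<le> b" using b.a_pos by (simp add: mult_left_le)
  finally show ?thesis .
qed

lemma not_congruent:
  assumes "annulus_parameter a" "annulus_parameter b" "a \<noteq> b"
  shows "\<not> congruent_sets (Sigma_set a) (Sigma_set b)"
proof
  assume c: "congruent_sets (Sigma_set a) (Sigma_set b)"
  have "Sigma_set a \<subseteq> S3"
    unfolding Sigma_set_def using annulus_parameter.X_imm_in_S3[OF assms(1)] by blast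
  from congruent_sets_sym[OF c this] show False
    using congruent_imp_le[OF assms(1,2) c] congruent_imp_le[OF assms(2,1)] assms(3) by force
qed

section \<open>The radius map and the degenerate annuli\<close>

theorem theoremA:
  defines "I \<equiv> {0<..<1/2::real}"
  shows
    "(real_analytic_on I Rad \<and> (\<forall>a\<in>I. Rad a > pi / 2) \<and>
      (Rad \<longlongrightarrow> pi / 2) (at_right 0) \<and> (Rad \<longlongrightarrow> pi / 2) (at_left (1/2)) \<and>
      \<not> mono_on I Rad \<and> \<not> antimono_on I Rad \<and>
      (\<exists>a\<in>I. \<forall>b\<in>I. Rad b \<le> Rad a) \<and> \<not> inj_on Rad I) \<and>
     (\<forall>r. pi / 2 < r \<and> r < (SUP a\<in>I. Rad a) \<longrightarrow>
        finite {a\<in>I. Rad a = r} \<and> card {a\<in>I. Rad a = r} \<ge> 2 \<and>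
        pairwise (\<lambda>a b. \<not> congruent_sets (Sigma_set a) (Sigma_set b)) {a\<in>I. Rad a = r} \<and>
        (\<forall>a\<in>I. Rad a = r \<longrightarrow>
           embedded_annulus (Psi a) \<and> free_boundary_minimal_annulus r (Psi a))) \<and>
     ((\<forall>a\<in>I. deriv Rad a = 0 \<longrightarrow>
         degenerate (Psi a) (Rad a) \<and> nul (Psi a) (Rad a) \<ge> 3 \<and>
         (\<forall>\<nu>. smooth_normal_family \<nu> \<longrightarrow>
            phi \<nu> a \<in> jacobi_robin_kernel (Psi a) (Rad a) \<and> phi \<nu> a \<noteq> (\<lambda>_. 0) \<and>
            rotation_invariant (phi \<nu> a) \<and> reflection_even (phi \<nu> a) \<and>
            \<not> killing_induced (Psi a) (Rad a) (phi \<nu> a))) \<and>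
      (\<forall>a\<in>I. (\<forall>b\<in>I. Rad b \<le> Rad a) \<longrightarrow> deriv Rad a = 0)) \<and>
     (discrete {a\<in>I. deriv Rad a = 0} \<and>
      (\<forall>a\<in>I. deriv Rad a \<noteq> 0 \<longrightarrow> fun_dim (kernel_ev (Psi a) (Rad a)) = 0))"
proof -
  have par: "annulus_parameter a" if "a \<in> I" for a using that by (auto simp: I_def annulus_parameter_def)
  obtain m where m: "m \<in> I" "\<And>a. a \<in> I \<Longrightarrow> Rad a \<le> Rad m"
    using Rad.maximum unfolding I_def by blast
  have sup: "(SUP a\<in>I. Rad a) = Rad m"
    by (rule cSup_eq_maximum) (use m in auto)
  have max_critical: "deriv Rad a = 0" if a: "a \<in> I" and max: "\<forall>b\<in>I. Rad b \<le> Rad a" for a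
  proof (rule DERIV_local_max[where x = a and f = Rad])
    interpret annulus_parameter a by (rule par[OF a])
    show "(Rad has_real_derivative deriv Rad a) (at a)"
      using Rad_deriv DERIV_imp_deriv by metis
    show "0 < min a (1/2 - a)" using a_pos a_less by simp
    show "\<forall>b. \<bar>a - b\<bar> < min a (1/2 - a) \<longrightarrow> Rad b \<le> Rad a"
      using max by (auto simp: I_def abs_less_iff)
  qed
  have level: "finite {a\<in>I. Rad a = r} \<and> card {a\<in>I. Rad a = r} \<ge> 2 \<and>
      pairwise (\<lambda>a b. \<not> congruent_sets (Sigma_set a) (Sigma_set b)) {a\<in>I. Rad a = r} \<and>
      (\<forall>a\<in>I. Rad a = r \<longrightarrow> embedded_annulus (Psi a) \<and> free_boundary_minimal_annulus r (Psi a))"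
    if r: "pi / 2 < r" "r < (SUP a\<in>I. Rad a)" for r
  proof (intro conjI ballI impI)
    show "finite {a\<in>I. Rad a = r}" unfolding I_def by (rule Rad.finite_level[OF r(1)])
    show "2 \<le> card {a\<in>I. Rad a = r}"
      unfolding I_def by (rule Rad.two_le_card_level[OF m(1)[unfolded I_def] r(1)]) (use r(2) sup in simp)
    show "pairwise (\<lambda>a b. \<not> congruent_sets (Sigma_set a) (Sigma_set b)) {a\<in>I. Rad a = r}"
      using not_congruent par by (auto simp: pairwise_def)
    fix a assume a: "a \<in> I" "Rad a = r"
    show "embedded_annulus (Psi a)" by (rule annulus_parameter.embedded[OF par[OF a(1)]])
    show "free_boundary_minimal_annulus r (Psi a)"
      using annulus_parameter.free_boundary[OF par[OF a(1)]] a(2) by simp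
  qed
  have noncritical: "fun_dim (kernel_ev (Psi a) (Rad a)) = 0" if "a \<in> I" "deriv Rad a \<noteq> 0" for a
    using annulus_parameter.kernel_ev_noncritical[OF par[OF that(1)] _ that(2)]
    by (intro fun_dim_subset_zero) auto
  have critical: "degenerate (Psi a) (Rad a)" "nul (Psi a) (Rad a) \<ge> 3"
      "smooth_normal_family \<nu> \<Longrightarrow> phi \<nu> a \<in> jacobi_robin_kernel (Psi a) (Rad a) \<and> phi \<nu> a \<noteq> (\<lambda>_. 0) \<and>
        rotation_invariant (phi \<nu> a) \<and> reflection_even (phi \<nu> a) \<and> \<not> killing_induced (Psi a) (Rad a) (phi \<nu> a)"
    if a: "a \<in> I" "deriv Rad a = 0" for a \<nu>
    using annulus_parameter.degenerate_critical[OF par[OF a(1)] a(2)]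
      annulus_parameter.nul_ge_3[OF par[OF a(1)] a(2)]
      annulus_parameter.phi_properties[OF par[OF a(1)] _ a(2), of \<nu>] by blast+
  have gt: "Rad a > pi / 2" if "a \<in> I" for a by (rule annulus_parameter.Rad_gt[OF par[OF that]])
  show ?thesis
  proof (intro conjI)
    show "real_analytic_on I Rad" unfolding I_def by (rule Rad_real_analytic)
    show "\<forall>a\<in>I. Rad a > pi / 2" using gt by blast
    show "(Rad \<longlongrightarrow> pi / 2) (at_right 0)" by (rule Rad_tendsto_0)
    show "(Rad \<longlongrightarrow> pi / 2) (at_left (1/2))" by (rule Rad_tendsto_half)
    show "\<not> mono_on I Rad" unfolding I_def by (rule Rad.not_mono)
    show "\<not> antimono_on I Rad" unfolding I_def by (rule Rad.not_antimono)
    show "\<exists>a\<in>I. \<forall>b\<in>I. Rad b \<le> Rad a" using m by blast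
    show "\<not> inj_on Rad I" unfolding I_def by (rule Rad.not_inj)
    show "discrete {a\<in>I. deriv Rad a = 0}" unfolding I_def by (rule Rad.critical_discrete)
  qed (use level critical max_critical noncritical in blast)+
qed

end
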